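(* There exists an absolute constant $c>0$ such that for every finite nonempty set $S\subset\mathbb{Z}^2$ and every $\phi\in L^2(\mathbb{T}^2)$, \[ \|e^{it\Delta}P_S\phi\|_{L^4_{t,x}([0,2\pi]\times\mathbb{T}^2)}\le c\,(\log\#S)^{1/4}\,\|\phi\|_{L^2(\mathbb{T}^2)}. \]
   Context: $\mathbb{T}^2=(\mathbb{R}/2\pi\mathbb{Z})^2$. For $f:\mathbb{T}^2\to\mathbb{C}$, $\widehat f(\xi)$, $\xi\in\mathbb{Z}^2$, denotes its Fourier coefficients. For $S\subset\mathbb{Z}^2$, $P_S$ is the Fourier multiplier $\widehat{P_Sf}=\chi_S\widehat f$ ($\chi_S$ the indicator of $S$). For $t\in\mathbb{R}$, $e^{it\Delta}\phi$ is defined by $\widehat{e^{it\Delta}\phi}(\xi)=e^{-it|\xi|^2}\widehat\phi(\xi)$. $\#S$ is the cardinality of $S$, and $\log x:=\max\{1,\log_e x\}$ for $x>0$. *)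

theory Defs
  imports "HOL-Analysis.Analysis"
begin

text \<open>The torus T^2 is represented by the fundamental domain [0,2pi]^2 with Lebesgue measure.\<close>

definition torus_box :: "(real \<times> real) set" where
  "torus_box = {0..2*pi} \<times> {0..2*pi}"

text \<open>Convention of the paper: log x = max 1 (ln x).\<close>
definition logp :: "real \<Rightarrow> real" where
  "logp x = max 1 (ln x)"

definition fourier_coeff :: "(real \<times> real \<Rightarrow> complex) \<Rightarrow> int \<times> int \<Rightarrow> complex" where
  "fourier_coeff f \<xi> = (1 / (2 * pi)^2) *
     (LINT x:torus_box|lborel. f x *
        exp (- \<i> * complex_of_real (of_int (fst \<xi>) * fst x + of_int (snd \<xi>) * snd x)))"

definition schrod_proj :: "(int \<times> int) set \<Rightarrow> (real \<times> real \<Rightarrow> complex) \<Rightarrow> real \<Rightarrow> real \<times> real \<Rightarrow> complex" where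
  "schrod_proj S \<phi> t x = (\<Sum>\<xi>\<in>S.
     exp (- \<i> * complex_of_real (t * of_int ((fst \<xi>)^2 + (snd \<xi>)^2))) * fourier_coeff \<phi> \<xi> *
     exp (\<i> * complex_of_real (of_int (fst \<xi>) * fst x + of_int (snd \<xi>) * snd x)))"

definition L2_torus :: "(real \<times> real \<Rightarrow> complex) \<Rightarrow> real" where
  "L2_torus f = sqrt (LINT x:torus_box|lborel. (cmod (f x))^2)"

definition L4_time_torus :: "(real \<Rightarrow> real \<times> real \<Rightarrow> complex) \<Rightarrow> real" where
  "L4_time_torus u = (LINT p:({0..2*pi} \<times> torus_box)|lborel. (cmod (u (fst p) (snd p)))^4) powr (1/4)"

end

theory Submission
  imports Defs "HOL-Library.Discrete_Functions"
begin

text \<open>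
  By orthogonality, the fourth power of the \<open>L\<^sup>4\<close> norm is \<open>(2\<pi>)\<^sup>3\<close> times a sum of
  \<open>c a * cnj (c b) * c c * cnj (c d)\<close> over all (possibly degenerate) rectangles \<open>a b c d\<close> with
  vertices in \<open>S\<close>, so the theorem is a weighted count of rectangles.  Sort \<open>S\<close> by decreasing
  modulus of the coefficients and cut it into levels \<open>S\<^sub>i\<close> of size at most \<open>2\<^sup>i\<close>; there are
  about \<open>log #S\<close> of them.  A line is superrich for level \<open>i\<close> if it contains more than
  \<open>2 * sqrt (2\<^sup>i)\<close> points of \<open>S\<^sub>i\<close>; by Cauchy-Schwarz the superrich lines of a level have only
  \<open>O(2\<^sup>i)\<close> incidences with it.  Consider the corner \<open>b\<close> opposite to a vertex \<open>d\<close> of highest level.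
  If neither side at \<open>b\<close> is superrich for the level of its other end point, the bound
  \<open>O(4\<^sup>i / s\<^sup>3)\<close> of Szemeredi and Trotter for the number of lines with at least \<open>s\<close> points of
  \<open>S\<^sub>i\<close> counts the rectangles; one factor \<open>log #S\<close> comes from the dyadic scales of \<open>s\<close>.  In the
  remaining cases the rectangles are handled by Cauchy-Schwarz, because a superrich line through
  a vertex leaves essentially no choice for the direction of the sides.  The rich line bound
  follows from the crossing lemma, which needs only that a plane graph with straight edges has
  at most four edges per vertex.
\<close>

subsection \<open>Plane geometric graphs and rich lines\<close>

text \<open>The exponent 1/4 leaves room for a single logarithm, while the scales of
  \<open>s\<close> cost one and so may the free sums over levels. Two devices prevent a double loss.
  The vertex \<open>d\<close> of highest level l is determined by the other three, so its small
  coefficient contributes a factor 2^(-l/2) that is not spent on the count. In the case without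
  superrich sides this leaves, between the levels j of \<open>b\<close> and l of \<open>d\<close>,
  the kernel 6 m (9/10)^(l-j) + 4, where m is the number of levels. The part that carries the
  logarithm of the scales decays away from the diagonal, so its summation over levels is free; the
  part without decay carries no such logarithm and can afford one for the levels. The superrich
  threshold lies inside the range where the cubic bound for rich lines holds; for the lines beyond
  it, it is enough that two lines have at most one common point. The constant 72000024 only records
  the steps: 6000002 for the rectangles, 3 for comparing m with \<open>logp\<close>, and 4 = 2^2 for
  replacing the coefficients by their majorant.\<close>

type_synonym pt = "real \<times> real"

text \<open>An edge is stored with its left end point first, so that it is the graph of the affine
  function \<open>seg_y\<close> over the interval from \<open>lx\<close> to
  \<open>rx\<close>.\<close>

definition lx :: "pt \<times> pt \<Rightarrow> real" where "lx e = fst (fst e)"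
definition rx :: "pt \<times> pt \<Rightarrow> real" where "rx e = fst (snd e)"
definition slope :: "pt \<times> pt \<Rightarrow> real" where
  "slope e = (snd (snd e) - snd (fst e)) / (rx e - lx e)"
definition seg_y :: "pt \<times> pt \<Rightarrow> real \<Rightarrow> real" where
  "seg_y e x = snd (fst e) + slope e * (x - lx e)"
text \<open>Only abscissas interior to both edges count: edges may share an end point without
  crossing, whereas two edges that overlap in a piece do cross.\<close>

definition crosses :: "pt \<times> pt \<Rightarrow> pt \<times> pt \<Rightarrow> bool" where
  "crosses e g \<longleftrightarrow> e \<noteq> g \<and> (\<exists>x. lx e < x \<and> x < rx e \<and> lx g < x \<and> x < rx g \<and> seg_y e x = seg_y g x)"

lemma seg_y_left [simp]: "seg_y e (lx e) = snd (fst e)"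
  by (simp add: seg_y_def)

lemma seg_y_right: "lx e < rx e \<Longrightarrow> seg_y e (rx e) = snd (snd e)"
  by (simp add: seg_y_def slope_def)

lemma continuous_on_seg_y: "continuous_on A (seg_y e)"
  unfolding seg_y_def by (intro continuous_intros)

text \<open>The intermediate value theorem for the difference of two affine functions, in either
  direction. A strict inequality at an end point keeps the root away from it.\<close>

lemma seg_y_root:
  assumes "seg_y e a < seg_y g a" "seg_y g b \<le> seg_y e b" "a < b \<or> b < a"
  obtains y where "seg_y e y = seg_y g y" "min a b \<le> y" "y \<le> max a b" "y \<noteq> a" "seg_y g b < seg_y e b \<Longrightarrow> y \<noteq> b"
proof -
  let ?h = "\<lambda>x. seg_y e x - seg_y g x"
  have c: "continuous_on A ?h" for A by (intro continuous_intros continuous_on_seg_y)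
  have "\<exists>y. min a b \<le> y \<and> y \<le> max a b \<and> ?h y = 0"
  proof (cases "a < b")
    case True
    then show ?thesis using IVT'[of ?h a 0 b, OF _ _ _ c] assms by (auto simp: min_def max_def)
  next
    case False
    then show ?thesis using IVT2'[of ?h a 0 b, OF _ _ _ c] assms by (auto simp: min_def max_def)
  qed
  then show ?thesis using assms that by force
qed

text \<open>A reversal of the order between \<open>x\<close> and \<open>x0\<close> would produce an
  interior crossing. Equality at \<open>x\<close> itself is excluded only if both edges continue to
  the left of \<open>x\<close>, since they may start at a common point.\<close>

lemma noncrossing_order_left:
  assumes "\<not> crosses e g" and "x0 \<le> rx e" "x0 \<le> rx g" "seg_y e x0 < seg_y g x0"
    and "lx e \<le> x" "lx g \<le> x" "x < x0"
  shows "seg_y e x \<le> seg_y g x" and "lx e < x \<Longrightarrow> lx g < x \<Longrightarrow> seg_y e x < seg_y g x"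
proof -
  have ne: "e \<noteq> g" using assms by auto
  show "seg_y e x \<le> seg_y g x"
  proof (rule ccontr)
    assume "\<not> ?thesis"
    then have *: "seg_y g x < seg_y e x" by simp
    obtain y where "seg_y e y = seg_y g y" "min x0 x \<le> y" "y \<le> max x0 x" "y \<noteq> x0" "y \<noteq> x"
      using seg_y_root[of e x0 g x] assms * by (metis less_imp_le)
    then show False using assms ne unfolding crosses_def by (auto simp: min_def max_def split: if_splits)
  qed
  assume l: "lx e < x" "lx g < x"
  show "seg_y e x < seg_y g x"
  proof (rule ccontr)
    assume "\<not> ?thesis"
    then have *: "seg_y g x \<le> seg_y e x" by simp
    obtain y where "seg_y e y = seg_y g y" "min x0 x \<le> y" "y \<le> max x0 x" "y \<noteq> x0"
      using seg_y_root[of e x0 g x] assms * by metis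
    then show False using assms ne l unfolding crosses_def by (auto simp: min_def max_def split: if_splits)
  qed
qed

text \<open>The condition \<open>inj\<close> makes a vertex recoverable from its abscissa, so that
  leftmost vertices are well defined; \<open>exists_shear\<close> arranges it later.\<close>

locale plane_graph =
  fixes V :: "pt set" and E :: "(pt \<times> pt) set"
  assumes finV: "finite V" and inj: "inj_on fst V"
    and EV: "\<And>e. e \<in> E \<Longrightarrow> fst e \<in> V \<and> snd e \<in> V \<and> lx e < rx e"
    and nocross: "\<And>e g. e \<in> E \<Longrightarrow> g \<in> E \<Longrightarrow> \<not> crosses e g"
    and novert: "\<And>e v. e \<in> E \<Longrightarrow> v \<in> V \<Longrightarrow> lx e < fst v \<Longrightarrow> fst v < rx e \<Longrightarrow> snd v \<noteq> seg_y e (fst v)"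
begin

lemma finE: "finite E"
proof (rule finite_subset)
  show "E \<subseteq> V \<times> V" using EV by force
qed (use finV in simp)

text \<open>Two such edges overlap near their left end point, so distinct ones would cross. Hence
  the edges leaving a vertex to the right are strictly ordered by slope.\<close>

lemma same_left_slope:
  assumes "e \<in> E" "g \<in> E" "fst e = fst g" "slope e = slope g"
  shows "e = g"
proof (rule ccontr)
  assume ne: "e \<noteq> g"
  have l: "lx e = lx g" using assms by (simp add: lx_def)
  have "seg_y e = seg_y g" using assms l by (auto simp: seg_y_def)
  moreover obtain x where "lx e < x" "x < min (rx e) (rx g)"
    using dense[of "lx e" "min (rx e) (rx g)"] EV[OF assms(1)] EV[OF assms(2)] l by auto
  ultimately show False using nocross[OF assms(1,2)] ne l by (auto simp: crosses_def)
qed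

text \<open>
  An edge that is not the steepest one leaving its left end point is charged to the leftmost
  vertex of the wedge between it and the next steeper edge at that point.  No edge enters the
  wedge before this vertex, so every vertex is charged at most three times: as the right end of
  the lower edge, as the right end of the upper edge, and from the interior of the wedge.
\<close>

definition above :: "pt \<times> pt \<Rightarrow> (pt \<times> pt) set" where
  "above e = {g \<in> E. fst g = fst e \<and> slope e < slope g}"

definition inner :: "(pt \<times> pt) set" where "inner = {e \<in> E. above e \<noteq> {}}"

definition up :: "pt \<times> pt \<Rightarrow> pt \<times> pt" where
  "up e = arg_min_on slope (above e)"

definition wedge :: "pt \<times> pt \<Rightarrow> pt set" where
  "wedge e = {v \<in> V. lx e < fst v \<and> fst v \<le> rx e \<and> fst v \<le> rx (up e) \<and>
     seg_y e (fst v) \<le> snd v \<and> snd v \<le> seg_y (up e) (fst v)}"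

definition first_vertex :: "pt \<times> pt \<Rightarrow> pt" where
  "first_vertex e = arg_min_on fst (wedge e)"

lemma up_props:
  assumes "e \<in> inner"
  shows "up e \<in> E" "fst (up e) = fst e" "lx (up e) = lx e" "slope e < slope (up e)"
    "\<And>h. h \<in> E \<Longrightarrow> fst h = fst e \<Longrightarrow> slope e < slope h \<Longrightarrow> slope (up e) \<le> slope h"
proof -
  have "finite (above e)" "above e \<noteq> {}" using assms finE by (auto simp: above_def inner_def)
  then have *: "up e \<in> above e" "h \<in> above e \<Longrightarrow> slope (up e) \<le> slope h" for h
    using arg_min_if_finite[of "above e" slope] unfolding up_def by (auto simp: not_less)
  show "up e \<in> E" "fst (up e) = fst e" "slope e < slope (up e)" "lx (up e) = lx e"
    using *(1) by (auto simp: above_def lx_def)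
  show "slope (up e) \<le> slope h" if "h \<in> E" "fst h = fst e" "slope e < slope h" for h
    using *(2)[of h] that by (simp add: above_def)
qed

lemma inner_E: "e \<in> inner \<Longrightarrow> e \<in> E" by (simp add: inner_def)

lemma up_above:
  assumes "e \<in> inner" "lx e < x"
  shows "seg_y e x < seg_y (up e) x"
  using up_props[OF assms(1)] assms(2) by (simp add: seg_y_def)

text \<open>The wedge is not empty because it contains the right end point of whichever of its two
  edges ends first.\<close>

lemma first_vertex_props:
  assumes "e \<in> inner"
  shows "first_vertex e \<in> wedge e" "\<And>u. u \<in> wedge e \<Longrightarrow> fst (first_vertex e) \<le> fst u"
proof -
  note u = up_props[OF assms]
  note e = EV[OF inner_E[OF assms]] and e' = EV[OF u(1)]
  have "wedge e \<noteq> {}"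
  proof (cases "rx e \<le> rx (up e)")
    case True
    then have "snd e \<in> wedge e" using e seg_y_right[of e] up_above[OF assms, of "rx e"]
      by (auto simp: wedge_def rx_def[symmetric])
    then show ?thesis by blast
  next
    case False
    then have "snd (up e) \<in> wedge e" using e' u(3) seg_y_right[of "up e"] up_above[OF assms, of "rx (up e)"]
      by (auto simp: wedge_def rx_def[symmetric])
    then show ?thesis by blast
  qed
  moreover have "finite (wedge e)" using finV by (simp add: wedge_def)
  ultimately show "first_vertex e \<in> wedge e" "\<And>u. u \<in> wedge e \<Longrightarrow> fst (first_vertex e) \<le> fst u"
    using arg_min_if_finite[of "wedge e" fst] unfolding first_vertex_def by (auto simp: not_less)
qed

text \<open>Followed to the left from \<open>x0\<close>, the edge \<open>g\<close> stays between the
  two sides of the wedge. If it starts to the right of the apex, its left end point is a vertex of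
  the wedge before the first one. Otherwise it reaches the apex; it cannot pass through a vertex, so
  it starts there with a slope between those of two neighbouring edges.\<close>

lemma no_edge_into_wedge:
  assumes e: "e \<in> inner" and g: "g \<in> E"
    and x0: "lx e < x0" "x0 \<le> fst (first_vertex e)" "lx g < x0" "x0 \<le> rx g"
    and y: "seg_y e x0 < seg_y g x0" "seg_y g x0 < seg_y (up e) x0"
  shows False
proof -
  note u = up_props[OF e] and fv = first_vertex_props[OF e]
  have r: "x0 \<le> rx e" "x0 \<le> rx (up e)" using fv(1) x0 by (auto simp: wedge_def)
  have eE: "e \<in> E" using inner_E e .
  have lo: "seg_y e x \<le> seg_y g x" if "lx e \<le> x" "lx g \<le> x" "x < x0" for x
    using noncrossing_order_left(1)[OF nocross[OF eE g]] r x0 y that by auto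
  have hi: "seg_y g x \<le> seg_y (up e) x" if "lx e \<le> x" "lx g \<le> x" "x < x0" for x
    using noncrossing_order_left(1)[OF nocross[OF g u(1)]] r x0 y that u(3) by auto
  show False
  proof (cases "lx e < lx g")
    case True
    have "fst g \<in> wedge e"
      using True EV[OF g] lo[of "lx g"] hi[of "lx g"] x0 r by (auto simp: wedge_def lx_def[symmetric])
    then show False using fv(2) x0 by (fastforce simp: lx_def)
  next
    case False
    have p: "fst e \<in> V" using EV[OF eE] by simp
    have "seg_y g (lx e) = snd (fst e)"
      using lo[of "lx e"] hi[of "lx e"] False x0 u(2,3) seg_y_left[of e] seg_y_left[of "up e"] by simp
    then have "\<not> lx g < lx e" using novert[OF g p] x0 by (auto simp: lx_def)
    then have "lx g = lx e" using False by simp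
    then have f: "fst g = fst e" using inj p EV[OF g] by (auto simp: lx_def inj_on_def)
    have "slope e < slope g" "slope g < slope (up e)"
      using y x0 f u(2,3) \<open>lx g = lx e\<close> by (auto simp: seg_y_def)
    then show False using u(5)[OF g f] by simp
  qed
qed

lemma seg_y_distinct:
  assumes "e \<in> E" "g \<in> E" "e \<noteq> g" "lx e < x" "lx g < x" "x < rx e" "x < rx g"
  shows "seg_y e x \<noteq> seg_y g x"
  using nocross[OF assms(1,2)] assms by (auto simp: crosses_def)

text \<open>If two lower edges end at the same vertex, then just to the left of it the higher one
  runs inside the wedge of the other.\<close>

lemma inj_lower: "inj_on first_vertex {e \<in> inner. first_vertex e = snd e}"
proof (rule inj_onI, rule ccontr, goal_cases)
  case (1 e1 e2)
  have aux: False if "e1 \<in> inner" "first_vertex e1 = snd e1" "e2 \<in> inner" "snd e1 = snd e2"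
     "max (lx e1) (lx e2) < x" "x < rx e1" "seg_y e1 x < seg_y e2 x" for e1 e2 x
  proof -
    note u = up_props[OF that(1)]
    have E: "e1 \<in> E" "e2 \<in> E" using that inner_E by auto
    have r: "rx e1 = rx e2" using that by (simp add: rx_def)
    have r': "rx e1 \<le> rx (up e1)" using first_vertex_props(1)[OF that(1)] that(2) by (simp add: wedge_def rx_def)
    have "seg_y e2 (rx e1) < seg_y (up e1) (rx e1)"
      using up_above[OF that(1), of "rx e1"] EV[OF E(1)] EV[OF E(2)] r that(4) seg_y_right[of e1] seg_y_right[of e2] by simp
    then have "seg_y e2 x < seg_y (up e1) x"
      using noncrossing_order_left(2)[OF nocross[OF E(2) u(1)], of "rx e1"] r r' that u(3) by simp
    then show False using no_edge_into_wedge[OF that(1) E(2), of x] that r by (simp add: rx_def)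
  qed
  define x where "x = (max (lx e1) (lx e2) + rx e1) / 2"
  have E: "e1 \<in> E" "e2 \<in> E" using 1 inner_E by auto
  have r: "rx e1 = rx e2" using 1 by (simp add: rx_def)
  have x: "max (lx e1) (lx e2) < x" "x < rx e1" using EV[OF E(1)] EV[OF E(2)] r by (auto simp: x_def)
  then have "seg_y e1 x \<noteq> seg_y e2 x" using seg_y_distinct[OF E 1(4), of x] r by simp
  then consider "seg_y e1 x < seg_y e2 x" | "seg_y e2 x < seg_y e1 x" by linarith
  then show False
  proof cases
    case a: 1
    show ?thesis by (rule aux[of e1 e2 x]) (use 1 x a in auto)
  next
    case a: 2
    show ?thesis by (rule aux[of e2 e1 x]) (use 1 x r a in auto)
  qed
qed

text \<open>The mirror image of \<open>inj_lower\<close>: the lower of two upper edges with a common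
  right end runs inside the wedge of the other. In addition the two upper edges may coincide; then
  the two wedges have the same apex, and the less steep of \<open>e1\<close> and \<open>e2\<close>
  has a next steeper edge before the common one.\<close>

lemma inj_upper: "inj_on first_vertex {e \<in> inner. first_vertex e = snd (up e)}"
proof (rule inj_onI, rule ccontr, goal_cases)
  case (1 e1 e2)
  have I: "e1 \<in> inner" "e2 \<in> inner" using 1 by auto
  have E: "e1 \<in> E" "e2 \<in> E" using I inner_E by auto
  note u1 = up_props[OF I(1)] and u2 = up_props[OF I(2)]
  have s: "snd (up e1) = snd (up e2)" using 1 by simp
  have r: "rx (up e1) = rx (up e2)" using s by (simp add: rx_def)
  have aux: False if I: "e1 \<in> inner" "e2 \<in> inner" and "first_vertex e2 = snd (up e2)" "snd (up e1) = snd (up e2)"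
     "max (lx e1) (lx e2) < x" "x < rx (up e1)" "seg_y (up e1) x < seg_y (up e2) x" for e1 e2 x
  proof -
    note u1 = up_props[OF I(1)] and u2 = up_props[OF I(2)]
    have r: "rx (up e1) = rx (up e2)" using that by (simp add: rx_def)
    have r': "rx (up e2) \<le> rx e2" using first_vertex_props(1)[OF that(2)] that(3) by (simp add: wedge_def rx_def)
    have "seg_y e2 (rx (up e2)) < seg_y (up e1) (rx (up e2))"
      using up_above[OF I(2), of "rx (up e2)"] EV[OF u1(1)] EV[OF u2(1)] r u2(3) u1(3) that(4)
        seg_y_right[of "up e1"] seg_y_right[of "up e2"] by simp
    then have "seg_y e2 x < seg_y (up e1) x"
      using noncrossing_order_left(2)[OF nocross[OF inner_E[OF I(2)] u1(1)], of "rx (up e2)"] r r' that u1(3) by simp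
    then show False using no_edge_into_wedge[OF I(2) u1(1), of x] that r u1(3) by (simp add: rx_def)
  qed
  show False
  proof (cases "up e1 = up e2")
    case True
    then have f: "fst e1 = fst e2" using u1(2) u2(2) by simp
    then have "slope e1 \<noteq> slope e2" using same_left_slope[OF E] 1 by blast
    then show False using u1(5)[OF E(2)] u2(5)[OF E(1)] f u1(4) u2(4) True by fastforce
  next
    case False
    define x where "x = (max (lx e1) (lx e2) + rx (up e1)) / 2"
    have x: "max (lx e1) (lx e2) < x" "x < rx (up e1)" using EV[OF u1(1)] EV[OF u2(1)] r u1(3) u2(3) by (auto simp: x_def)
    then have "seg_y (up e1) x \<noteq> seg_y (up e2) x" using seg_y_distinct[OF u1(1) u2(1) False, of x] r u1(3) u2(3) by simp
    then consider "seg_y (up e1) x < seg_y (up e2) x" | "seg_y (up e2) x < seg_y (up e1) x" by linarith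
    then show False
    proof cases
      case a: 1
      show ?thesis by (rule aux[OF I, of x]) (use 1 x s a in auto)
    next
      case a: 2
      show ?thesis by (rule aux[OF I(2) I(1), of x]) (use 1 x r s a in auto)
    qed
  qed
qed

text \<open>Both lower edges pass strictly below the common first vertex, so at its abscissa the
  higher one lies inside the wedge of the other.\<close>

lemma inj_middle: "inj_on first_vertex {e \<in> inner. first_vertex e \<noteq> snd e \<and> first_vertex e \<noteq> snd (up e)}"
proof (rule inj_onI, rule ccontr, goal_cases)
  case (1 e1 e2)
  have inside: "lx e < fst (first_vertex e)" "fst (first_vertex e) < rx e"
    "seg_y e (fst (first_vertex e)) < snd (first_vertex e)"
    "snd (first_vertex e) \<le> seg_y (up e) (fst (first_vertex e))"
    if "e \<in> inner" "first_vertex e \<noteq> snd e" for e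
  proof -
    have w: "first_vertex e \<in> wedge e" using first_vertex_props that by blast
    then show l: "lx e < fst (first_vertex e)" by (simp add: wedge_def)
    have "fst (first_vertex e) \<noteq> rx e"
      using w that inj EV[OF inner_E[OF that(1)]] by (auto simp: wedge_def rx_def inj_on_def)
    then show r: "fst (first_vertex e) < rx e" using w by (simp add: wedge_def)
    show "snd (first_vertex e) \<le> seg_y (up e) (fst (first_vertex e))" using w by (simp add: wedge_def)
    show "seg_y e (fst (first_vertex e)) < snd (first_vertex e)"
      using novert[OF inner_E[OF that(1)], of "first_vertex e"] w l r by (auto simp: wedge_def)
  qed
  let ?x = "fst (first_vertex e1)"
  note i1 = inside[of e1] and i2 = inside[of e2]
  have "seg_y e1 ?x \<noteq> seg_y e2 ?x"
    using seg_y_distinct[of e1 e2 ?x] 1 i1 i2 inner_E by auto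
  then show False
    using no_edge_into_wedge[of e1 e2 ?x] no_edge_into_wedge[of e2 e1 ?x] 1 i1 i2 inner_E by fastforce
qed

text \<open>Three edges per vertex come from the three kinds of charges, the fourth from the
  steepest edge at each left end point.\<close>

theorem card_edges_le: "card E \<le> 4 * card V"
proof -
  let ?A = "{e \<in> inner. first_vertex e = snd e}" and ?B = "{e \<in> inner. first_vertex e = snd (up e)}"
    and ?C = "{e \<in> inner. first_vertex e \<noteq> snd e \<and> first_vertex e \<noteq> snd (up e)}"
  have fv: "first_vertex ` X \<subseteq> V" if "X \<subseteq> inner" for X
    using first_vertex_props(1) that by (fastforce simp: wedge_def)
  have "inj_on fst (E - inner)"
  proof (rule inj_onI, goal_cases)
    case (1 e g)
    then have "\<not> slope e < slope g" "\<not> slope g < slope e" unfolding inner_def above_def by fastforce+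
    then have "slope e = slope g" by simp
    then show ?case using same_left_slope 1 by blast
  qed
  then have t: "card (E - inner) \<le> card V"
    using card_inj_on_le[of fst "E - inner" V] EV finV by force
  have a: "card ?A \<le> card V" using card_inj_on_le[OF inj_lower fv finV] by auto
  have b: "card ?B \<le> card V" using card_inj_on_le[OF inj_upper fv finV] by auto
  have c: "card ?C \<le> card V" using card_inj_on_le[OF inj_middle fv finV] by auto
  have "E = (E - inner) \<union> ?A \<union> ?B \<union> ?C" using inner_E by blast
  then have "card E = card ((E - inner) \<union> ?A \<union> ?B \<union> ?C)" by simp
  also have "\<dots> \<le> card (E - inner) + card ?A + card ?B + card ?C"
    using card_Un_le[of "(E - inner) \<union> ?A \<union> ?B" ?C] card_Un_le[of "(E - inner) \<union> ?A" ?B]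
      card_Un_le[of "E - inner" ?A] by linarith
  finally show ?thesis using t a b c by linarith
qed

end


section \<open>Crossing lemma by random sampling of vertices\<close>

lemma sum_bernoulli_superset:
  fixes p :: real
  assumes "finite P" "A \<subseteq> P"
  shows "(\<Sum>V\<in>Pow P. if A \<subseteq> V then p ^ card V * (1 - p) ^ card (P - V) else 0) = p ^ card A"
proof -
  \<comment> \<open>Replacing the factor 1 - p by 0 at the points of \<open>A\<close> suppresses
    exactly those \<open>V\<close> that miss a point of \<open>A\<close>.\<close>
  let ?g = "\<lambda>x. if x \<in> A then 0 else 1 - p"
  have "p ^ card A = (\<Prod>x\<in>P. if x \<in> A then p else 1)"
    using assms by (simp add: prod.If_cases Int_absorb1)
  also have "\<dots> = (\<Prod>x\<in>P. p + ?g x)" by (intro prod.cong) auto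
  also have "\<dots> = (\<Sum>V\<in>Pow P. (\<Prod>x\<in>V. p) * (\<Prod>x\<in>P - V. ?g x))"
    using assms by (intro prod_add)
  also have "\<dots> = (\<Sum>V\<in>Pow P. if A \<subseteq> V then p ^ card V * (1 - p) ^ card (P - V) else 0)"
  proof (rule sum.cong, simp)
    fix V assume V: "V \<in> Pow P"
    have f: "finite (P - V)" using assms by simp
    show "(\<Prod>x\<in>V. p) * (\<Prod>x\<in>P - V. ?g x) = (if A \<subseteq> V then p ^ card V * (1 - p) ^ card (P - V) else 0)"
    proof (cases "A \<subseteq> V")
      case True
      then have "(\<Prod>x\<in>P - V. ?g x) = (\<Prod>x\<in>P - V. 1 - p)" by (intro prod.cong) auto
      then show ?thesis using True by simp
    next
      case False
      then obtain x where "x \<in> A" "x \<notin> V" by auto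
      then have "x \<in> P - V" "?g x = 0" using assms by auto
      then have "(\<Prod>x\<in>P - V. ?g x) = 0" by (intro prod_zero f bexI[of _ x]) auto
      then show ?thesis using False by simp
    qed
  qed
  finally show ?thesis by simp
qed

text \<open>Linearity of expectation: the weights are the law of a random subset of \<open>P\<close>
  that keeps each point independently with probability \<open>p\<close>, and \<open>h z\<close> is
  the set of points that must survive for \<open>z\<close> to survive.\<close>

lemma expected_count:
  fixes p :: real
  assumes "finite P" "finite Z" "\<And>z. z \<in> Z \<Longrightarrow> h z \<subseteq> P"
  shows "(\<Sum>V\<in>Pow P. p ^ card V * (1 - p) ^ card (P - V) * real (card {z \<in> Z. h z \<subseteq> V})) = (\<Sum>z\<in>Z. p ^ card (h z))"
proof -
  let ?m = "\<lambda>V. p ^ card V * (1 - p) ^ card (P - V)"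
  have "(\<Sum>V\<in>Pow P. ?m V * real (card {z \<in> Z. h z \<subseteq> V})) = (\<Sum>V\<in>Pow P. \<Sum>z\<in>Z. if h z \<subseteq> V then ?m V else 0)"
    using assms(2) by (intro sum.cong) (auto simp: sum.If_cases Int_def)
  also have "\<dots> = (\<Sum>z\<in>Z. \<Sum>V\<in>Pow P. if h z \<subseteq> V then ?m V else 0)" by (rule sum.swap)
  also have "\<dots> = (\<Sum>z\<in>Z. p ^ card (h z))"
    using sum_bernoulli_superset[OF assms(1) assms(3)] by (intro sum.cong) auto
  finally show ?thesis .
qed

text \<open>Keep every vertex with probability \<open>p\<close> and drop one edge of every surviving crossing.\<close>

lemma crossing_lemma:
  fixes p :: real
  assumes fin: "finite P" and inj: "inj_on fst P"
    and EV: "\<And>e. e \<in> E \<Longrightarrow> fst e \<in> P \<and> snd e \<in> P \<and> lx e < rx e"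
    and novert: "\<And>e v. e \<in> E \<Longrightarrow> v \<in> P \<Longrightarrow> lx e < fst v \<Longrightarrow> fst v < rx e \<Longrightarrow> snd v \<noteq> seg_y e (fst v)"
    and disj: "\<And>e g. e \<in> E \<Longrightarrow> g \<in> E \<Longrightarrow> crosses e g \<Longrightarrow> {fst e, snd e} \<inter> {fst g, snd g} = {}"
    and p: "0 \<le> p" "p \<le> 1"
  shows "p^2 * card E \<le> 4 * p * card P + p^4 * card {(e, g) \<in> E \<times> E. crosses e g}"
proof -
  have fE: "finite E"
  proof (rule finite_subset)
    show "E \<subseteq> P \<times> P" using EV by force
  qed (use fin in simp)
  let ?cr = "{z \<in> E \<times> E. crosses (fst z) (snd z)}"
  let ?h = "\<lambda>z. {fst (fst z), snd (fst z)} \<union> {fst (snd z), snd (snd z)}"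
  let ?m = "\<lambda>V. p ^ card V * (1 - p) ^ card (P - V)"
  have fcr: "finite ?cr" using fE by simp
  have pointwise: "real (card {e \<in> E. {fst e, snd e} \<subseteq> V}) \<le> 4 * card {v \<in> P. {v} \<subseteq> V} + card {z \<in> ?cr. ?h z \<subseteq> V}"
    if V: "V \<in> Pow P" for V
  proof -
    let ?EV = "{e \<in> E. {fst e, snd e} \<subseteq> V}" and ?cV = "{z \<in> ?cr. ?h z \<subseteq> V}"
    interpret plane_graph V "?EV - fst ` ?cV"
    proof
      show "finite V" using V fin finite_subset by blast
      show "inj_on fst V" using V inj inj_on_subset by blast
      show "\<not> crosses e g" if e: "e \<in> ?EV - fst ` ?cV" and g: "g \<in> ?EV - fst ` ?cV" for e g
      proof
        assume "crosses e g"
        then have "(e, g) \<in> ?cV" using e g by auto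
        then show False using e by force
      qed
      show "fst e \<in> V \<and> snd e \<in> V \<and> lx e < rx e" if "e \<in> ?EV - fst ` ?cV" for e
        using that EV[of e] by blast
      show "snd v \<noteq> seg_y e (fst v)" if "e \<in> ?EV - fst ` ?cV" "v \<in> V" "lx e < fst v" "fst v < rx e" for e v
        using that V novert[of e v] by blast
    qed
    have "?EV \<subseteq> (?EV - fst ` ?cV) \<union> fst ` ?cV" by blast
    then have "card ?EV \<le> card ((?EV - fst ` ?cV) \<union> fst ` ?cV)" using fcr fE by (intro card_mono finite_UnI finite_Diff finite_imageI) simp_all
    also have "\<dots> \<le> card (?EV - fst ` ?cV) + card (fst ` ?cV)" by (rule card_Un_le)
    also have "\<dots> \<le> 4 * card V + card ?cV"
      by (intro add_mono card_edges_le card_image_le finite_subset[OF _ fcr]) blast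
    finally have "card ?EV \<le> 4 * card V + card ?cV" .
    moreover have "{v \<in> P. {v} \<subseteq> V} = V" using V by auto
    ultimately have "card ?EV \<le> 4 * card {v \<in> P. {v} \<subseteq> V} + card ?cV" by simp
    from of_nat_mono[OF this, where 'a = real] show ?thesis
      unfolding of_nat_add of_nat_mult of_nat_numeral .
  qed
  have "p^2 * card E = (\<Sum>e\<in>E. p ^ card {fst e, snd e})"
  proof -
    have "(\<Sum>e\<in>E. p ^ card {fst e, snd e}) = (\<Sum>e\<in>E. p^2)"
    proof (rule sum.cong)
      fix e assume "e \<in> E"
      then have "fst e \<noteq> snd e" using EV[of e] unfolding lx_def rx_def by fastforce
      then show "p ^ card {fst e, snd e} = p^2" by (simp add: power2_eq_square)
    qed simp
    then show ?thesis by simp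
  qed
  also have "\<dots> = (\<Sum>V\<in>Pow P. ?m V * card {e \<in> E. {fst e, snd e} \<subseteq> V})"
    using EV by (intro expected_count[symmetric] fin fE) auto
  also have "\<dots> \<le> (\<Sum>V\<in>Pow P. ?m V * (4 * card {v \<in> P. {v} \<subseteq> V} + card {z \<in> ?cr. ?h z \<subseteq> V}))"
    using p pointwise by (intro sum_mono mult_left_mono) auto
  also have "\<dots> = 4 * (\<Sum>V\<in>Pow P. ?m V * card {v \<in> P. {v} \<subseteq> V}) + (\<Sum>V\<in>Pow P. ?m V * card {z \<in> ?cr. ?h z \<subseteq> V})"
    by (simp add: sum.distrib[symmetric] sum_distrib_left algebra_simps)
  also have "(\<Sum>V\<in>Pow P. ?m V * card {v \<in> P. {v} \<subseteq> V}) = (\<Sum>v\<in>P. p ^ card {v})"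
    by (rule expected_count[OF fin fin]) simp
  also have "(\<Sum>V\<in>Pow P. ?m V * card {z \<in> ?cr. ?h z \<subseteq> V}) = (\<Sum>z\<in>?cr. p ^ card (?h z))"
    by (rule expected_count[OF fin fcr]) (use EV in auto)
  finally have "p^2 * card E \<le> 4 * (\<Sum>v\<in>P. p ^ card {v}) + (\<Sum>z\<in>?cr. p ^ card (?h z))" .
  \<comment> \<open>By \<open>disj\<close> two crossing edges have four different end points, so a
    crossing survives with probability \<open>p ^ 4\<close>.\<close>
  moreover have "(\<Sum>z\<in>?cr. p ^ card (?h z)) = (\<Sum>z\<in>?cr. p ^ 4)"
  proof (rule sum.cong)
    fix z assume z: "z \<in> ?cr"
    have ne: "fst e \<noteq> snd e" if "e \<in> E" for e using EV[OF that] unfolding lx_def rx_def by fastforce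
    have "fst z \<in> E" "snd z \<in> E" "crosses (fst z) (snd z)" using z by (auto simp: mem_Times_iff)
    then have "fst (fst z) \<noteq> snd (fst z)" "fst (snd z) \<noteq> snd (snd z)" using ne by blast+
    moreover have "{fst (fst z), snd (fst z)} \<inter> {fst (snd z), snd (snd z)} = {}"
      by (rule disj) fact+
    ultimately have "card (?h z) = 4" by (subst card_Un_disjoint) auto
    then show "p ^ card (?h z) = p ^ 4" by simp
  qed simp
  moreover have "?cr = {(e, g) \<in> E \<times> E. crosses e g}" by auto
  ultimately show ?thesis by (simp add: mult_ac)
qed

section \<open>Lines rich in points of a planar set\<close>

definition on_line :: "real \<times> real \<Rightarrow> pt \<Rightarrow> bool" where
  "on_line l p \<longleftrightarrow> snd p = fst l * fst p + snd l"

lemma on_line_unique: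
  fixes l k :: "real \<times> real"
  assumes "fst l * x + snd l = fst k * x + snd k" "fst l * y + snd l = fst k * y + snd k" "x \<noteq> y"
  shows "l = k"
proof -
  have "(fst l - fst k) * (x - y) = 0" using assms by (simp add: algebra_simps)
  then show ?thesis using assms by (auto simp: prod_eq_iff)
qed

definition consecutive :: "pt set \<Rightarrow> (pt \<times> pt) set" where
  "consecutive Q = {(p, q). p \<in> Q \<and> q \<in> Q \<and> fst p < fst q \<and> (\<forall>r\<in>Q. \<not> (fst p < fst r \<and> fst r < fst q))}"

lemma finite_consecutive: "finite Q \<Longrightarrow> finite (consecutive Q)"
  by (rule finite_subset[of _ "Q \<times> Q"]) (auto simp: consecutive_def)

text \<open>Every point except the rightmost one starts a pair. The truncated subtraction covers the
  empty set.\<close>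

lemma card_consecutive:
  assumes "finite Q" "inj_on fst Q"
  shows "card Q - 1 \<le> card (consecutive Q)"
proof (cases "Q = {}")
  case False
  define M where "M = arg_min_on (\<lambda>q. - fst q) Q"
  have M: "M \<in> Q" "\<And>q. q \<in> Q \<Longrightarrow> fst q \<le> fst M"
    using arg_min_if_finite[OF assms(1) False, of "\<lambda>q. - fst q"] unfolding M_def by (auto simp: not_less)
  have "Q - {M} \<subseteq> fst ` consecutive Q"
  proof
    fix p assume p: "p \<in> Q - {M}"
    then have "fst p < fst M" using M assms(2) by (metis DiffD1 DiffD2 inj_onD insertI1 order_less_le)
    then have ne: "{q \<in> Q. fst p < fst q} \<noteq> {}" using M by blast
    define q where "q = arg_min_on fst {q \<in> Q. fst p < fst q}"
    have "q \<in> Q" "fst p < fst q" "\<And>r. r \<in> Q \<Longrightarrow> fst p < fst r \<Longrightarrow> fst q \<le> fst r"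
      using arg_min_if_finite[OF _ ne, of fst] assms(1) unfolding q_def by (auto simp: not_less)
    then have "(p, q) \<in> consecutive Q" using p by (force simp: consecutive_def)
    then show "p \<in> fst ` consecutive Q" by force
  qed
  then have "card (Q - {M}) \<le> card (consecutive Q)"
    by (meson assms(1) finite_consecutive surj_card_le)
  then show ?thesis using M assms by simp
qed simp

lemma consecutive_overlap:
  assumes "inj_on fst Q" "e \<in> consecutive Q" "g \<in> consecutive Q"
    "lx e < x" "x < rx e" "lx g < x" "x < rx g"
  shows "e = g"
proof -
  obtain p q u w where eg: "e = (p, q)" "g = (u, w)" by (metis surj_pair)
  have Q: "p \<in> Q" "q \<in> Q" "u \<in> Q" "w \<in> Q" using assms eg by (auto simp: consecutive_def)
  have n: "\<not> (fst p < fst r \<and> fst r < fst q)" "\<not> (fst u < fst r \<and> fst r < fst w)" if "r \<in> Q" for r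
    using assms(2,3) eg that by (auto simp: consecutive_def)
  have "fst p = fst u" "fst q = fst w"
    using n(1)[OF Q(3)] n(1)[OF Q(4)] n(2)[OF Q(1)] n(2)[OF Q(2)] assms(4-7) eg by (auto simp: lx_def rx_def)
  then show ?thesis using assms(1) Q eg by (simp add: inj_on_eq_iff)
qed

text \<open>Here \<open>n\<close> counts edges, \<open>N\<close> bounds the number of vertices, and
  \<open>m\<close> counts lines, so that \<open>m^2\<close> bounds the number of crossings. If
  \<open>n\<close> is at least 8N, the choice p = 8N/n makes the vertex term half of the left side,
  which gives n^3 \<le> 128 N^2 m^2 and then 1024 = 8 * 128. If \<open>n\<close> is smaller,
  \<open>s^2 \<le> 16 * N\<close> supplies the two missing powers of \<open>s\<close>.\<close>

lemma crossing_arith: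
  fixes n m N s :: real
  assumes key: "\<And>p. 0 \<le> p \<Longrightarrow> p \<le> 1 \<Longrightarrow> p^2 * n \<le> 4 * p * N + p^4 * m^2"
    and m0: "0 \<le> m" and nm: "m * s \<le> 2 * n" and s: "2 \<le> s" "s^2 \<le> 16 * N"
  shows "m * s^3 \<le> 1024 * N^2"
proof -
  have s0: "s > 0" using s by simp
  have "0 < s^2" using s0 by simp
  then have N0: "N > 0" using s by linarith
  show ?thesis
  proof (cases "n < 8 * N")
    case True
    have "m * s^3 = (m * s) * s^2" by (simp add: power2_eq_square power3_eq_cube)
    also have "\<dots> \<le> (16 * N) * (16 * N)"
      using nm s s0 m0 N0 True by (intro mult_mono[of _ _ "s^2"]) auto
    also have "\<dots> \<le> 1024 * N^2" by (simp add: power2_eq_square)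
    finally show ?thesis .
  next
    case False
    then have n0: "n > 0" using N0 by simp
    define p where "p = 8 * N / n"
    have p: "0 < p" "p \<le> 1" using False n0 N0 by (auto simp: p_def)
    have pn: "p * n = 8 * N" using n0 by (simp add: p_def)
    have "p * (p * n) \<le> 4 * p * N + p * (p^3 * m^2)" using key[of p] p
      by (simp add: power2_eq_square power3_eq_cube power4_eq_xxxx mult.assoc)
    then have "p * (4 * N) \<le> p * (p^3 * m^2)" unfolding pn by (simp add: algebra_simps)
    then have "4 * N \<le> p^3 * m^2" using p(1) by (simp only: mult_le_cancel_left_pos)
    then have "4 * N * n^3 \<le> p^3 * m^2 * n^3" using n0 by (intro mult_right_mono) auto
    also have "\<dots> = (p * n)^3 * m^2" by (simp add: power_mult_distrib)
    finally have "(4 * N) * n^3 \<le> (4 * N) * (128 * N^2 * m^2)" unfolding pn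
      by (simp add: power2_eq_square power3_eq_cube)
    then have n3: "n^3 \<le> 128 * N^2 * m^2" using N0 by (subst (asm) mult_le_cancel_left_pos) auto
    have "(m * s)^3 \<le> (2 * n)^3" using nm m0 s0 by (intro power_mono) auto
    then have "m^2 * (m * s^3) \<le> m^2 * (1024 * N^2)" using n3
      by (simp add: power2_eq_square power3_eq_cube power_mult_distrib mult_ac)
    then show ?thesis by (cases "m = 0") (auto simp: mult_le_cancel_left)
  qed
qed

text \<open>Join neighbouring points on each line. A line with r \<ge> s \<ge> 2 points yields at
  least r - 1 \<ge> s/2 edges, and two lines meet at most once, so the graph has many edges and few
  crossings. Vertical lines, which \<open>on_line\<close> cannot represent, carry at most one point
  because of \<open>inj\<close>.\<close>

lemma szemeredi_trotter_rich_lines: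
  fixes P X :: "(real \<times> real) set" and s N :: real
  assumes fin: "finite P" "finite X" and inj: "inj_on fst P" and N: "card P \<le> N"
    and rich: "\<And>l. l \<in> X \<Longrightarrow> s \<le> card {p \<in> P. on_line l p}"
    and s: "2 \<le> s" "s^2 \<le> 16 * N"
  shows "card X * s^3 \<le> 1024 * N^2"
proof -
  let ?Q = "\<lambda>l. {p \<in> P. on_line l p}"
  let ?El = "\<lambda>l. consecutive (?Q l)"
  define E where "E = (\<Union>l\<in>X. ?El l)"
  have Elx: "fst e \<in> ?Q l" "snd e \<in> ?Q l" "lx e < rx e" if "e \<in> ?El l" for e l
    using that by (auto simp: consecutive_def lx_def rx_def)
  have slopeE: "slope e = fst l" if "e \<in> ?El l" for e l
  proof -
    have "snd (snd e) - snd (fst e) = fst l * (rx e - lx e)"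
      using Elx[OF that] by (simp add: on_line_def lx_def rx_def algebra_simps)
    then show ?thesis using Elx(3)[OF that] by (simp add: slope_def)
  qed
  have segE: "seg_y e x = fst l * x + snd l" if "e \<in> ?El l" for e l x
    using slopeE[OF that] Elx(1)[OF that] by (simp add: seg_y_def on_line_def lx_def algebra_simps)
  have lineE: "l = k" if "e \<in> ?El l" "e \<in> ?El k" for e l k
    using on_line_unique[of l "lx e" k "rx e"] segE[OF that(1)] segE[OF that(2)] Elx(3)[OF that(1)] by (metis less_irrefl)
  have injQ: "inj_on fst (?Q l)" for l using inj by (rule inj_on_subset) auto
  have finEl: "finite (?El l)" for l using fin by (intro finite_consecutive) auto
  have finE: "finite E" unfolding E_def using fin finEl by auto
  have overlap: "e = g" if "e \<in> ?El l" "g \<in> ?El l" "lx e < x" "x < rx e" "lx g < x" "x < rx g" for e g l x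
    using consecutive_overlap[OF injQ that] .
  have cardE: "card X * (s / 2) \<le> card E"
  proof -
    have "card E = (\<Sum>l\<in>X. card (?El l))" unfolding E_def
      using fin finEl lineE by (intro card_UN_disjoint) blast+
    moreover have "s / 2 \<le> card (?El l)" if "l \<in> X" for l
    proof -
      have "card (?Q l) - 1 \<le> card (?El l)" using card_consecutive[OF _ injQ] fin by auto
      then show ?thesis using rich[OF that] s by linarith
    qed
    ultimately have "(\<Sum>l\<in>X. s / 2) \<le> card E" by (simp only: of_nat_sum) (rule sum_mono)
    then show ?thesis by simp
  qed
  let ?cr = "{(e, g) \<in> E \<times> E. crosses e g}"
  have crosses_lines: "l \<noteq> k" if "e \<in> ?El l" "g \<in> ?El k" "crosses e g" for e g l k
    using that overlap by (fastforce simp: crosses_def)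
  \<comment> \<open>A crossing is determined by the lines of its two edges: they fix the crossing
    point, and on each line only one edge has that point in its interior.\<close>
  have cardcr: "card ?cr \<le> card (X \<times> X)"
  proof -
    define line where "line e = (slope e, snd (fst e) - slope e * lx e)" for e :: "pt \<times> pt"
    have line: "line e = l" if "e \<in> ?El l" for e l
      using slopeE[OF that] Elx(1)[OF that] by (auto simp: line_def on_line_def lx_def)
    show ?thesis
    proof (rule card_inj_on_le)
      show "inj_on (map_prod line line) ?cr"
      proof (rule inj_onI)
        fix z z' assume z: "z \<in> ?cr" "z' \<in> ?cr" "map_prod line line z = map_prod line line z'"
        obtain e g e' g' where eg: "z = (e, g)" "z' = (e', g')" by (metis surj_pair)
        obtain l k where lk: "e \<in> ?El l" "g \<in> ?El k" using z eg by (auto simp: E_def)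
        have lk': "e' \<in> ?El l" "g' \<in> ?El k"
          using z eg line[OF lk(1)] line[OF lk(2)] by (auto simp: E_def line)
        have ne: "l \<noteq> k" using crosses_lines lk z eg by auto
        obtain x where x: "lx e < x" "x < rx e" "lx g < x" "x < rx g" "seg_y e x = seg_y g x"
          using z eg by (auto simp: crosses_def)
        obtain y where y: "lx e' < y" "y < rx e'" "lx g' < y" "y < rx g'" "seg_y e' y = seg_y g' y"
          using z eg by (auto simp: crosses_def)
        have "x = y" using on_line_unique[of l x k y] x y segE lk lk' ne by metis
        then show "z = z'" using overlap[OF lk(1) lk'(1)] overlap[OF lk(2) lk'(2)] x y eg by simp
      qed
      show "map_prod line line ` ?cr \<subseteq> X \<times> X" by (auto simp: E_def line)
    qed (use fin in simp)
  qed
  have key: "p^2 * card E \<le> 4 * p * card P + p^4 * card ?cr" if "0 \<le> p" "p \<le> 1" for p :: real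
  proof (rule crossing_lemma[OF fin(1) inj _ _ _ that])
    show "fst e \<in> P \<and> snd e \<in> P \<and> lx e < rx e" if "e \<in> E" for e
      using that Elx unfolding E_def by blast
    show "snd v \<noteq> seg_y e (fst v)" if e: "e \<in> E" and v: "v \<in> P" "lx e < fst v" "fst v < rx e" for e v
    proof
      assume a: "snd v = seg_y e (fst v)"
      obtain l where l: "e \<in> ?El l" using e by (auto simp: E_def)
      have "v \<in> ?Q l" using v a segE[OF l] by (simp add: on_line_def)
      then show False using l v unfolding consecutive_def lx_def rx_def by (cases e) fastforce
    qed
    \<comment> \<open>A shared end point and an interior crossing would be two common points of
      different lines.\<close>
    show "{fst e, snd e} \<inter> {fst g, snd g} = {}" if e: "e \<in> E" "g \<in> E" and c: "crosses e g" for e g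
    proof (rule ccontr)
      assume "\<not> ?thesis"
      then obtain v where v: "v \<in> {fst e, snd e}" "v \<in> {fst g, snd g}" by blast
      obtain l k where lk: "e \<in> ?El l" "g \<in> ?El k" using e by (auto simp: E_def)
      obtain x where x: "lx e < x" "x < rx e" "lx g < x" "x < rx g" "seg_y e x = seg_y g x"
        using c by (auto simp: crosses_def)
      have "on_line l v" "on_line k v" using Elx[OF lk(1)] Elx[OF lk(2)] v by auto
      moreover have "fst v \<noteq> x" using v x by (auto simp: lx_def rx_def)
      ultimately have "l = k" using on_line_unique[of l "fst v" k x] x segE lk by (metis on_line_def)
      then show False using crosses_lines lk c by auto
    qed
  qed
  define n where "n = real (card E)"
  define m where "m = real (card X)"
  have key': "p^2 * n \<le> 4 * p * N + p^4 * m^2" if "0 \<le> p" "p \<le> 1" for p :: real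
  proof -
    have "real (card ?cr) \<le> real (card (X \<times> X))" using cardcr by (rule of_nat_mono)
    also have "\<dots> = m^2" by (simp add: m_def card_cartesian_product power2_eq_square)
    finally have "real (card ?cr) \<le> m^2" .
    then have "p^4 * card ?cr \<le> p^4 * m^2" using that by (intro mult_left_mono) auto
    moreover have "4 * p * card P \<le> 4 * p * N" using N that by (intro mult_left_mono) auto
    ultimately show ?thesis using key[OF that] unfolding n_def by linarith
  qed
  have "m * s \<le> 2 * n" using cardE by (auto simp: n_def m_def)
  then have "m * s^3 \<le> 1024 * N^2"
    using crossing_arith[OF key' _ _ s] by (simp add: m_def)
  then show ?thesis by (simp add: m_def)
qed

subsection \<open>Lines in the integer lattice\<close>

text \<open>The vanishing determinant avoids division. For \<open>a = b\<close> this is the whole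
  plane, hence the assumptions \<open>a \<noteq> b\<close> below.\<close>

definition ln_through :: "int \<times> int \<Rightarrow> int \<times> int \<Rightarrow> (int \<times> int) set" where
  "ln_through a b = {p. (fst a - fst b) * (snd p - snd b) = (snd a - snd b) * (fst p - fst b)}"

definition right_angle :: "int \<times> int \<Rightarrow> int \<times> int \<Rightarrow> int \<times> int \<Rightarrow> bool" where
  "right_angle a b c \<longleftrightarrow> (fst a - fst b) * (fst c - fst b) + (snd a - snd b) * (snd c - snd b) = 0"

lemma parallel_trans:
  fixes u1 :: int
  assumes "u1 * v2 = u2 * v1" "u1 * w2 = u2 * w1" "u1 \<noteq> 0 \<or> u2 \<noteq> 0"
  shows "v1 * w2 = v2 * w1"
proof -
  have "u1 * (v1 * w2 - v2 * w1) = v1 * (u1 * w2) - w1 * (u1 * v2)" by (simp add: algebra_simps)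
  also have "\<dots> = 0" unfolding assms(1,2) by (simp add: algebra_simps)
  finally have 1: "u1 * (v1 * w2 - v2 * w1) = 0" .
  have "u2 * (v1 * w2 - v2 * w1) = w2 * (u2 * v1) - v2 * (u2 * w1)" by (simp add: algebra_simps)
  also have "\<dots> = 0" unfolding assms(1)[symmetric] assms(2)[symmetric] by (simp add: algebra_simps)
  finally show ?thesis using 1 assms(3) by auto
qed

text \<open>Lagrange's identity: |u|^2 |v|^2 is the sum of the squares of the inner product and of
  the determinant.\<close>

lemma parallel_perp_zero:
  fixes u1 :: int
  assumes "u1 * v2 = u2 * v1" "u1 * v1 + u2 * v2 = 0" "u1 \<noteq> 0 \<or> u2 \<noteq> 0"
  shows "v1 = 0 \<and> v2 = 0"
proof -
  have "(u1^2 + u2^2) * (v1^2 + v2^2) = (u1 * v1 + u2 * v2)^2 + (u1 * v2 - u2 * v1)^2"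
    by (simp add: power2_eq_square algebra_simps)
  then have "(u1^2 + u2^2) * (v1^2 + v2^2) = 0" using assms by simp
  moreover have "u1^2 + u2^2 \<noteq> 0" using assms(3) by (simp add: sum_power2_eq_zero_iff)
  ultimately show ?thesis by (auto simp: sum_power2_eq_zero_iff)
qed

lemma mem_ln_through [simp]: "a \<in> ln_through a b" "b \<in> ln_through a b"
  by (auto simp: ln_through_def)

lemma ln_through_commute: "ln_through a b = ln_through b a"
  by (auto simp: ln_through_def algebra_simps)

lemma ln_through_eq:
  assumes "a \<noteq> b" "p \<in> ln_through a b" "q \<in> ln_through a b" "p \<noteq> q"
  shows "ln_through p q = ln_through a b"
proof -
  let ?u1 = "fst a - fst b" and ?u2 = "snd a - snd b" and ?v1 = "fst p - fst q" and ?v2 = "snd p - snd q"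
  have u: "?u1 \<noteq> 0 \<or> ?u2 \<noteq> 0" and v: "?v1 \<noteq> 0 \<or> ?v2 \<noteq> 0" using assms by (auto simp: prod_eq_iff)
  have uv: "?u1 * ?v2 = ?u2 * ?v1" using assms by (simp add: ln_through_def algebra_simps)
  have "?v1 * (snd r - snd q) = ?v2 * (fst r - fst q) \<longleftrightarrow> ?u1 * (snd r - snd b) = ?u2 * (fst r - fst b)" for r
  proof -
    have *: "?u1 * (snd r - snd b) = ?u2 * (fst r - fst b) \<longleftrightarrow> ?u1 * (snd r - snd q) = ?u2 * (fst r - fst q)"
    proof -
      have q: "?u1 * (snd q - snd b) = ?u2 * (fst q - fst b)" using assms by (simp add: ln_through_def)
      have 1: "?u1 * (snd r - snd b) = ?u1 * (snd r - snd q) + ?u1 * (snd q - snd b)" by (simp add: algebra_simps)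
      have 2: "?u2 * (fst r - fst b) = ?u2 * (fst r - fst q) + ?u2 * (fst q - fst b)" by (simp add: algebra_simps)
      show ?thesis unfolding 1 2 q by (simp only: add_right_cancel)
    qed
    show ?thesis unfolding *
      using parallel_trans[OF uv _ u, of "snd r - snd q" "fst r - fst q"] 
        parallel_trans[of ?v1 ?u2 ?v2 ?u1 "snd r - snd q" "fst r - fst q"] uv v by (auto simp: mult.commute)
  qed
  then show ?thesis by (auto simp: ln_through_def)
qed

text \<open>Both \<open>c\<close> and \<open>c'\<close> lie on the perpendicular at
  \<open>b\<close>. This confines the third vertex of a rectangle with a given side to a single
  line.\<close>

lemma right_angle_ln_eq:
  assumes "a \<noteq> b" "c \<noteq> b" "c' \<noteq> b" "right_angle a b c" "right_angle a b c'"
  shows "ln_through b c = ln_through b c'"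
proof -
  have "(fst c - fst b) * (snd c' - snd b) = (snd c - snd b) * (fst c' - fst b)"
    using parallel_trans[of "- (snd a - snd b)" "snd c - snd b" "fst a - fst b" "fst c - fst b"
        "snd c' - snd b" "fst c' - fst b"] assms by (auto simp: right_angle_def prod_eq_iff algebra_simps)
  then have "c' \<in> ln_through c b" by (simp add: ln_through_def)
  then show ?thesis using ln_through_eq[of c b c' b] assms ln_through_commute by auto
qed

text \<open>Each of \<open>b\<close> and \<open>b'\<close> is the foot of the perpendicular from
  \<open>c\<close> to the same line, so their difference is both parallel and orthogonal to
  it.\<close>

lemma foot_unique:
  assumes "a \<noteq> b" "a \<noteq> b'" "ln_through a b = ln_through a b'" "right_angle a b c" "right_angle a b' c"
  shows "b = b'"
proof -
  let ?u1 = "fst a - fst b" and ?u2 = "snd a - snd b"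
  have u: "?u1 \<noteq> 0 \<or> ?u2 \<noteq> 0" using assms by (auto simp: prod_eq_iff)
  have b': "b' \<in> ln_through a b" using assms by simp
  then have par: "?u1 * (snd b' - snd b) = ?u2 * (fst b' - fst b)" by (simp add: ln_through_def)
  then have par': "?u1 * (snd a - snd b') = ?u2 * (fst a - fst b')" by (simp add: algebra_simps)
  have v: "fst a - fst b' \<noteq> 0 \<or> snd a - snd b' \<noteq> 0" using assms by (auto simp: prod_eq_iff)
  have "(fst a - fst b') * (fst c - fst b') = (snd a - snd b') * (- (snd c - snd b'))"
    using assms(5) by (simp add: right_angle_def algebra_simps)
  moreover have "(fst a - fst b') * ?u2 = (snd a - snd b') * ?u1" using par' by (simp add: mult.commute)
  ultimately have "?u1 * (fst c - fst b') = ?u2 * (- (snd c - snd b'))"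
    using parallel_trans[of "fst a - fst b'" ?u2 "snd a - snd b'" ?u1 "fst c - fst b'" "- (snd c - snd b')"] v by simp
  then have "?u1 * (fst b' - fst b) + ?u2 * (snd b' - snd b) = 0"
    using assms(4) by (simp add: right_angle_def algebra_simps)
  then show ?thesis using parallel_perp_zero[OF par _ u] by (auto simp: prod_eq_iff)
qed

text \<open>The factor exceeds every difference of second coordinates, so equal images force equal
  first coordinates.\<close>

lemma exists_shear:
  fixes A :: "(int \<times> int) set"
  assumes "finite A"
  obtains K :: int where "K > 0" "inj_on (\<lambda>p. K * fst p + snd p) A"
proof
  let ?M = "\<Sum>p\<in>A. \<bar>snd p\<bar>"
  have M: "\<bar>snd p\<bar> \<le> ?M" if "p \<in> A" for p
    using that assms by (intro member_le_sum) auto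
  have M0: "?M \<ge> 0" by (intro sum_nonneg) auto
  then show "2 * ?M + 1 > 0" by simp
  show "inj_on (\<lambda>p. (2 * ?M + 1) * fst p + snd p) A"
  proof (rule inj_onI)
    fix p q assume pq: "p \<in> A" "q \<in> A" "(2 * ?M + 1) * fst p + snd p = (2 * ?M + 1) * fst q + snd q"
    then have e: "(2 * ?M + 1) * (fst p - fst q) = snd q - snd p" by (simp add: algebra_simps)
    have "fst p = fst q"
    proof (rule ccontr)
      assume "fst p \<noteq> fst q"
      then have "1 \<le> \<bar>fst p - fst q\<bar>" by simp
      then have "(2 * ?M + 1) * 1 \<le> (2 * ?M + 1) * \<bar>fst p - fst q\<bar>" using M0 by (intro mult_left_mono) auto
      also have "\<dots> = \<bar>(2 * ?M + 1) * (fst p - fst q)\<bar>" using M0 by (simp add: abs_mult)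
      finally have "(2 * ?M + 1) * 1 \<le> \<bar>snd q - snd p\<bar>" unfolding e .
      then show False using M[OF pq(1)] M[OF pq(2)] by simp
    qed
    then show "p = q" using pq by (simp add: prod_eq_iff)
  qed
qed

text \<open>The shear \<open>t\<close> makes the abscissas distinct and preserves collinearity. A
  line of \<open>Y\<close> has two points in \<open>A\<close>, so its image is not vertical, and
  slope and intercept of the image determine the line.\<close>

lemma rich_integer_lines:
  fixes A :: "(int \<times> int) set" and Y :: "(int \<times> int) set set" and s N :: real
  assumes fin: "finite A" "finite Y" and N: "card A \<le> N"
    and lines: "\<And>L. L \<in> Y \<Longrightarrow> \<exists>a b. a \<noteq> b \<and> L = ln_through a b"
    and rich: "\<And>L. L \<in> Y \<Longrightarrow> s \<le> card (A \<inter> L)"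
    and s: "2 \<le> s" "s^2 \<le> 16 * N"
  shows "card Y * s^3 \<le> 1024 * N^2"
proof -
  obtain K where K: "K > 0" "inj_on (\<lambda>p. K * fst p + snd p) A" using exists_shear[OF fin(1)] by blast
  define t where "t p = (real_of_int (K * fst p + snd p), real_of_int (snd p))" for p :: "int \<times> int"
  have inj: "inj_on (fst \<circ> t) A" using K(2) unfolding inj_on_def t_def comp_def fst_conv of_int_eq_iff .
  have injt: "inj_on t A" using inj inj_on_imageI2 by blast
  have col: "r \<in> ln_through p q \<longleftrightarrow>
      (fst (t p) - fst (t q)) * (snd (t r) - snd (t q)) = (snd (t p) - snd (t q)) * (fst (t r) - fst (t q))" for p q r
  proof -
    have "r \<in> ln_through p q \<longleftrightarrow> K * ((fst p - fst q) * (snd r - snd q)) = K * ((snd p - snd q) * (fst r - fst q))"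
      using K(1) by (simp add: ln_through_def)
    also have "\<dots> \<longleftrightarrow> ((K * fst p + snd p) - (K * fst q + snd q)) * (snd r - snd q) =
        (snd p - snd q) * ((K * fst r + snd r) - (K * fst q + snd q))"
      by (simp add: algebra_simps)
    also have "\<dots> \<longleftrightarrow> real_of_int (((K * fst p + snd p) - (K * fst q + snd q)) * (snd r - snd q)) =
        real_of_int ((snd p - snd q) * ((K * fst r + snd r) - (K * fst q + snd q)))"
      by (simp only: of_int_eq_iff)
    finally show ?thesis unfolding t_def fst_conv snd_conv of_int_mult of_int_diff by simp
  qed
  have two: "\<exists>p q. p \<in> A \<inter> L \<and> q \<in> A \<inter> L \<and> p \<noteq> q \<and> L = ln_through p q" if "L \<in> Y" for L
  proof -
    have "2 \<le> card (A \<inter> L)" using rich[OF that] s by linarith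
    then obtain p q where pq: "p \<in> A \<inter> L" "q \<in> A \<inter> L" "p \<noteq> q"
      by (metis card_le_Suc0_iff_eq fin(1) finite_Int numeral_2_eq_2 not_less_eq_eq)
    then show ?thesis using lines[OF that] ln_through_eq by blast
  qed
  have "\<exists>l. \<forall>r \<in> A \<inter> L. on_line l (t r)" if L: "L \<in> Y" for L
  proof -
    obtain p q where pq: "p \<in> A \<inter> L" "q \<in> A \<inter> L" "p \<noteq> q" "L = ln_through p q" using two[OF L] by blast
    have ne: "fst (t p) - fst (t q) \<noteq> 0" using inj pq by (auto simp: inj_on_def)
    define mu where "mu = (snd (t p) - snd (t q)) / (fst (t p) - fst (t q))"
    have "on_line (mu, snd (t q) - mu * fst (t q)) (t r)" if "r \<in> A \<inter> L" for r
    proof -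
      have "snd (t r) - snd (t q) = mu * (fst (t r) - fst (t q))"
        using that pq(4) col[of r p q] ne by (auto simp: mu_def field_simps)
      then show ?thesis by (simp add: on_line_def algebra_simps)
    qed
    then show ?thesis by blast
  qed
  then obtain g where g: "\<And>L r. L \<in> Y \<Longrightarrow> r \<in> A \<inter> L \<Longrightarrow> on_line (g L) (t r)" by metis
  have injg: "inj_on g Y"
  proof (rule inj_onI)
    fix L L' assume L: "L \<in> Y" "L' \<in> Y" "g L = g L'"
    obtain p q where pq: "p \<in> A \<inter> L" "q \<in> A \<inter> L" "p \<noteq> q" "L = ln_through p q" using two[OF L(1)] by blast
    obtain p' q' where pq': "p' \<in> A \<inter> L'" "q' \<in> A \<inter> L'" "p' \<noteq> q'" "L' = ln_through p' q'" using two[OF L(2)] by blast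
    have *: "r \<in> L" if "r \<in> A \<inter> L'" for r
    proof -
      have "on_line (g L) (t p)" "on_line (g L) (t q)" "on_line (g L) (t r)"
        using g[OF L(1) pq(1)] g[OF L(1) pq(2)] g[OF L(2) that] L(3) by simp_all
      then show ?thesis unfolding pq(4) col on_line_def by (simp add: algebra_simps)
    qed
    show "L = L'" using ln_through_eq[OF pq(3), of p' q'] * pq pq' by blast
  qed
  have "real (card (g ` Y)) * s^3 \<le> 1024 * N^2"
  proof (rule szemeredi_trotter_rich_lines[of "t ` A"])
    show "inj_on fst (t ` A)" using inj by (simp add: inj_on_imageI)
    show "real (card (t ` A)) \<le> N" using N injt by (simp add: card_image)
    fix l assume "l \<in> g ` Y"
    then obtain L where L: "L \<in> Y" "l = g L" by blast
    have "card (A \<inter> L) = card (t ` (A \<inter> L))" using injt by (metis card_image inf_le1 inj_on_subset)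
    also have "\<dots> \<le> card {p \<in> t ` A. on_line l p}" using fin g L by (intro card_mono) auto
    finally show "s \<le> card {p \<in> t ` A. on_line l p}" using rich[OF L(1)] by simp
  qed (use fin s in auto)
  then show ?thesis using injg by (simp add: card_image)
qed

text \<open>Let T be the number of incidences and x the number of lines. Cauchy-Schwarz over the
  points, together with the fact that two lines share at most one point of \<open>A\<close>, gives
  T^2 \<le> w^2 (T + x^2). The richness gives 2 w x \<le> T, so the term w^2 x^2 is at most a
  quarter of T^2 and is absorbed; this is the purpose of the factor 2 in the threshold.\<close>

lemma superrich_incidences:
  fixes A :: "'a set" and Y :: "'a set set" and w :: real
  assumes fin: "finite A" "finite Y" and A: "card A \<le> w^2" and w: "w > 0"
    and meet: "\<And>L M. L \<in> Y \<Longrightarrow> M \<in> Y \<Longrightarrow> L \<noteq> M \<Longrightarrow> card (A \<inter> L \<inter> M) \<le> 1"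
    and rich: "\<And>L. L \<in> Y \<Longrightarrow> 2 * w \<le> card (A \<inter> L)"
  shows "(\<Sum>L\<in>Y. real (card (A \<inter> L))) \<le> 4 / 3 * w^2"
proof -
  define T where "T = (\<Sum>L\<in>Y. real (card (A \<inter> L)))"
  define x where "x = real (card Y)"
  define ind where "ind L a = (if a \<in> L then 1 else 0 :: real)" for L and a :: 'a
  have cnt: "real (card (A \<inter> L)) = (\<Sum>a\<in>A. ind L a)" for L
    using fin by (simp add: ind_def sum.If_cases)
  have cnt2: "real (card (A \<inter> L \<inter> M)) = (\<Sum>a\<in>A. ind L a * ind M a)" for L M
  proof -
    have "(\<Sum>a\<in>A. ind L a * ind M a) = (\<Sum>a\<in>A. ind (L \<inter> M) a)" by (intro sum.cong) (auto simp: ind_def)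
    then show ?thesis using cnt[of "L \<inter> M"] by (simp add: Int_assoc)
  qed
  have T0: "T \<ge> 0" unfolding T_def by (intro sum_nonneg) auto
  have "T = (\<Sum>a\<in>A. (\<Sum>L\<in>Y. ind L a) * 1)" unfolding T_def cnt by (subst sum.swap) simp
  then have "T^2 \<le> (\<Sum>a\<in>A. (\<Sum>L\<in>Y. ind L a)^2) * (\<Sum>a\<in>A. 1^2)"
    by (simp only: Cauchy_Schwarz_ineq_sum)
  also have "(\<Sum>a\<in>A. (\<Sum>L\<in>Y. ind L a)^2) = (\<Sum>L\<in>Y. \<Sum>M\<in>Y. real (card (A \<inter> L \<inter> M)))"
  proof -
    have "(\<Sum>a\<in>A. (\<Sum>L\<in>Y. ind L a)^2) = (\<Sum>a\<in>A. \<Sum>L\<in>Y. \<Sum>M\<in>Y. ind L a * ind M a)"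
      by (simp add: power2_eq_square sum_product)
    also have "\<dots> = (\<Sum>L\<in>Y. \<Sum>a\<in>A. \<Sum>M\<in>Y. ind L a * ind M a)" by (rule sum.swap)
    also have "\<dots> = (\<Sum>L\<in>Y. \<Sum>M\<in>Y. \<Sum>a\<in>A. ind L a * ind M a)" by (intro sum.cong sum.swap) auto
    finally show ?thesis by (simp add: cnt2)
  qed
  also have "\<dots> \<le> (\<Sum>L\<in>Y. card (A \<inter> L) + x)"
  proof (rule sum_mono)
    fix L assume L: "L \<in> Y"
    have "(\<Sum>M\<in>Y. real (card (A \<inter> L \<inter> M))) \<le> (\<Sum>M\<in>Y. (if M = L then real (card (A \<inter> L)) else 0) + 1)"
      by (rule sum_mono) (use meet[OF L] in force)
    also have "\<dots> = card (A \<inter> L) + x" using L fin by (simp add: sum.distrib x_def)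
    finally show "(\<Sum>M\<in>Y. real (card (A \<inter> L \<inter> M))) \<le> card (A \<inter> L) + x" .
  qed
  also have "\<dots> = T + x^2" by (simp add: T_def x_def sum.distrib power2_eq_square)
  finally have "T^2 \<le> (T + x^2) * card A" by (simp add: mult_right_mono)
  also have "\<dots> \<le> (T + x^2) * w^2" using A T0 by (intro mult_left_mono) auto
  finally have 1: "T^2 \<le> (T + x^2) * w^2" .
  have "(\<Sum>L\<in>Y. 2 * w) \<le> T" unfolding T_def by (rule sum_mono) (use rich in auto)
  then have "2 * w * x \<le> T" by (simp add: x_def mult.commute)
  then have "(2 * w * x)^2 \<le> T^2" using w by (intro power_mono) (auto simp: x_def)
  then have "T * (3 / 4 * T) \<le> T * w^2" using 1 by (simp add: power2_eq_square algebra_simps)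
  then show ?thesis using T0 w unfolding T_def[symmetric] by (cases "T = 0") (auto simp: mult_le_cancel_left)
qed

subsection \<open>Level sets\<close>

lemma sum_cover_le:
  fixes h :: "'a \<Rightarrow> real"
  assumes "finite A" "finite B" "Z \<subseteq> A \<union> B" "\<And>z. z \<in> A \<union> B \<Longrightarrow> 0 \<le> h z"
  shows "sum h Z \<le> sum h A + sum h B"
proof -
  have "sum h Z \<le> sum h (A \<union> B)" using assms by (intro sum_mono2) auto
  also have "\<dots> \<le> sum h A + sum h B"
  proof -
    have "sum h (A \<inter> B) \<ge> 0" using assms by (intro sum_nonneg) auto
    then show ?thesis using sum.union_inter[OF assms(1,2), of h] by linarith
  qed
  finally show ?thesis .
qed

lemma card_subset_Times:
  assumes "X \<subseteq> A \<times> B" "finite A" "finite B"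
  shows "real (card X) \<le> real (card A) * real (card B)"
proof -
  have "card X \<le> card (A \<times> B)" using assms by (intro card_mono) auto
  then have "real (card X) \<le> real (card (A \<times> B))" by (rule of_nat_mono)
  then show ?thesis by (simp add: card_cartesian_product)
qed

lemma two_pow_pow: "((2::real) ^ c)^2 = 4 ^ c" "((2::real) ^ c)^3 = 8 ^ c"
  by (induction c) (auto simp: power_mult_distrib)

text \<open>A geometric tail is at most twice its first term, and the first admissible scale already
  satisfies 2 * 2^c > s.\<close>

lemma sum_half_powers:
  fixes s :: real
  assumes "s > 0"
  shows "(\<Sum>c \<in> {c \<in> {1..m::nat}. s < 2 ^ (c + 1)}. 1 / 2 ^ c) \<le> 4 / s"
proof (cases "{c \<in> {1..m}. s < 2 ^ (c + 1)} = {}")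
  case True
  then show ?thesis using assms by (simp only: sum.empty) simp
next
  case False
  let ?C = "{c \<in> {1..m}. s < 2 ^ (c + 1)}"
  define c0 where "c0 = Min ?C"
  have c0: "c0 \<in> ?C" "\<And>c. c \<in> ?C \<Longrightarrow> c0 \<le> c" unfolding c0_def using Min_in[OF _ False] by simp_all
  have "(\<Sum>c\<in>?C. 1 / 2 ^ c) \<le> (\<Sum>c = c0..m. 1 / 2 ^ c :: real)"
    using c0 by (intro sum_mono2) auto
  also have "\<dots> \<le> 2 / 2 ^ c0"
  proof (cases "c0 \<le> m")
    case True
    have "(\<Sum>c = c0..c0 + n. 1 / 2 ^ c :: real) = 2 / 2 ^ c0 - 1 / 2 ^ (c0 + n)" for n
    proof (induction n)
      case (Suc n)
      have "(\<Sum>c = c0..c0 + Suc n. 1 / 2 ^ c :: real) = (\<Sum>c = c0..c0 + n. 1 / 2 ^ c) + 1 / 2 ^ (c0 + Suc n)" by simp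
      then show ?case using Suc by simp
    qed simp
    from this[of "m - c0"] show ?thesis using True by simp
  qed simp
  also have "\<dots> \<le> 4 / s"
  proof -
    have "s < 2 * 2 ^ c0" using c0(1) by simp
    then show ?thesis using assms by (simp add: field_simps)
  qed
  finally show ?thesis .
qed

text \<open>The number \<open>lam i\<close> stands for the l2 norm of the coefficients on level
  \<open>i\<close>: a level of at most 2^i points, all with coefficient lam i / 2^(i/2), has norm at
  most \<open>lam i\<close>.\<close>

locale level_sets =
  fixes S :: "(int \<times> int) set" and idx :: "int \<times> int \<Rightarrow> nat" and m :: nat and lam :: "nat \<Rightarrow> real"
  assumes finS: "finite S" and idx_less: "\<And>p. p \<in> S \<Longrightarrow> idx p < m"
    and card_level: "\<And>i. card {p \<in> S. idx p = i} \<le> 2 ^ i"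
    and lam_nonneg: "\<And>i. 0 \<le> lam i"
begin

text \<open>
  \<open>rc i L\<close> is the number of points of level \<open>i\<close> on \<open>L\<close>, \<open>sr\<close> means superrich, and \<open>f\<close> is the
  majorant of the coefficients that is constant on levels.
\<close>

definition w :: "nat \<Rightarrow> real" where "w i = sqrt 2 ^ i"
definition f :: "int \<times> int \<Rightarrow> real" where "f p = lam (idx p) / w (idx p)"
definition lev :: "nat \<Rightarrow> (int \<times> int) set" where "lev i = {p \<in> S. idx p = i}"
definition rc :: "nat \<Rightarrow> (int \<times> int) set \<Rightarrow> real" where "rc i L = card (lev i \<inter> L)"
definition sr :: "nat \<Rightarrow> (int \<times> int) set \<Rightarrow> bool" where "sr i L \<longleftrightarrow> 2 * w i < rc i L"
definition Lines :: "(int \<times> int) set set" where "Lines = (\<lambda>(a, b). ln_through a b) ` {(a, b) \<in> S \<times> S. a \<noteq> b}"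
definition mass :: real where "mass = (\<Sum>i<m. (lam i)^2)"

lemma w_pos [simp]: "0 < w i" "w i \<noteq> 0" "0 \<le> w i" by (auto simp: w_def)

lemma w_sq: "w i ^ 2 = 2 ^ i"
  unfolding w_def by (metis power_mult mult.commute real_sqrt_pow2 zero_le_numeral)

lemma f_nonneg [simp]: "0 \<le> f p" by (simp add: f_def lam_nonneg)

lemma mass_nonneg [simp]: "0 \<le> mass" by (simp add: mass_def sum_nonneg)

lemma finite_lev [simp]: "finite (lev i)" using finS by (simp add: lev_def)

lemma lev_subset: "lev i \<subseteq> S" by (auto simp: lev_def)

lemma f_lev: "p \<in> lev i \<Longrightarrow> f p = lam i / w i" by (simp add: lev_def f_def)

lemma card_lev: "real (card (lev i)) \<le> 2 ^ i"
  using of_nat_mono[OF card_level[of i], where 'a = real] by (simp add: lev_def)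

lemma rc_nonneg [simp]: "0 \<le> rc i L" by (simp add: rc_def)

lemma finite_Lines [simp]: "finite Lines"
  unfolding Lines_def by (rule finite_imageI, rule finite_subset[of _ "S \<times> S"]) (use finS in auto)

lemma LinesI: "a \<in> S \<Longrightarrow> b \<in> S \<Longrightarrow> a \<noteq> b \<Longrightarrow> ln_through a b \<in> Lines"
  by (auto simp: Lines_def)

lemma LinesE: "L \<in> Lines \<Longrightarrow> \<exists>a b. a \<noteq> b \<and> L = ln_through a b"
  by (auto simp: Lines_def)

lemma Lines_meet:
  assumes "L \<in> Lines" "M \<in> Lines" "L \<noteq> M" "finite A"
  shows "card (A \<inter> L \<inter> M) \<le> 1"
proof -
  have "p = q" if "p \<in> A \<inter> L \<inter> M" "q \<in> A \<inter> L \<inter> M" for p q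
  proof (rule ccontr)
    assume ne: "p \<noteq> q"
    obtain a b where ab: "a \<noteq> b" "L = ln_through a b" using LinesE[OF assms(1)] by blast
    obtain c d where cd: "c \<noteq> d" "M = ln_through c d" using LinesE[OF assms(2)] by blast
    have "ln_through p q = L" "ln_through p q = M"
      using ln_through_eq[OF ab(1), of p q] ln_through_eq[OF cd(1), of p q] that ne ab(2) cd(2) by simp_all
    then show False using assms(3) by simp
  qed
  then show ?thesis using assms(4) by (metis card_le_Suc0_iff_eq finite_Int One_nat_def)
qed

lemma sum_f_sq_lev: "(\<Sum>p\<in>lev i. (f p)^2) \<le> (lam i)^2"
proof -
  have "(\<Sum>p\<in>lev i. (f p)^2) = card (lev i) * ((lam i)^2 / 2 ^ i)"
    by (simp add: f_lev power_divide w_sq)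
  also have "\<dots> \<le> 2 ^ i * ((lam i)^2 / 2 ^ i)" using card_lev by (intro mult_right_mono) auto
  finally show ?thesis by simp
qed

lemma sum_by_level: "(\<Sum>p\<in>S. h p) = (\<Sum>i<m. \<Sum>p\<in>lev i. h p)"
  using sum.group[OF finS finite_lessThan, of idx m h] idx_less by (auto simp: lev_def image_subset_iff)

lemma sum_f_sq: "(\<Sum>p\<in>S. (f p)^2) \<le> mass"
  unfolding sum_by_level mass_def by (intro sum_mono sum_f_sq_lev)

text \<open>Two free sums over levels together cost one factor \<open>m\<close>, which is the whole
  loss that the theorem permits.\<close>

lemma sum_lam_sq: "(\<Sum>i<m. lam i)^2 \<le> m * mass"
  using Cauchy_Schwarz_ineq_sum[of "\<lambda>_. 1" lam "{..<m}"] by (simp add: mass_def)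

lemma sr_sum: "(\<Sum>L | L \<in> Lines \<and> sr i L. rc i L) \<le> 4 / 3 * 2 ^ i"
  unfolding rc_def w_sq[symmetric]
  by (rule superrich_incidences)
    (use card_lev Lines_meet in \<open>auto simp: w_sq sr_def rc_def\<close>)

lemma rich_lines:
  assumes "2 \<le> s" "s^2 \<le> 16 * 2 ^ i"
  shows "real (card {L \<in> Lines. s \<le> rc i L}) * s^3 \<le> 1024 * 4 ^ i"
proof -
  have "real (card {L \<in> Lines. s \<le> rc i L}) * s^3 \<le> 1024 * (2 ^ i)^2"
    by (rule rich_integer_lines[of "lev i"]) (use assms card_lev LinesE in \<open>auto simp: rc_def\<close>)
  also have "(2 ^ i)^2 = (4 ^ i :: real)" by (simp flip: power_mult_distrib add: power2_eq_square)
  finally show ?thesis .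
qed

section \<open>Dyadic scales of the richness of lines\<close>

definition dyadic :: "nat \<Rightarrow> nat \<Rightarrow> (int \<times> int) set set" where
  "dyadic i c = {L \<in> Lines. \<not> sr i L \<and> 2 \<le> rc i L \<and> floor_log (card (lev i \<inter> L)) = c}"

lemma dyadic_bounds:
  assumes "L \<in> dyadic i c"
  shows "2 ^ c \<le> rc i L" "rc i L < 2 * 2 ^ c" "1 \<le> c" "(2 ^ c)^2 \<le> 4 * (2 ^ i :: real)"
proof -
  let ?n = "card (lev i \<inter> L)"
  have n: "2 \<le> ?n" "floor_log ?n = c" using assms by (auto simp: dyadic_def rc_def)
  have "2 ^ c \<le> ?n" using floor_log_exp2_le[of ?n] n by simp
  then show 1: "2 ^ c \<le> rc i L" unfolding rc_def by (metis of_nat_mono of_nat_numeral of_nat_power)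
  have "?n < 2 * 2 ^ c" using floor_log_exp2_gt[of ?n] n by simp
  then show "rc i L < 2 * 2 ^ c" unfolding rc_def by (metis of_nat_less_iff of_nat_mult of_nat_numeral of_nat_power)
  show "1 \<le> c" using \<open>?n < 2 * 2 ^ c\<close> n(1) by (cases c) auto
  have "(2 ^ c)^2 \<le> (2 * w i)^2" using 1 assms by (intro power_mono) (auto simp: dyadic_def sr_def)
  then show "(2 ^ c)^2 \<le> 4 * (2 ^ i :: real)" by (simp add: power_mult_distrib w_sq)
qed

lemma dyadic_card: "real (card (dyadic i c)) * 8 ^ c \<le> 1024 * 4 ^ i"
proof (cases "dyadic i c = {}")
  case False
  then obtain L where L: "L \<in> dyadic i c" by blast
  note b = dyadic_bounds[OF L]
  have "(2::real) ^ 1 \<le> 2 ^ c" using b(3) by (intro power_increasing) auto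
  then have c: "2 \<le> (2::real) ^ c" by simp
  have "card (dyadic i c) \<le> card {L \<in> Lines. 2 ^ c \<le> rc i L}"
    using dyadic_bounds(1) by (intro card_mono) (auto simp: dyadic_def)
  then have "real (card (dyadic i c)) * (2 ^ c)^3 \<le> real (card {L \<in> Lines. 2 ^ c \<le> rc i L}) * (2 ^ c)^3"
    by (intro mult_right_mono) auto
  also have "\<dots> \<le> 1024 * 4 ^ i" using c b(4) by (intro rich_lines) (auto intro: order_trans)
  finally show ?thesis unfolding two_pow_pow by simp
qed simp

text \<open>A line that is not superrich has 2^c \<le> 2 * w i, hence c \<le> i/2 + 1. Thus at most
  \<open>m\<close> scales occur.\<close>

lemma dyadic_index_le:
  assumes "L \<in> dyadic i c" "i < m"
  shows "c \<in> {1..m}"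
proof -
  have "(2::real) ^ (2 * c) \<le> 2 ^ (i + 2)"
    using dyadic_bounds(4)[OF assms(1)] unfolding two_pow_pow by (simp add: power_mult)
  then have "2 * c \<le> i + 2" by (rule power_le_imp_le_exp[rotated]) simp
  then show ?thesis using dyadic_bounds(3)[OF assms(1)] assms(2) by auto
qed

lemma sum_dyadic:
  assumes "i < m"
  shows "(\<Sum>L | L \<in> Lines \<and> \<not> sr i L \<and> 2 \<le> rc i L. h L) = (\<Sum>c\<in>{1..m}. \<Sum>L\<in>dyadic i c. h L)"
proof -
  have "(\<Sum>c\<in>{1..m}. \<Sum>L\<in>dyadic i c. h L) = (\<Sum>c\<in>{1..m}. \<Sum>L | L \<in> {L \<in> Lines. \<not> sr i L \<and> 2 \<le> rc i L} \<and> floor_log (card (lev i \<inter> L)) = c. h L)"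
    by (intro sum.cong) (auto simp: dyadic_def)
  also have "\<dots> = (\<Sum>L\<in>{L \<in> Lines. \<not> sr i L \<and> 2 \<le> rc i L}. h L)"
  proof (rule sum.group)
    show "(\<lambda>L. floor_log (card (lev i \<inter> L))) ` {L \<in> Lines. \<not> sr i L \<and> 2 \<le> rc i L} \<subseteq> {1..m}"
      using dyadic_index_le[OF _ assms] unfolding dyadic_def by blast
  qed auto
  finally show ?thesis by simp
qed

text \<open>The power 3 exactly cancels the decay in the bound for rich lines, so all scales
  contribute equally; their number is the factor \<open>m\<close>.\<close>

lemma cubic_sum:
  assumes "i < m"
  shows "(\<Sum>L | L \<in> Lines \<and> \<not> sr i L \<and> 2 \<le> rc i L. rc i L ^ 3) \<le> 8192 * m * 4 ^ i"
proof -
  have "(\<Sum>L\<in>dyadic i c. rc i L ^ 3) \<le> 8192 * 4 ^ i" for c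
  proof -
    have "(\<Sum>L\<in>dyadic i c. rc i L ^ 3) \<le> (\<Sum>L\<in>dyadic i c. (2 * 2 ^ c) ^ 3)"
      using dyadic_bounds(2) by (intro sum_mono power_mono) (auto simp: less_imp_le)
    also have "\<dots> = 8 * (real (card (dyadic i c)) * 8 ^ c)"
      unfolding power_mult_distrib two_pow_pow by simp
    also have "\<dots> \<le> 8 * (1024 * 4 ^ i)" using dyadic_card by (intro mult_left_mono) auto
    finally show ?thesis by simp
  qed
  then have "(\<Sum>c\<in>{1..m}. \<Sum>L\<in>dyadic i c. rc i L ^ 3) \<le> (\<Sum>c\<in>{1..m}. 8192 * 4 ^ i)" by (intro sum_mono)
  then show ?thesis unfolding sum_dyadic[OF assms] by (simp add: mult_ac)
qed

text \<open>With a square in place of the cube the scale 2^c contributes a multiple of 4^i / 2^c.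
  The series converges, so the number of scales does not enter, and the cutoff gains 1/s.\<close>

lemma square_tail_sum:
  assumes "i < m" "s > 0"
  shows "(\<Sum>L | L \<in> Lines \<and> \<not> sr i L \<and> 2 \<le> rc i L \<and> s < rc i L. rc i L ^ 2) \<le> 16384 * 4 ^ i / s"
proof -
  have each: "(\<Sum>L\<in>dyadic i c. if s < rc i L then rc i L ^ 2 else 0) \<le> (if s < 2 ^ (c + 1) then 4096 * 4 ^ i / 2 ^ c else 0)" for c
  proof (cases "s < 2 ^ (c + 1)")
    case True
    have "(\<Sum>L\<in>dyadic i c. if s < rc i L then rc i L ^ 2 else 0) \<le> (\<Sum>L\<in>dyadic i c. (2 * 2 ^ c) ^ 2)"
    proof (rule sum_mono)
      fix L assume "L \<in> dyadic i c"
      then have "rc i L ^ 2 \<le> (2 * 2 ^ c) ^ 2" using dyadic_bounds(2) by (intro power_mono) (auto simp: less_imp_le)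
      then show "(if s < rc i L then rc i L ^ 2 else 0) \<le> (2 * 2 ^ c) ^ 2" by simp
    qed
    also have "\<dots> = 4 * (real (card (dyadic i c)) * 8 ^ c) / 2 ^ c"
    proof -
      have "((2::real) ^ c)^2 = 8 ^ c / 2 ^ c" unfolding two_pow_pow power_divide[symmetric] by simp
      then show ?thesis by (simp add: power_mult_distrib)
    qed
    also have "\<dots> \<le> 4 * (1024 * 4 ^ i) / 2 ^ c" using dyadic_card by (intro divide_right_mono mult_left_mono) auto
    finally show ?thesis using True by simp
  next
    case False
    then have "\<not> s < rc i L" if "L \<in> dyadic i c" for L using dyadic_bounds(2)[OF that] by simp
    then show ?thesis using False by simp
  qed
  have "(\<Sum>L | L \<in> Lines \<and> \<not> sr i L \<and> 2 \<le> rc i L \<and> s < rc i L. rc i L ^ 2)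
      = (\<Sum>L | L \<in> Lines \<and> \<not> sr i L \<and> 2 \<le> rc i L. if s < rc i L then rc i L ^ 2 else 0)"
    by (rule sum.mono_neutral_cong_left) auto
  also have "\<dots> \<le> (\<Sum>c\<in>{1..m}. if s < 2 ^ (c + 1) then 4096 * 4 ^ i / 2 ^ c else 0)"
    unfolding sum_dyadic[OF assms(1)] by (intro sum_mono each)
  also have "\<dots> = 4096 * 4 ^ i * (\<Sum>c\<in>{c \<in> {1..m}. s < 2 ^ (c + 1)}. 1 / 2 ^ c)"
    unfolding sum.inter_filter[OF finite_atLeastAtMost] sum_distrib_left by (intro sum.cong) auto
  also have "\<dots> \<le> 4096 * 4 ^ i * (4 / s)" using sum_half_powers[OF assms(2)] by (intro mult_left_mono) auto
  finally show ?thesis by simp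
qed

section \<open>Pairs of points from two levels\<close>

definition prs :: "nat \<Rightarrow> nat \<Rightarrow> ((int \<times> int) \<times> (int \<times> int)) set" where
  "prs i j = {z \<in> lev i \<times> lev j. fst z \<noteq> snd z}"

abbreviation lnz :: "(int \<times> int) \<times> (int \<times> int) \<Rightarrow> (int \<times> int) set" where
  "lnz z \<equiv> ln_through (fst z) (snd z)"

lemma finite_prs [simp]: "finite (prs i j)" by (simp add: prs_def)

lemma card_prs: "real (card (prs i j)) \<le> 2 ^ i * 2 ^ j"
proof -
  have "real (card (prs i j)) \<le> real (card (lev i)) * real (card (lev j))"
    by (rule card_subset_Times) (auto simp: prs_def)
  also have "\<dots> \<le> 2 ^ i * 2 ^ j" using card_lev by (intro mult_mono) auto
  finally show ?thesis .
qed

lemma prs_Lines: "z \<in> prs i j \<Longrightarrow> lnz z \<in> Lines"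
  using lev_subset[of i] lev_subset[of j] by (intro LinesI) (auto simp: prs_def mem_Times_iff)

text \<open>All pairs on a line \<open>L\<close> share the value \<open>h L\<close>, and
  \<open>L\<close> carries at most \<open>rc i L * rc j L\<close> of them.\<close>

lemma sum_pairs_le_lines:
  assumes "\<And>L. L \<in> Lines \<Longrightarrow> P L \<Longrightarrow> 0 \<le> h L"
  shows "(\<Sum>z | z \<in> prs i j \<and> P (lnz z). h (lnz z)) \<le> (\<Sum>L | L \<in> Lines \<and> P L. rc i L * rc j L * h L)"
proof -
  let ?Z = "{z \<in> prs i j. P (lnz z)}"
  have "(\<Sum>z\<in>?Z. h (lnz z)) = (\<Sum>L | L \<in> Lines \<and> P L. \<Sum>z | z \<in> ?Z \<and> lnz z = L. h (lnz z))"
    by (rule sum.group[symmetric]) (auto dest: prs_Lines)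
  also have "\<dots> \<le> (\<Sum>L | L \<in> Lines \<and> P L. rc i L * rc j L * h L)"
  proof (rule sum_mono)
    fix L assume L: "L \<in> {L. L \<in> Lines \<and> P L}"
    have "real (card {z \<in> ?Z. lnz z = L}) \<le> rc i L * rc j L" unfolding rc_def
      by (rule card_subset_Times) (auto simp: prs_def)
    moreover have "(\<Sum>z | z \<in> ?Z \<and> lnz z = L. h (lnz z)) = card {z \<in> ?Z. lnz z = L} * h L" by simp
    ultimately show "(\<Sum>z | z \<in> ?Z \<and> lnz z = L. h (lnz z)) \<le> rc i L * rc j L * h L"
      using assms L by (simp add: mult_right_mono)
  qed
  finally show ?thesis .
qed

text \<open>By \<open>sr_sum\<close> there are at most 4/3 * 2^i incidences of level
  \<open>i\<close>, and each of the lines in question carries at most \<open>2 * w j\<close> points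
  of level \<open>j\<close>.\<close>

lemma sr_pairs: "card {z \<in> prs i j. sr i (lnz z) \<and> \<not> sr j (lnz z)} \<le> 8 / 3 * w j * 2 ^ i"
proof -
  have "real (card {z \<in> prs i j. sr i (lnz z) \<and> \<not> sr j (lnz z)}) = (\<Sum>z | z \<in> prs i j \<and> (sr i (lnz z) \<and> \<not> sr j (lnz z)). 1)"
    by simp
  also have "\<dots> \<le> (\<Sum>L | L \<in> Lines \<and> (sr i L \<and> \<not> sr j L). rc i L * rc j L * 1)"
    by (rule sum_pairs_le_lines) auto
  also have "\<dots> \<le> (\<Sum>L | L \<in> Lines \<and> (sr i L \<and> \<not> sr j L). rc i L * (2 * w j))"
    by (intro sum_mono) (auto simp: sr_def mult_left_mono)
  also have "\<dots> \<le> (\<Sum>L | L \<in> Lines \<and> sr i L. rc i L * (2 * w j))"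
    by (intro sum_mono2) auto
  also have "\<dots> = (\<Sum>L | L \<in> Lines \<and> sr i L. rc i L) * (2 * w j)" by (simp add: sum_distrib_right)
  also have "\<dots> \<le> (4 / 3 * 2 ^ i) * (2 * w j)" using sr_sum by (intro mult_right_mono) auto
  finally show ?thesis by (simp add: mult_ac)
qed

text \<open>The term with exponent 1/3 comes from lines with at least two points of both levels and
  alone carries the number \<open>m\<close> of scales. The exponent 1/2 comes from lines with at
  most one point of level \<open>j\<close>, and the 1 from lines that are poor for level
  \<open>i\<close> or superrich for level \<open>j\<close>.\<close>

definition G :: "nat \<Rightarrow> nat \<Rightarrow> real" where
  "G i j = 2 ^ i * 2 ^ j * (m * 2 powr ((real i - real j) / 3) + 2 powr ((real i - real j) / 2) + 1)"

lemma G_nonneg: "0 \<le> G i j" by (simp add: G_def)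

text \<open>
  On lines with at least two points of either level, \<open>r\<^sub>j r\<^sub>i\<^sup>2\<close> is dominated by the cube of
  \<open>r\<^sub>i\<close> or of \<open>r\<^sub>j\<close>, with weights \<open>1 / y\<close> and \<open>y\<^sup>2\<close> that balance the two resulting sums;
  the threshold \<open>s\<close> does the same for lines with one point of level \<open>j\<close>.
\<close>

lemma normal_pairs:
  assumes ij: "i < m" "j < m"
  shows "(\<Sum>z | z \<in> prs i j \<and> \<not> sr i (lnz z). rc i (lnz z)) \<le> 20000 * G i j"
proof -
  define D where "D = real i - real j"
  \<comment> \<open>These values solve 4^i / s = 2^i 2^j s and 4^i / y = y^2 4^j.\<close>
  define s where "s = 2 powr (D / 2)"
  define y where "y = 2 powr (2 * D / 3)"
  have pos: "s > 0" "y > 0" by (auto simp: s_def y_def)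
  let ?h = "\<lambda>z. rc i (lnz z)"
  let ?Z = "{z \<in> prs i j. \<not> sr i (lnz z)}"
  let ?Z1 = "{z \<in> prs i j. \<not> sr i (lnz z) \<and> sr j (lnz z)}"
  let ?Z2 = "{z \<in> prs i j. ?h z \<le> 1 + s}"
  let ?Z3 = "{z \<in> prs i j. \<not> sr i (lnz z) \<and> 2 \<le> ?h z \<and> s < ?h z \<and> rc j (lnz z) \<le> 1}"
  let ?Z4 = "{z \<in> prs i j. \<not> sr i (lnz z) \<and> 2 \<le> ?h z \<and> \<not> sr j (lnz z) \<and> 2 \<le> rc j (lnz z)}"
  have int: "rc k L \<le> 1 \<or> 2 \<le> rc k L" for k L
  proof -
    have "card (lev k \<inter> L) \<le> 1 \<or> 2 \<le> card (lev k \<inter> L)" by linarith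
    then show ?thesis by (auto simp: rc_def)
  qed
  have cover: "?Z \<subseteq> ?Z1 \<union> (?Z2 \<union> (?Z3 \<union> ?Z4))"
  proof
    fix z assume z: "z \<in> ?Z"
    then show "z \<in> ?Z1 \<union> (?Z2 \<union> (?Z3 \<union> ?Z4))"
      using int[of i "lnz z"] int[of j "lnz z"] pos by auto
  qed
  have 1: "sum ?h ?Z1 \<le> 16 / 3 * (2 ^ i * 2 ^ j)"
  proof -
    have "sum ?h ?Z1 \<le> (\<Sum>L | L \<in> Lines \<and> (\<not> sr i L \<and> sr j L). rc i L * rc j L * rc i L)"
      by (rule sum_pairs_le_lines) auto
    also have "\<dots> \<le> (\<Sum>L | L \<in> Lines \<and> (\<not> sr i L \<and> sr j L). 4 * 2 ^ i * rc j L)"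
    proof (rule sum_mono)
      fix L assume "L \<in> {L. L \<in> Lines \<and> (\<not> sr i L \<and> sr j L)}"
      then have "rc i L ^ 2 \<le> (2 * w i)^2" by (intro power_mono) (auto simp: sr_def)
      then have "rc i L ^ 2 * rc j L \<le> 4 * 2 ^ i * rc j L"
        by (intro mult_right_mono) (auto simp: power_mult_distrib w_sq)
      then show "rc i L * rc j L * rc i L \<le> 4 * 2 ^ i * rc j L" by (simp add: power2_eq_square mult_ac)
    qed
    also have "\<dots> \<le> (\<Sum>L | L \<in> Lines \<and> sr j L. 4 * 2 ^ i * rc j L)" by (intro sum_mono2) auto
    also have "\<dots> = 4 * 2 ^ i * (\<Sum>L | L \<in> Lines \<and> sr j L. rc j L)" by (simp add: sum_distrib_left)
    also have "\<dots> \<le> 4 * 2 ^ i * (4 / 3 * 2 ^ j)" using sr_sum by (intro mult_left_mono) auto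
    finally show ?thesis by simp
  qed
  have 2: "sum ?h ?Z2 \<le> (2 ^ i * 2 ^ j) * (1 + s)"
  proof -
    have "sum ?h ?Z2 \<le> (\<Sum>z\<in>?Z2. 1 + s)" by (intro sum_mono) auto
    also have "\<dots> \<le> (\<Sum>z\<in>prs i j. 1 + s)" using pos by (intro sum_mono2) auto
    also have "\<dots> \<le> (2 ^ i * 2 ^ j) * (1 + s)" using card_prs pos by (simp add: mult_right_mono del: distrib_left)
    finally show ?thesis .
  qed
  have 3: "sum ?h ?Z3 \<le> 16384 * (4 ^ i / s)"
  proof -
    have "sum ?h ?Z3 \<le> (\<Sum>L | L \<in> Lines \<and> (\<not> sr i L \<and> 2 \<le> rc i L \<and> s < rc i L \<and> rc j L \<le> 1). rc i L * rc j L * rc i L)"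
      by (rule sum_pairs_le_lines) auto
    also have "\<dots> \<le> (\<Sum>L | L \<in> Lines \<and> (\<not> sr i L \<and> 2 \<le> rc i L \<and> s < rc i L \<and> rc j L \<le> 1). rc i L ^ 2)"
    proof (rule sum_mono)
      fix L assume "L \<in> {L. L \<in> Lines \<and> (\<not> sr i L \<and> 2 \<le> rc i L \<and> s < rc i L \<and> rc j L \<le> 1)}"
      then have "rc i L ^ 2 * rc j L \<le> rc i L ^ 2 * 1" by (intro mult_left_mono) auto
      then show "rc i L * rc j L * rc i L \<le> rc i L ^ 2" by (simp add: power2_eq_square mult_ac)
    qed
    also have "\<dots> \<le> (\<Sum>L | L \<in> Lines \<and> \<not> sr i L \<and> 2 \<le> rc i L \<and> s < rc i L. rc i L ^ 2)"
      by (intro sum_mono2) auto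
    also have "\<dots> \<le> 16384 * 4 ^ i / s" by (rule square_tail_sum[OF ij(1) pos(1)])
    finally show ?thesis by simp
  qed
  have 4: "sum ?h ?Z4 \<le> 8192 * m * (4 ^ i / y + y^2 * 4 ^ j)"
  proof -
    let ?A = "{L. L \<in> Lines \<and> (\<not> sr i L \<and> 2 \<le> rc i L \<and> \<not> sr j L \<and> 2 \<le> rc j L)}"
    have "sum ?h ?Z4 \<le> (\<Sum>L\<in>?A. rc i L * rc j L * rc i L)"
      by (rule sum_pairs_le_lines) auto
    also have "\<dots> \<le> (\<Sum>L\<in>?A. rc i L ^ 3 / y + y^2 * rc j L ^ 3)"
    proof (rule sum_mono)
      fix L
      have a: "0 \<le> rc i L ^ 3 / y" "0 \<le> y^2 * rc j L ^ 3" using pos by auto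
      have e: "rc i L * rc j L * rc i L = rc j L * rc i L ^ 2" by (simp add: power2_eq_square mult_ac)
      show "rc i L * rc j L * rc i L \<le> rc i L ^ 3 / y + y^2 * rc j L ^ 3"
      proof (cases "rc j L * y \<le> rc i L")
        case True
        then have "rc j L \<le> rc i L / y" using pos by (simp add: field_simps)
        then have "rc j L * rc i L ^ 2 \<le> rc i L / y * rc i L ^ 2" by (intro mult_right_mono) auto
        also have "\<dots> = rc i L ^ 3 / y" by (simp add: power2_eq_square power3_eq_cube)
        finally show ?thesis unfolding e using a by linarith
      next
        case False
        then have "rc i L ^ 2 \<le> (rc j L * y)^2" by (intro power_mono) auto
        then have "rc j L * rc i L ^ 2 \<le> rc j L * (rc j L * y)^2" by (intro mult_left_mono) auto
        also have "\<dots> = y^2 * rc j L ^ 3" by (simp add: power2_eq_square power3_eq_cube)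
        finally show ?thesis unfolding e using a by linarith
      qed
    qed
    also have "\<dots> = (\<Sum>L\<in>?A. rc i L ^ 3) / y + y^2 * (\<Sum>L\<in>?A. rc j L ^ 3)"
      by (simp add: sum.distrib sum_distrib_left sum_divide_distrib)
    also have "\<dots> \<le> (8192 * m * 4 ^ i) / y + y^2 * (8192 * m * 4 ^ j)"
    proof (intro add_mono divide_right_mono mult_left_mono)
      show "(\<Sum>L\<in>?A. rc i L ^ 3) \<le> 8192 * m * 4 ^ i"
        by (rule order_trans[OF sum_mono2 cubic_sum[OF ij(1)]]) auto
      show "(\<Sum>L\<in>?A. rc j L ^ 3) \<le> 8192 * m * 4 ^ j"
        by (rule order_trans[OF sum_mono2 cubic_sum[OF ij(2)]]) auto
    qed (use pos in auto)
    finally show ?thesis by (simp add: algebra_simps)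
  qed
  have fin: "finite ?Z1" "finite ?Z2" "finite ?Z3" "finite ?Z4" by simp_all
  have "sum ?h ?Z \<le> sum ?h ?Z1 + sum ?h (?Z2 \<union> (?Z3 \<union> ?Z4))"
    by (rule sum_cover_le[OF _ _ cover]) (use fin in auto)
  also have "sum ?h (?Z2 \<union> (?Z3 \<union> ?Z4)) \<le> sum ?h ?Z2 + sum ?h (?Z3 \<union> ?Z4)"
    by (rule sum_cover_le) (use fin in auto)
  also have "sum ?h (?Z3 \<union> ?Z4) \<le> sum ?h ?Z3 + sum ?h ?Z4"
    by (rule sum_cover_le) (use fin in auto)
  finally have total: "sum ?h ?Z \<le> 16 / 3 * (2 ^ i * 2 ^ j) + (2 ^ i * 2 ^ j) * (1 + s)
      + 16384 * (4 ^ i / s) + 8192 * m * (4 ^ i / y + y^2 * 4 ^ j)"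
    using 1 2 3 4 by linarith
  have pw: "(2::real) ^ k = 2 powr real k" "(4::real) ^ k = 2 powr (2 * real k)" for k
    by (simp_all add: powr_realpow[symmetric] powr_powr[symmetric] power_mult flip: powr_numeral)
  have e1: "4 ^ i / s = 2 ^ i * 2 ^ j * s" unfolding pw s_def D_def
    by (simp only: powr_add[symmetric] powr_diff[symmetric]) (rule arg_cong[where f = "(powr) 2"], simp add: field_simps)
  have e2: "4 ^ i / y = 2 ^ i * 2 ^ j * 2 powr (D / 3)" unfolding pw y_def D_def
    by (simp only: powr_add[symmetric] powr_diff[symmetric]) (rule arg_cong[where f = "(powr) 2"], simp add: field_simps)
  have e3: "y^2 * 4 ^ j = 2 ^ i * 2 ^ j * 2 powr (D / 3)" unfolding pw y_def D_def power2_eq_square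
    by (simp only: powr_add[symmetric] powr_diff[symmetric]) (rule arg_cong[where f = "(powr) 2"], simp add: field_simps)
  define Q where "Q = (2::real) ^ i * 2 ^ j"
  define t where "t = m * 2 powr (D / 3)"
  have nn: "Q \<ge> 0" "Q * s \<ge> 0" "Q * t \<ge> 0" using pos by (auto simp: Q_def t_def)
  have "sum ?h ?Z \<le> 16 / 3 * Q + Q * (1 + s) + 16384 * (Q * s) + 16384 * (Q * t)"
    using total unfolding e1 e2 e3 Q_def[symmetric] t_def by (simp add: algebra_simps)
  also have "\<dots> \<le> 20000 * (Q * (t + s + 1))" using nn by (simp add: algebra_simps)
  finally show ?thesis by (simp add: G_def Q_def t_def s_def D_def)
qed

end

subsection \<open>Rectangles\<close>

text \<open>Schur's test: bound x_i x_l by half the sum of the squares; every row and every column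
  of the kernel sums to at most 1/(1-q). Unlike \<open>sum_lam_sq\<close>, this loses no factor
  depending on the number of levels.\<close>

lemma schur_sum:
  fixes x :: "nat \<Rightarrow> real"
  assumes x: "\<And>i. 0 \<le> x i" and q: "0 \<le> q" "q < 1"
  shows "(\<Sum>l<m. \<Sum>i<m. if i \<le> l then x i * x l * q ^ (l - i) else 0) \<le> (\<Sum>i<m. (x i)^2) / (1 - q)"
proof -
  have geo: "(\<Sum>i<m. if i \<le> l then q ^ (l - i) else 0) \<le> 1 / (1 - q)" if "l < m" for l
  proof -
    have "(\<Sum>i<m. if i \<le> l then q ^ (l - i) else 0) = (\<Sum>i\<in>{..l}. q ^ (l - i))"
      using that by (intro sum.mono_neutral_cong_right) auto
    also have "\<dots> = (\<Sum>i\<in>{..l}. q ^ i)" by (rule sum.reindex_bij_witness[of _ "\<lambda>i. l - i" "\<lambda>i. l - i"]) auto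
    also have "\<dots> = (1 - q ^ Suc l) / (1 - q)" using q by (subst sum_gp0) auto
    also have "\<dots> \<le> 1 / (1 - q)" using q by (intro divide_right_mono) auto
    finally show ?thesis .
  qed
  have geo': "(\<Sum>l<m. if i \<le> l then q ^ (l - i) else 0) \<le> 1 / (1 - q)" for i
  proof -
    have "(\<Sum>l<m. if i \<le> l then q ^ (l - i) else 0) = (\<Sum>l\<in>{i..<m}. q ^ (l - i))"
      by (intro sum.mono_neutral_cong_right) auto
    also have "\<dots> = (\<Sum>l<m - i. q ^ l)"
      by (rule sum.reindex_bij_witness[of _ "\<lambda>l. l + i" "\<lambda>l. l - i"]) auto
    also have "\<dots> = (1 - q ^ (m - i)) / (1 - q)" using q by (subst sum_gp_strict) auto
    also have "\<dots> \<le> 1 / (1 - q)" using q by (intro divide_right_mono) auto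
    finally show ?thesis .
  qed
  have "(\<Sum>l<m. \<Sum>i<m. if i \<le> l then x i * x l * q ^ (l - i) else 0)
      \<le> (\<Sum>l<m. \<Sum>i<m. (x i)^2 / 2 * (if i \<le> l then q ^ (l - i) else 0) + (x l)^2 / 2 * (if i \<le> l then q ^ (l - i) else 0))"
  proof (intro sum_mono)
    fix l i
    have "x i * x l \<le> (x i)^2 / 2 + (x l)^2 / 2" using sum_squares_bound[of "x i" "x l"] by (simp add: field_simps)
    then have "x i * x l * q ^ (l - i) \<le> ((x i)^2 / 2 + (x l)^2 / 2) * q ^ (l - i)" using q by (intro mult_right_mono) auto
    then show "(if i \<le> l then x i * x l * q ^ (l - i) else 0) \<le> (x i)^2 / 2 * (if i \<le> l then q ^ (l - i) else 0) + (x l)^2 / 2 * (if i \<le> l then q ^ (l - i) else 0)"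
      by (simp add: distrib_right)
  qed
  also have "\<dots> = (\<Sum>l<m. \<Sum>i<m. (x i)^2 / 2 * (if i \<le> l then q ^ (l - i) else 0)) + (\<Sum>l<m. \<Sum>i<m. (x l)^2 / 2 * (if i \<le> l then q ^ (l - i) else 0))"
    by (simp add: sum.distrib)
  also have "(\<Sum>l<m. \<Sum>i<m. (x i)^2 / 2 * (if i \<le> l then q ^ (l - i) else 0)) = (\<Sum>i<m. (x i)^2 / 2 * (\<Sum>l<m. if i \<le> l then q ^ (l - i) else 0))"
    unfolding sum_distrib_left by (rule sum.swap)
  also have "\<dots> \<le> (\<Sum>i<m. (x i)^2 / 2 * (1 / (1 - q)))" by (intro sum_mono mult_left_mono geo') auto
  also have "(\<Sum>l<m. \<Sum>i<m. (x l)^2 / 2 * (if i \<le> l then q ^ (l - i) else 0)) \<le> (\<Sum>l<m. (x l)^2 / 2 * (1 / (1 - q)))"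
    unfolding sum_distrib_left[symmetric] by (intro sum_mono mult_left_mono geo) auto
  also have "(\<Sum>i<m. (x i)^2 / 2 * (1 / (1 - q))) + (\<Sum>l<m. (x l)^2 / 2 * (1 / (1 - q))) = (\<Sum>i<m. (x i)^2) * (1 / (1 - q))"
    unfolding sum_distrib_right sum.distrib[symmetric] distrib_right[symmetric] field_sum_of_halves ..
  finally show ?thesis by simp
qed

text \<open>The last term dominates. A bound \<open>q\<close> for the ratio, in place of the ratio
  itself, keeps the later constants rational.\<close>

lemma geometric_powr_sum:
  fixes al q y :: real
  assumes "2 powr (- al) \<le> q" "q < 1"
  shows "(\<Sum>i\<le>l. 2 powr (al * (real i - y))) \<le> 2 powr (al * (real l - y)) / (1 - q)"
proof (induction l)
  case 0
  have q0: "0 \<le> q" using assms(1) powr_ge_zero order_trans by blast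
  have "2 powr (al * (real 0 - y)) * (1 - q) \<le> 2 powr (al * (real 0 - y)) * 1" using q0 by (intro mult_left_mono) auto
  then show ?case using assms by (simp add: field_simps)
next
  case (Suc l)
  let ?X = "2 powr (al * (real (Suc l) - y))"
  have "2 powr (al * (real l - y)) = ?X * 2 powr (- al)" by (simp add: powr_add[symmetric] algebra_simps)
  also have "\<dots> \<le> ?X * q" using assms by (intro mult_left_mono) auto
  finally have "2 powr (al * (real l - y)) / (1 - q) \<le> ?X * q / (1 - q)" using assms by (intro divide_right_mono) auto
  then have "(\<Sum>i\<le>Suc l. 2 powr (al * (real i - y))) \<le> ?X * q / (1 - q) + ?X" using Suc by simp
  also have "\<dots> = ?X / (1 - q)" using assms by (simp add: field_simps)
  finally show ?case .
qed

text \<open>Each is verified by raising to a power and comparing with 1/2. The values 4/5, 3/4 and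
  9/10 turn 1/(1-q) into 5, 4 and 10.\<close>

lemma powr_two_bounds: "2 powr (- (1 / 3)) \<le> (4 / 5 :: real)" "2 powr (- (1 / 2)) \<le> (3 / 4 :: real)" "2 powr (- (1 / 6)) \<le> (9 / 10 :: real)"
proof -
  have *: "2 powr (- (1 / real n)) \<le> q" if "0 < n" "0 < q" "1 / 2 \<le> q ^ n" for n and q :: real
  proof -
    have "(2 powr (- (1 / real n))) ^ n = 2 powr (- 1)" using that by (simp add: powr_powr powr_realpow[symmetric])
    also have "\<dots> = 1 / 2" by (simp add: powr_minus_divide)
    finally have e: "(2 powr (- (1 / real n))) ^ n = 1 / 2" .
    have "(2 powr (- (1 / real n))) ^ n \<le> q ^ n" unfolding e by (rule that(3))
    then show ?thesis using that by (subst (asm) power_mono_iff) auto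
  qed
  show "2 powr (- (1 / 3)) \<le> (4 / 5 :: real)" using *[of 3 "4/5"] by (simp add: power_divide)
  show "2 powr (- (1 / 2)) \<le> (3 / 4 :: real)" using *[of 2 "3/4"] by (simp add: power_divide)
  show "2 powr (- (1 / 6)) \<le> (9 / 10 :: real)" using *[of 6 "9/10"] by (simp add: power_divide)
qed

section \<open>Rectangles coded by a corner between its two neighbours\<close>

type_synonym triple = "(int \<times> int) \<times> (int \<times> int) \<times> (int \<times> int)"

abbreviation vA :: "triple \<Rightarrow> int \<times> int" where "vA z \<equiv> fst z"
abbreviation vB :: "triple \<Rightarrow> int \<times> int" where "vB z \<equiv> fst (snd z)"
abbreviation vC :: "triple \<Rightarrow> int \<times> int" where "vC z \<equiv> snd (snd z)"
definition vD :: "triple \<Rightarrow> int \<times> int" where "vD z = vA z + vC z - vB z"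

lemma triple_eqI: "vA z = vA z' \<Longrightarrow> vB z = vB z' \<Longrightarrow> vC z = vC z' \<Longrightarrow> z = z'"
  by (simp add: prod_eq_iff)

context level_sets
begin

definition R :: "triple set" where
  "R = {z \<in> S \<times> S \<times> S. vD z \<in> S \<and> vA z \<noteq> vB z \<and> vC z \<noteq> vB z \<and> right_angle (vA z) (vB z) (vC z)}"

definition W :: "triple \<Rightarrow> real" where "W z = f (vA z) * f (vB z) * f (vC z) * f (vD z)"

abbreviation l1 :: "triple \<Rightarrow> (int \<times> int) set" where "l1 z \<equiv> ln_through (vA z) (vB z)"
abbreviation l2 :: "triple \<Rightarrow> (int \<times> int) set" where "l2 z \<equiv> ln_through (vB z) (vC z)"

lemma W_nonneg [simp]: "0 \<le> W z" by (simp add: W_def)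

lemma finite_R [simp]: "finite R"
  by (rule finite_subset[of _ "S \<times> S \<times> S"]) (auto simp: R_def finS)

lemma finite_subR: "Z \<subseteq> R \<Longrightarrow> finite Z" using finite_R finite_subset by blast

lemma R_D:
  assumes "z \<in> R"
  shows "vA z \<in> S" "vB z \<in> S" "vC z \<in> S" "vD z \<in> S" "vA z \<noteq> vB z" "vC z \<noteq> vB z"
    "right_angle (vA z) (vB z) (vC z)" "right_angle (vB z) (vA z) (vD z)"
  using assms by (auto simp: R_def mem_Times_iff right_angle_def vD_def algebra_simps)

lemma idx_R: "z \<in> R \<Longrightarrow> idx (vA z) < m \<and> idx (vB z) < m \<and> idx (vC z) < m \<and> idx (vD z) < m"
  using R_D idx_less by blast

lemma lev_R: "z \<in> R \<Longrightarrow> vA z \<in> lev (idx (vA z)) \<and> vB z \<in> lev (idx (vB z)) \<and> vC z \<in> lev (idx (vC z))"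
  using R_D by (auto simp: lev_def)

text \<open>Incidences of the superrich lines of level \<open>i\<close> with their points of that
  level; by \<open>sr_sum\<close> there are at most 4/3 * 2^i of them.\<close>

definition Fl :: "nat \<Rightarrow> ((int \<times> int) set \<times> (int \<times> int)) set" where
  "Fl i = (SIGMA L:{L \<in> Lines. sr i L}. lev i \<inter> L)"

lemma finite_Fl [simp]: "finite (Fl i)" by (simp add: Fl_def)

text \<open>A point of level \<open>i\<close> has squared coefficient (lam i)^2 / 2^i, which cancels
  the number of incidences; the second point ranges over all of \<open>S\<close> and contributes
  \<open>mass\<close>.\<close>

lemma Fl_sum:
  assumes fin: "finite Z" and inj: "inj_on \<phi> Z" and im: "\<phi> ` Z \<subseteq> Fl i \<times> S"
  shows "(\<Sum>z\<in>Z. (f (snd (fst (\<phi> z))) * f (snd (\<phi> z)))^2) \<le> 4 / 3 * (lam i)^2 * mass"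
proof -
  have "(\<Sum>z\<in>Z. (f (snd (fst (\<phi> z))) * f (snd (\<phi> z)))^2) = (\<Sum>x\<in>\<phi> ` Z. (f (snd (fst x)) * f (snd x))^2)"
    using inj by (simp add: sum.reindex)
  also have "\<dots> \<le> (\<Sum>x\<in>Fl i \<times> S. (f (snd (fst x)) * f (snd x))^2)"
    using im finS by (intro sum_mono2) auto
  also have "\<dots> = (\<Sum>y\<in>Fl i. (f (snd y))^2) * (\<Sum>q\<in>S. (f q)^2)"
    unfolding sum_product sum.cartesian_product by (intro sum.cong) (auto simp: power_mult_distrib)
  also have "\<dots> \<le> (4 / 3 * (lam i)^2) * mass"
  proof (intro mult_mono sum_f_sq)
    have "(\<Sum>y\<in>Fl i. (f (snd y))^2) = (\<Sum>y\<in>Fl i. (lam i)^2 / 2 ^ i)"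
      by (intro sum.cong) (auto simp: Fl_def f_lev power_divide w_sq)
    also have "\<dots> = real (card (Fl i)) * ((lam i)^2 / 2 ^ i)" by simp
    also have "real (card (Fl i)) = (\<Sum>L | L \<in> Lines \<and> sr i L. rc i L)"
      by (simp add: Fl_def rc_def)
    also have "\<dots> * ((lam i)^2 / 2 ^ i) \<le> (4 / 3 * 2 ^ i) * ((lam i)^2 / 2 ^ i)"
      using sr_sum by (intro mult_right_mono) auto
    finally show "(\<Sum>y\<in>Fl i. (f (snd y))^2) \<le> 4 / 3 * (lam i)^2" by simp
  qed (auto intro: sum_nonneg)
  finally show ?thesis .
qed

text \<open>Cauchy-Schwarz separates the diagonals \<open>(a, c)\<close> and \<open>(b, d)\<close>.
  The line of the side with \<open>a\<close> and \<open>c\<close> determines \<open>b\<close> as the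
  foot of the perpendicular from \<open>c\<close>; the same line with \<open>b\<close> and
  \<open>d\<close> determines \<open>a\<close> as the foot from \<open>d\<close>. So either diagonal
  is counted by \<open>Fl_sum\<close>.\<close>

lemma case_rich_rich:
  assumes Z: "Z \<subseteq> R" and sr: "\<And>z. z \<in> Z \<Longrightarrow> sr (idx (vA z)) (l1 z) \<and> sr (idx (vB z)) (l1 z)"
  shows "sum W Z \<le> 4 / 3 * m * mass^2"
proof -
  have fin: "finite Z" using finite_subR Z .
  have "sum W Z = (\<Sum>y\<in>{..<m} \<times> {..<m}. \<Sum>z | z \<in> Z \<and> (idx (vA z), idx (vB z)) = y. W z)"
    using Z idx_R by (intro sum.group[symmetric] fin) auto
  also have "\<dots> \<le> (\<Sum>y\<in>{..<m} \<times> {..<m}. 4 / 3 * (lam (fst y) * lam (snd y)) * mass)"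
  proof (rule sum_mono)
    fix y :: "nat \<times> nat"
    obtain i j where y: "y = (i, j)" by force
    let ?Z = "{z \<in> Z. (idx (vA z), idx (vB z)) = y}"
    have mem: "z \<in> R" "idx (vA z) = i" "idx (vB z) = j" "vA z \<in> lev i" "vB z \<in> lev j" "l1 z \<in> Lines" "sr i (l1 z)" "sr j (l1 z)"
      if "z \<in> ?Z" for z
    proof -
      show r: "z \<in> R" using that Z by auto
      show e: "idx (vA z) = i" "idx (vB z) = j" using that y by auto
      show "vA z \<in> lev i" "vB z \<in> lev j" using lev_R[OF r] e by auto
      show "l1 z \<in> Lines" using R_D[OF r] by (intro LinesI)
      show "sr i (l1 z)" "sr j (l1 z)" using sr[of z] that e by auto
    qed
    have f: "finite ?Z" using fin by simp
    have 1: "(\<Sum>z\<in>?Z. (f (vA z) * f (vC z))^2) \<le> 4 / 3 * (lam i)^2 * mass"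
    proof -
      let ?p = "\<lambda>z. ((l1 z, vA z), vC z)"
      have "inj_on ?p ?Z"
      proof (rule inj_onI)
        fix z z' assume a: "z \<in> ?Z" "z' \<in> ?Z" "?p z = ?p z'"
        have e: "vA z = vA z'" "vC z = vC z'" "l1 z = l1 z'" using a(3) unfolding prod.inject by blast+
        have "vB z = vB z'"
          by (rule foot_unique[of "vA z" _ _ "vC z"])
            (use R_D[OF mem(1)[OF a(1)]] R_D[OF mem(1)[OF a(2)]] e in simp_all)
        then show "z = z'" using e by (intro triple_eqI)
      qed
      moreover have "?p z \<in> Fl i \<times> S" if "z \<in> ?Z" for z
        using mem[OF that] R_D(3)[of z] by (simp add: Fl_def)
      then have "?p ` ?Z \<subseteq> Fl i \<times> S" by blast
      ultimately show ?thesis using Fl_sum[OF f, of ?p i] by simp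
    qed
    have 2: "(\<Sum>z\<in>?Z. (f (vB z) * f (vD z))^2) \<le> 4 / 3 * (lam j)^2 * mass"
    proof -
      let ?p = "\<lambda>z. ((l1 z, vB z), vD z)"
      have "inj_on ?p ?Z"
      proof (rule inj_onI)
        fix z z' assume a: "z \<in> ?Z" "z' \<in> ?Z" "?p z = ?p z'"
        note r = R_D[OF mem(1)[OF a(1)]] and r' = R_D[OF mem(1)[OF a(2)]]
        have e: "vB z = vB z'" "vD z = vD z'" "l1 z = l1 z'" using a(3) unfolding prod.inject by blast+
        have "vA z = vA z'"
        proof (rule foot_unique[of "vB z" _ _ "vD z"])
          show "ln_through (vB z) (vA z) = ln_through (vB z) (vA z')"
            using e ln_through_commute[of "vB z" "vA z"] ln_through_commute[of "vB z" "vA z'"] by simp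
        qed (use r r' e in simp_all)
        moreover from this have "vC z = vC z'" using e by (simp add: vD_def)
        ultimately show "z = z'" using e by (intro triple_eqI)
      qed
      moreover have "?p z \<in> Fl j \<times> S" if "z \<in> ?Z" for z
        using mem[OF that] R_D(4)[of z] by (simp add: Fl_def)
      then have "?p ` ?Z \<subseteq> Fl j \<times> S" by blast
      ultimately show ?thesis using Fl_sum[OF f, of ?p j] by simp
    qed
    have "(\<Sum>z\<in>?Z. W z)^2 = (\<Sum>z\<in>?Z. (f (vA z) * f (vC z)) * (f (vB z) * f (vD z)))^2"
      by (simp add: W_def mult_ac)
    also have "\<dots> \<le> (\<Sum>z\<in>?Z. (f (vA z) * f (vC z))^2) * (\<Sum>z\<in>?Z. (f (vB z) * f (vD z))^2)"
      by (rule Cauchy_Schwarz_ineq_sum)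
    also have "\<dots> \<le> (4 / 3 * (lam i)^2 * mass) * (4 / 3 * (lam j)^2 * mass)"
      using 1 2 by (intro mult_mono) (auto intro: sum_nonneg)
    also have "\<dots> = (4 / 3 * (lam i * lam j) * mass)^2" by (simp add: power2_eq_square)
    finally have "(\<Sum>z\<in>?Z. W z) \<le> 4 / 3 * (lam i * lam j) * mass"
      by (rule power2_le_imp_le) (simp add: lam_nonneg)
    then show "(\<Sum>z\<in>?Z. W z) \<le> 4 / 3 * (lam (fst y) * lam (snd y)) * mass" using y by simp
  qed
  also have "\<dots> = 4 / 3 * mass * (\<Sum>i<m. lam i)^2"
  proof -
    have "(\<Sum>i<m. lam i)^2 = (\<Sum>y\<in>{..<m} \<times> {..<m}. lam (fst y) * lam (snd y))"
      by (simp only: power2_eq_square sum_product sum.cartesian_product split_def)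
    then show ?thesis unfolding sum_distrib_left by (simp add: sum_distrib_left mult_ac)
  qed
  also have "\<dots> \<le> 4 / 3 * mass * (m * mass)" using sum_lam_sq by (intro mult_left_mono) auto
  finally show ?thesis by (simp add: power2_eq_square mult_ac)
qed

text \<open>Level i supplies at most 8/3 * w j * 2^i pairs of weight (lam i)^2 / 2^i. The powers of
  2 cancel, so the sum over i costs nothing beyond \<open>mass\<close>.\<close>

lemma sr_pairs_mass:
  assumes Y: "\<And>y. y \<in> Y \<Longrightarrow> fst y \<in> S \<and> snd y \<in> lev j \<and> fst y \<noteq> snd y \<and>
      sr (idx (fst y)) (lnz y) \<and> \<not> sr j (lnz y)"
  shows "(\<Sum>y\<in>Y. (f (fst y))^2) \<le> 8 / 3 * w j * mass"
proof -
  have fin: "finite Y"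
  proof (rule finite_subset)
    show "Y \<subseteq> S \<times> lev j" using Y by (auto simp: mem_Times_iff)
  qed (use finS in auto)
  have "(\<Sum>y\<in>Y. (f (fst y))^2) = (\<Sum>i<m. \<Sum>y | y \<in> Y \<and> idx (fst y) = i. (f (fst y))^2)"
    using Y idx_less by (intro sum.group[symmetric] fin) auto
  also have "\<dots> \<le> (\<Sum>i<m. 8 / 3 * w j * (lam i)^2)"
  proof (rule sum_mono)
    fix i
    let ?Y = "{y \<in> Y. idx (fst y) = i}"
    have "card ?Y \<le> card {z \<in> prs i j. sr i (lnz z) \<and> \<not> sr j (lnz z)}"
    proof (rule card_mono)
      show "?Y \<subseteq> {z \<in> prs i j. sr i (lnz z) \<and> \<not> sr j (lnz z)}"
      proof
        fix y assume "y \<in> ?Y"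
        then show "y \<in> {z \<in> prs i j. sr i (lnz z) \<and> \<not> sr j (lnz z)}"
          using Y[of y] by (simp add: prs_def lev_def mem_Times_iff)
      qed
    qed simp
    then have c: "real (card ?Y) \<le> 8 / 3 * w j * 2 ^ i" using sr_pairs[of i j] by linarith
    have "(\<Sum>y\<in>?Y. (f (fst y))^2) = (\<Sum>y\<in>?Y. (lam i)^2 / 2 ^ i)"
      by (intro sum.cong) (auto simp: f_def power_divide w_sq)
    also have "\<dots> = real (card ?Y) * ((lam i)^2 / 2 ^ i)" by simp
    also have "\<dots> \<le> (8 / 3 * w j * 2 ^ i) * ((lam i)^2 / 2 ^ i)" using c by (intro mult_right_mono) auto
    finally show "(\<Sum>y\<in>?Y. (f (fst y))^2) \<le> 8 / 3 * w j * (lam i)^2" by simp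
  qed
  finally show ?thesis by (simp add: mass_def sum_distrib_left)
qed

text \<open>The vector a - a' = c' - c is both parallel and orthogonal to e - b, hence zero. The
  point \<open>e\<close> only records the direction of one side.\<close>

lemma rectangle_corner_inj:
  assumes "a \<noteq> b" "a' \<noteq> b" "e \<noteq> b" "c \<noteq> b" "c' \<noteq> b" 
    "right_angle a b e" "right_angle a' b e" "right_angle a b c" "right_angle a' b c'" "a + c - b = a' + c' - b"
  shows "a = a' \<and> c = c'"
proof -
  have l: "ln_through b c = ln_through b e" "ln_through b c' = ln_through b e"
    using right_angle_ln_eq[of a b c e] right_angle_ln_eq[of a' b c' e] assms by auto
  have m: "c \<in> ln_through e b" "c' \<in> ln_through e b"
    using l mem_ln_through ln_through_commute by metis+
  have s: "fst a - fst a' = fst c' - fst c" "snd a - snd a' = snd c' - snd c"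
    using assms(10) by (auto simp: prod_eq_iff)
  have par: "(fst e - fst b) * (snd a - snd a') = (snd e - snd b) * (fst a - fst a')"
    using m unfolding s by (simp add: ln_through_def algebra_simps)
  have "(fst e - fst b) * (fst a - fst a') + (snd e - snd b) * (snd a - snd a') = 0"
    using assms(6,7) by (simp add: right_angle_def algebra_simps)
  then have "fst a - fst a' = 0 \<and> snd a - snd a' = 0"
    using parallel_perp_zero[OF par] assms(3) by (auto simp: prod_eq_iff)
  then show ?thesis using s by (simp add: prod_eq_iff)
qed

text \<open>
  Cauchy-Schwarz over the pairs \<open>(a, b)\<close>: a point \<open>a\<close> sees few superrich lines, and for fixed
  \<open>b\<close> and fixed direction the vertex \<open>d\<close> determines the rectangle.
\<close>

lemma case_two_arms_rich:
  assumes Z: "Z \<subseteq> R"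
    and s1: "\<And>z. z \<in> Z \<Longrightarrow> sr (idx (vA z)) (l1 z) \<and> \<not> sr (idx (vB z)) (l1 z)"
    and s2: "\<And>z. z \<in> Z \<Longrightarrow> sr (idx (vC z)) (l2 z) \<and> \<not> sr (idx (vB z)) (l2 z)"
    and m: "1 \<le> m"
  shows "sum W Z \<le> 8 / 3 * m * mass^2"
proof -
  have fin: "finite Z" using finite_subR Z .
  have level: "(\<Sum>z | z \<in> Z \<and> idx (vB z) = j. W z) \<le> lam j * (8 / 3 * mass * sqrt mass)" for j
  proof -
    let ?Z = "{z \<in> Z. idx (vB z) = j}"
    have fZ: "finite ?Z" using fin by simp
    have mem: "z \<in> R" "vB z \<in> lev j" if "z \<in> ?Z" for z
    proof -
      show r: "z \<in> R" using that Z by auto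
      show "vB z \<in> lev j" using lev_R[OF r] that by auto
    qed
    define B1 where "B1 = 8 / 3 * w j * mass"
    have B1: "0 \<le> B1" by (simp add: B1_def)
    let ?ab = "\<lambda>z. (vA z, vB z)" and ?cb = "\<lambda>z. (vC z, vB z)"
    let ?F = "\<lambda>y. {z \<in> ?Z. ?ab z = y}"
    let ?V = "\<lambda>y. \<Sum>z\<in>?F y. (f (vC z))^2" and ?D = "\<lambda>y. \<Sum>z\<in>?F y. (f (vD z))^2" and ?h = "\<lambda>y. \<Sum>z\<in>?F y. f (vC z) * f (vD z)"
    have fF: "finite (?F y)" for y using fZ by (rule rev_finite_subset) blast
    have P1: "(\<Sum>y\<in>?ab ` ?Z. (f (fst y))^2) \<le> B1" unfolding B1_def
    proof (rule sr_pairs_mass)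
      fix y assume "y \<in> ?ab ` ?Z"
      then obtain z where z: "z \<in> ?Z" "y = ?ab z" by blast
      then show "fst y \<in> S \<and> snd y \<in> lev j \<and> fst y \<noteq> snd y \<and> sr (idx (fst y)) (lnz y) \<and> \<not> sr j (lnz y)"
        using R_D[OF mem(1)[OF z(1)]] mem(2)[OF z(1)] s1[of z] by simp
    qed
    have P2: "(\<Sum>y\<in>?cb ` ?Z. (f (fst y))^2) \<le> B1" unfolding B1_def
    proof (rule sr_pairs_mass)
      fix y assume "y \<in> ?cb ` ?Z"
      then obtain z where z: "z \<in> ?Z" "y = ?cb z" by blast
      then show "fst y \<in> S \<and> snd y \<in> lev j \<and> fst y \<noteq> snd y \<and> sr (idx (fst y)) (lnz y) \<and> \<not> sr j (lnz y)"
        using R_D[OF mem(1)[OF z(1)]] mem(2)[OF z(1)] s2[of z] ln_through_commute[of "vC z" "vB z"] by simp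
    qed
    \<comment> \<open>Fix \<open>c\<close> and \<open>b\<close>. The outer triple chooses
      \<open>a\<close>, the inner one another third vertex for the same \<open>a\<close> and
      \<open>b\<close>. All these rectangles have their corner at \<open>b\<close> and the same
      directions of sides, so by \<open>rectangle_corner_inj\<close> their fourth vertices are
      different points of \<open>S\<close>.\<close>
    have inner: "(\<Sum>z | z \<in> ?Z \<and> ?cb z = y. ?D (?ab z)) \<le> mass" if y: "y \<in> ?cb ` ?Z" for y
    proof -
      let ?P = "SIGMA z:{z \<in> ?Z. ?cb z = y}. ?F (?ab z)"
      have "(\<Sum>z | z \<in> ?Z \<and> ?cb z = y. ?D (?ab z)) = (\<Sum>x\<in>?P. (f (vD (snd x)))^2)"
      proof (subst sum.Sigma)
        show "finite {z \<in> ?Z. ?cb z = y}" using fZ by (rule rev_finite_subset) blast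
        show "\<forall>z\<in>{z \<in> ?Z. ?cb z = y}. finite (?F (?ab z))" using fF by blast
      qed (simp only: split_def)
      also have "\<dots> = (\<Sum>p\<in>(\<lambda>x. vD (snd x)) ` ?P. (f p)^2)"
      proof (rule sum.reindex_cong[symmetric, where l = "\<lambda>x. vD (snd x)"])
        show "inj_on (\<lambda>x. vD (snd x)) ?P"
        proof (rule inj_onI)
          fix x x' assume x: "x \<in> ?P" "x' \<in> ?P" "vD (snd x) = vD (snd x')"
          have r: "fst x \<in> R" "snd x \<in> R" "fst x' \<in> R" "snd x' \<in> R" using x Z by auto
          have e: "vB (fst x) = snd y" "vB (snd x) = snd y" "vB (fst x') = snd y" "vB (snd x') = snd y"
            "vC (fst x) = fst y" "vC (fst x') = fst y" "vA (snd x) = vA (fst x)" "vA (snd x') = vA (fst x')"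
            using x by auto
          have "vA (fst x) = vA (fst x') \<and> vC (snd x) = vC (snd x')"
          proof (rule rectangle_corner_inj[where b = "snd y" and e = "fst y"])
            show "vA (fst x) + vC (snd x) - snd y = vA (fst x') + vC (snd x') - snd y"
              using x(3) e by (simp add: vD_def)
          qed (use R_D[OF r(1)] R_D[OF r(2)] R_D[OF r(3)] R_D[OF r(4)] e in auto)
          then have "fst x = fst x'" "snd x = snd x'" using e by (auto intro!: triple_eqI)
          then show "x = x'" by (rule prod_eqI)
        qed
      qed auto
      also have "\<dots> \<le> (\<Sum>p\<in>S. (f p)^2)"
      proof (intro sum_mono2 finS)
        show "(\<lambda>x. vD (snd x)) ` ?P \<subseteq> S"
        proof
          fix p assume "p \<in> (\<lambda>x. vD (snd x)) ` ?P"
          then obtain x where x: "x \<in> ?P" "p = vD (snd x)" by blast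
          then have "snd x \<in> R" using Z by auto
          then show "p \<in> S" using R_D(4) x(2) by simp
        qed
      qed auto
      also have "\<dots> \<le> mass" by (rule sum_f_sq)
      finally show ?thesis .
    qed
    \<comment> \<open>The product is expanded over the vertices \<open>c\<close> of each fibre and
      the triples are regrouped by \<open>(c, b)\<close>, so that \<open>inner\<close>
      applies.\<close>
    have "(\<Sum>y\<in>?ab ` ?Z. ?V y * ?D y) = (\<Sum>y\<in>?ab ` ?Z. \<Sum>z\<in>?F y. (f (vC z))^2 * ?D (?ab z))"
      by (intro sum.cong) (auto simp: sum_distrib_right)
    also have "\<dots> = (\<Sum>z\<in>?Z. (f (vC z))^2 * ?D (?ab z))"
      using fZ by (intro sum.group) auto
    also have "\<dots> = (\<Sum>y\<in>?cb ` ?Z. \<Sum>z | z \<in> ?Z \<and> ?cb z = y. (f (vC z))^2 * ?D (?ab z))"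
      using fZ by (intro sum.group[symmetric]) auto
    also have "\<dots> = (\<Sum>y\<in>?cb ` ?Z. (f (fst y))^2 * (\<Sum>z | z \<in> ?Z \<and> ?cb z = y. ?D (?ab z)))"
      by (intro sum.cong) (auto simp: sum_distrib_left)
    also have "\<dots> \<le> (\<Sum>y\<in>?cb ` ?Z. (f (fst y))^2 * mass)"
      by (intro sum_mono mult_left_mono inner) auto
    also have "\<dots> = (\<Sum>y\<in>?cb ` ?Z. (f (fst y))^2) * mass" by (simp add: sum_distrib_right)
    also have "\<dots> \<le> B1 * mass" using P2 by (intro mult_right_mono) auto
    finally have VD: "(\<Sum>y\<in>?ab ` ?Z. ?V y * ?D y) \<le> B1 * mass" .
    have "(\<Sum>z\<in>?Z. f (vA z) * (f (vC z) * f (vD z))) = (\<Sum>y\<in>?ab ` ?Z. \<Sum>z\<in>?F y. f (vA z) * (f (vC z) * f (vD z)))"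
      using fZ by (intro sum.group[symmetric]) auto
    also have "\<dots> = (\<Sum>y\<in>?ab ` ?Z. f (fst y) * ?h y)"
      by (intro sum.cong) (auto simp: sum_distrib_left)
    finally have "(\<Sum>z\<in>?Z. f (vA z) * (f (vC z) * f (vD z)))^2 \<le> (\<Sum>y\<in>?ab ` ?Z. (f (fst y))^2) * (\<Sum>y\<in>?ab ` ?Z. (?h y)^2)"
      by (simp only: Cauchy_Schwarz_ineq_sum)
    also have "\<dots> \<le> B1 * (B1 * mass)"
    proof (intro mult_mono P1)
      have "(\<Sum>y\<in>?ab ` ?Z. (?h y)^2) \<le> (\<Sum>y\<in>?ab ` ?Z. ?V y * ?D y)"
        by (intro sum_mono Cauchy_Schwarz_ineq_sum)
      then show "(\<Sum>y\<in>?ab ` ?Z. (?h y)^2) \<le> B1 * mass" using VD by linarith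
    qed (use B1 in \<open>auto intro!: sum_nonneg\<close>)
    also have "\<dots> = (B1 * sqrt mass)^2" by (simp add: power2_eq_square)
    finally have s: "(\<Sum>z\<in>?Z. f (vA z) * (f (vC z) * f (vD z))) \<le> B1 * sqrt mass"
      by (rule power2_le_imp_le) (use B1 in auto)
    have "(\<Sum>z\<in>?Z. W z) = lam j / w j * (\<Sum>z\<in>?Z. f (vA z) * (f (vC z) * f (vD z)))"
      unfolding sum_distrib_left by (intro sum.cong) (auto simp: W_def f_def[of "fst (snd _)"])
    also have "\<dots> \<le> lam j / w j * (B1 * sqrt mass)" using s lam_nonneg by (intro mult_left_mono) auto
    finally show ?thesis by (simp add: B1_def mult_ac)
  qed
  have "sum W Z = (\<Sum>j<m. \<Sum>z | z \<in> Z \<and> idx (vB z) = j. W z)"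
    using Z idx_R by (intro sum.group[symmetric] fin) auto
  also have "\<dots> \<le> (\<Sum>j<m. lam j * (8 / 3 * mass * sqrt mass))" by (intro sum_mono level)
  also have "\<dots> = (\<Sum>j<m. lam j) * (8 / 3 * mass * sqrt mass)" by (rule sum_distrib_right[symmetric])
  \<comment> \<open>Only one free sum over levels is left here, so even \<open>m\<close> in place of
    \<open>sqrt m\<close> is affordable.\<close>
  also have "\<dots> \<le> (m * sqrt mass) * (8 / 3 * mass * sqrt mass)"
  proof (intro mult_right_mono)
    have "(\<Sum>j<m. lam j)^2 \<le> m * mass" by (rule sum_lam_sq)
    also have "\<dots> \<le> (m * m) * mass" using m by (intro mult_right_mono) auto
    also have "\<dots> = (m * sqrt mass)^2" by (simp add: power2_eq_square)
    finally show "(\<Sum>j<m. lam j) \<le> m * sqrt mass" by (rule power2_le_imp_le) auto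
  qed auto
  also have "\<dots> = 8 / 3 * m * mass * (sqrt mass * sqrt mass)" by (simp only: mult_ac)
  also have "\<dots> = 8 / 3 * m * mass^2" by (simp add: power2_eq_square)
  finally show ?thesis .
qed

end

context level_sets
begin

section \<open>Relabelling the vertices and counting level by level\<close>

definition swap :: "triple \<Rightarrow> triple" where "swap z = (vC z, vB z, vA z)"
definition rot :: "triple \<Rightarrow> triple" where "rot z = (vB z, vC z, vD z)"

lemma swap_simps [simp]: "vA (swap z) = vC z" "vB (swap z) = vB z" "vC (swap z) = vA z" "vD (swap z) = vD z"
    "swap (swap z) = z"
  by (simp_all add: swap_def vD_def)

lemma W_swap [simp]: "W (swap z) = W z" by (simp add: W_def)

lemma l_swap: "l1 (swap z) = l2 z" "l2 (swap z) = l1 z"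
  by (simp_all add: ln_through_commute)

lemma swap_R: "z \<in> R \<Longrightarrow> swap z \<in> R"
  by (auto simp: R_def mem_Times_iff right_angle_def mult.commute)

lemma inj_swap: "inj_on swap Z" by (rule inj_on_inverseI[of _ swap]) simp

lemma sum_swap: "sum h (swap ` Z) = (\<Sum>z\<in>Z. h (swap z))"
  by (simp add: sum.reindex inj_swap)

lemma rot_simps [simp]: "vA (rot z) = vB z" "vB (rot z) = vC z" "vC (rot z) = vD z" "vD (rot z) = vA z"
  by (simp_all add: rot_def vD_def)

lemma W_rot [simp]: "W (rot z) = W z" by (simp add: W_def)

lemma rot_R: "z \<in> R \<Longrightarrow> rot z \<in> R"
  by (auto simp: R_def mem_Times_iff right_angle_def vD_def algebra_simps prod_eq_iff)

lemma inj_rot: "inj_on rot Z"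
proof (rule inj_onI)
  fix z z' assume e: "rot z = rot z'"
  have "vA (rot z) = vA (rot z')" "vB (rot z) = vB (rot z')" "vD (rot z) = vD (rot z')" using e by simp_all
  then show "z = z'" by (intro triple_eqI) simp_all
qed

definition Rmax :: "triple set" where
  "Rmax = {z \<in> R. idx (vA z) \<le> idx (vD z) \<and> idx (vB z) \<le> idx (vD z) \<and> idx (vC z) \<le> idx (vD z)}"

lemma Rmax_R: "Rmax \<subseteq> R" by (auto simp: Rmax_def)

text \<open>One of the four cyclic relabellings moves a vertex of highest level to \<open>d\<close>,
  and relabelling preserves \<open>W\<close>.\<close>

lemma sum_R_le_Rmax: "sum W R \<le> 4 * sum W Rmax"
proof -
  let ?P = "\<lambda>n. {z \<in> R. (rot ^^ n) z \<in> Rmax}"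
  have bound: "sum W (?P n) \<le> sum W Rmax" for n
  proof -
    have inj: "inj_on (rot ^^ n) (?P n)" using inj_fn[OF inj_rot] inj_on_subset by blast
    have W: "W ((rot ^^ n) z) = W z" for z by (induction n) simp_all
    have "sum W (?P n) = sum W ((rot ^^ n) ` ?P n)"
      using inj by (simp add: sum.reindex W)
    also have "\<dots> \<le> sum W Rmax"
      using finite_subR[OF Rmax_R] by (intro sum_mono2) auto
    finally show ?thesis .
  qed
  have cover: "R \<subseteq> ?P 0 \<union> (?P 1 \<union> (?P 2 \<union> ?P 3))"
  proof
    fix z assume z: "z \<in> R"
    have r: "rot z \<in> R" "rot (rot z) \<in> R" "rot (rot (rot z)) \<in> R" using z rot_R by simp_all
    let ?M = "max (max (idx (vA z)) (idx (vB z))) (max (idx (vC z)) (idx (vD z)))"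
    have "?M = idx (vA z) \<or> ?M = idx (vB z) \<or> ?M = idx (vC z) \<or> ?M = idx (vD z)" by linarith
    then have "z \<in> Rmax \<or> rot z \<in> Rmax \<or> rot (rot z) \<in> Rmax \<or> rot (rot (rot z)) \<in> Rmax"
      unfolding Rmax_def using z r by auto
    then show "z \<in> ?P 0 \<union> (?P 1 \<union> (?P 2 \<union> ?P 3))" using z by (auto simp: eval_nat_numeral)
  qed
  have fin: "finite (?P n)" for n by (rule finite_subR) auto
  have "sum W R \<le> sum W (?P 0) + sum W (?P 1 \<union> (?P 2 \<union> ?P 3))"
    by (rule sum_cover_le[OF _ _ cover]) (use fin in auto)
  also have "sum W (?P 1 \<union> (?P 2 \<union> ?P 3)) \<le> sum W (?P 1) + sum W (?P 2 \<union> ?P 3)"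
    by (rule sum_cover_le) (use fin in auto)
  also have "sum W (?P 2 \<union> ?P 3) \<le> sum W (?P 2) + sum W (?P 3)"
    by (rule sum_cover_le) (use fin in auto)
  finally show ?thesis using bound[of 0] bound[of 1] bound[of 2] bound[of 3] by linarith
qed

text \<open>For fixed \<open>a\<close> and \<open>b\<close> the vertex \<open>c\<close> lies on the
  perpendicular at \<open>b\<close>, and it determines the triple.\<close>

lemma fiber_card:
  assumes Z: "Z \<subseteq> R" and k: "\<And>z. z \<in> Z \<Longrightarrow> idx (vC z) = k" and z0: "z0 \<in> Z"
    and ab: "\<And>z. z \<in> Z \<Longrightarrow> vA z = a \<and> vB z = b"
  shows "real (card Z) \<le> rc k (l2 z0)" and "\<And>z. z \<in> Z \<Longrightarrow> l2 z = l2 z0"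
proof -
  show l: "l2 z = l2 z0" if "z \<in> Z" for z
  proof -
    have r: "z \<in> R" "z0 \<in> R" using that z0 Z by auto
    have e: "vA z = a" "vB z = b" "vA z0 = a" "vB z0 = b" using ab[OF that] ab[OF z0] by simp_all
    show ?thesis unfolding e
      by (rule right_angle_ln_eq[of a]) (use R_D[OF r(1)] R_D[OF r(2)] e in simp_all)
  qed
  have "card Z \<le> card (lev k \<inter> l2 z0)"
  proof (rule card_inj_on_le[of vC])
    show "inj_on vC Z"
    proof (rule inj_onI)
      fix z z' assume "z \<in> Z" "z' \<in> Z" "vC z = vC z'"
      then show "z = z'" using ab[of z] ab[of z'] by (intro triple_eqI) simp_all
    qed
    show "vC ` Z \<subseteq> lev k \<inter> l2 z0"
    proof
      fix p assume "p \<in> vC ` Z"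
      then obtain z where z: "z \<in> Z" "p = vC z" by blast
      then have "vC z \<in> lev k" using lev_R[of z] k[of z] Z by auto
      moreover have "vC z \<in> l2 z0" using l[OF z(1)] mem_ln_through(2)[of "vC z" "vB z"] by simp
      ultimately show "p \<in> lev k \<inter> l2 z0" using z by simp
    qed
  qed simp
  then show "real (card Z) \<le> rc k (l2 z0)" by (simp add: rc_def)
qed

definition lvl :: "triple set \<Rightarrow> nat \<Rightarrow> nat \<Rightarrow> nat \<Rightarrow> triple set" where
  "lvl Z i j k = {z \<in> Z. idx (vA z) = i \<and> idx (vB z) = j \<and> idx (vC z) = k}"

text \<open>\<open>W\<close> is constant once the four levels are fixed. The count ignores the level
  \<open>l\<close> of the fourth vertex, which enters only through the weight; \<open>\<Phi>\<close>
  retains what relates it to the other levels.\<close>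

lemma level_sum:
  assumes Z: "Z \<subseteq> R" and \<Phi>: "\<And>z. z \<in> Z \<Longrightarrow> \<Phi> (idx (vA z)) (idx (vB z)) (idx (vC z)) (idx (vD z))"
    and N: "\<And>i j k. i < m \<Longrightarrow> j < m \<Longrightarrow> k < m \<Longrightarrow> real (card (lvl Z i j k)) \<le> N i j k"
  shows "sum W Z \<le> (\<Sum>j<m. \<Sum>l<m. \<Sum>i<m. \<Sum>k<m. if \<Phi> i j k l then
      N i j k * (lam i / w i * (lam j / w j) * (lam k / w k) * (lam l / w l)) else 0)"
proof -
  have fin: "finite Z" using finite_subR Z .
  let ?I = "{..<m} \<times> {..<m} \<times> {..<m} \<times> {..<m}"
  let ?t = "\<lambda>z. (idx (vB z), idx (vD z), idx (vA z), idx (vC z))"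
  let ?X = "\<lambda>(j, l, i, k). if \<Phi> i j k l then N i j k * (lam i / w i * (lam j / w j) * (lam k / w k) * (lam l / w l)) else 0"
  have "sum W Z = (\<Sum>y\<in>?I. \<Sum>z | z \<in> Z \<and> ?t z = y. W z)"
  proof (rule sum.group[symmetric])
    show "?t ` Z \<subseteq> ?I" using Z idx_R by auto
  qed (use fin in auto)
  also have "\<dots> \<le> (\<Sum>y\<in>?I. ?X y)"
  proof (rule sum_mono)
    fix y assume y: "y \<in> ?I"
    obtain j l i k where e: "y = (j, l, i, k)" by (metis surj_pair)
    let ?Z = "{z \<in> Z. ?t z = y}"
    show "(\<Sum>z\<in>?Z. W z) \<le> ?X y"
    proof (cases "\<Phi> i j k l")
      case True
      let ?c = "lam i / w i * (lam j / w j) * (lam k / w k) * (lam l / w l)"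
      have c0: "0 \<le> ?c" using lam_nonneg by simp
      have "card ?Z \<le> card (lvl Z i j k)"
        using fin e by (intro card_mono) (auto simp: lvl_def)
      then have c: "real (card ?Z) \<le> N i j k" using N[of i j k] y e by auto
      have "(\<Sum>z\<in>?Z. W z) = (\<Sum>z\<in>?Z. ?c)"
        by (intro sum.cong) (auto simp: e W_def f_def)
      also have "\<dots> = card ?Z * ?c" by simp
      also have "\<dots> \<le> N i j k * ?c" using c c0 by (rule mult_right_mono)
      finally show ?thesis using True e by simp
    next
      case False
      have "?Z = {}"
      proof (rule ccontr)
        assume "?Z \<noteq> {}"
        then obtain z where "z \<in> ?Z" by blast
        then show False using \<Phi>[of z] False e by simp
      qed
      then have "(\<Sum>z\<in>?Z. W z) = 0" by (simp only: sum.empty)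
      then show ?thesis using False e by (simp only: prod.case if_False)
    qed
  qed
  also have "\<dots> = (\<Sum>j<m. \<Sum>l<m. \<Sum>i<m. \<Sum>k<m. ?X (j, l, i, k))"
    by (simp add: sum.cartesian_product)
  finally show ?thesis by simp
qed

text \<open>The pair \<open>(a, b)\<close> is counted by \<open>sr_pairs\<close>, and then
  \<open>c\<close> has at most \<open>2 * w k\<close> choices. What remains is the weight w i / w l
  between the levels of \<open>a\<close> and \<open>d\<close>, summed by Schur's test, and two free
  sums over the levels of \<open>b\<close> and \<open>c\<close>, which cost one factor
  \<open>m\<close>.\<close>

lemma case_one_arm_rich:
  assumes Z: "Z \<subseteq> Rmax"
    and s1: "\<And>z. z \<in> Z \<Longrightarrow> sr (idx (vA z)) (l1 z) \<and> \<not> sr (idx (vB z)) (l1 z)"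
    and s2: "\<And>z. z \<in> Z \<Longrightarrow> \<not> sr (idx (vC z)) (l2 z)"
  shows "sum W Z \<le> 22 * m * mass^2"
proof -
  have ZR: "Z \<subseteq> R" using Z Rmax_R by blast
  have fin: "finite Z" using finite_subR ZR .
  have count: "real (card (lvl Z i j k)) \<le> 16 / 3 * 2 ^ i * w j * w k" for i j k
  proof -
    let ?Y = "{y \<in> prs i j. sr i (lnz y) \<and> \<not> sr j (lnz y)}"
    let ?ab = "\<lambda>z. (vA z, vB z)"
    have flvl: "finite (lvl Z i j k)" using fin by (rule rev_finite_subset) (auto simp: lvl_def)
    have im: "?ab ` lvl Z i j k \<subseteq> ?Y"
    proof
      fix y assume "y \<in> ?ab ` lvl Z i j k"
      then obtain z where z: "z \<in> Z" "idx (vA z) = i" "idx (vB z) = j" "y = ?ab z" by (auto simp: lvl_def)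
      have r: "z \<in> R" using z ZR by auto
      show "y \<in> ?Y" using z s1[OF z(1)] R_D[OF r] lev_R[OF r] by (simp add: prs_def)
    qed
    have "real (card (lvl Z i j k)) = (\<Sum>z\<in>lvl Z i j k. 1)" by simp
    also have "\<dots> = (\<Sum>y\<in>?Y. \<Sum>z | z \<in> lvl Z i j k \<and> ?ab z = y. 1)"
      by (rule sum.group[OF flvl _ im, symmetric]) simp
    also have "\<dots> \<le> (\<Sum>y\<in>?Y. 2 * w k)"
    proof (rule sum_mono)
      fix y
      let ?F = "{z \<in> lvl Z i j k. ?ab z = y}"
      show "(\<Sum>z\<in>?F. 1) \<le> 2 * w k"
      proof (cases "?F = {}")
        case False
        then obtain z0 where z0: "z0 \<in> ?F" by blast
        have "real (card ?F) \<le> rc k (l2 z0)"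
          by (rule fiber_card(1)[of ?F k z0 "fst y" "snd y"]) (use ZR z0 in \<open>auto simp: lvl_def\<close>)
        also have "\<dots> \<le> 2 * w k" using s2[of z0] z0 by (auto simp: lvl_def sr_def)
        finally show ?thesis by simp
      next
        case True
        then show ?thesis by (simp only: sum.empty) simp
      qed
    qed
    also have "\<dots> = real (card ?Y) * (2 * w k)" by simp
    also have "\<dots> \<le> (8 / 3 * w j * 2 ^ i) * (2 * w k)" using sr_pairs by (intro mult_right_mono) auto
    finally show ?thesis by (simp add: mult_ac)
  qed
  \<comment> \<open>The quotient of \<open>w\<close> at neighbouring levels; the bound 3/4 makes
    1/(1-q) at most 4.\<close>
  define q where "q = 1 / sqrt 2"
  have q: "0 \<le> q" "q \<le> 3 / 4"
  proof -
    show "0 \<le> q" by (simp add: q_def)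
    have "4 / 3 \<le> sqrt 2" by (rule real_le_rsqrt) (simp add: power2_eq_square)
    then show "q \<le> 3 / 4" by (simp add: q_def field_simps)
  qed
  have ww: "w i / w l = q ^ (l - i)" if "i \<le> l" for i l
  proof -
    have "w l = w i * sqrt 2 ^ (l - i)" using that by (simp add: w_def power_add[symmetric])
    then show ?thesis by (simp add: q_def power_one_over)
  qed
  have "sum W Z \<le> (\<Sum>j<m. \<Sum>l<m. \<Sum>i<m. \<Sum>k<m. if i \<le> l then
      16 / 3 * 2 ^ i * w j * w k * (lam i / w i * (lam j / w j) * (lam k / w k) * (lam l / w l)) else 0)"
  proof (rule level_sum[OF ZR])
    show "idx (vA z) \<le> idx (vD z)" if "z \<in> Z" for z using that Z by (auto simp: Rmax_def)
  qed (rule count)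
  also have "\<dots> = (\<Sum>j<m. \<Sum>l<m. \<Sum>i<m. \<Sum>k<m. 16 / 3 * lam j * lam k * (if i \<le> l then lam i * lam l * q ^ (l - i) else 0))"
  proof (intro sum.cong refl)
    fix j l i k
    have "16 / 3 * 2 ^ i * w j * w k * (lam i / w i * (lam j / w j) * (lam k / w k) * (lam l / w l))
        = 16 / 3 * lam j * lam k * (lam i * lam l * (w i / w l))"
      unfolding w_sq[symmetric, of i] by (simp add: power2_eq_square)
    then show "(if i \<le> l then 16 / 3 * 2 ^ i * w j * w k * (lam i / w i * (lam j / w j) * (lam k / w k) * (lam l / w l)) else 0)
        = 16 / 3 * lam j * lam k * (if i \<le> l then lam i * lam l * q ^ (l - i) else 0)"
      by (cases "i \<le> l") (simp_all only: if_True if_False ww mult_zero_right)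
  qed
  also have "\<dots> = 16 / 3 * (\<Sum>j<m. lam j) * (\<Sum>k<m. lam k) * (\<Sum>l<m. \<Sum>i<m. if i \<le> l then lam i * lam l * q ^ (l - i) else 0)"
    by (simp only: sum_distrib_left[symmetric] sum_distrib_right[symmetric])
  also have "\<dots> \<le> 16 / 3 * (\<Sum>j<m. lam j) * (\<Sum>k<m. lam k) * (4 * mass)"
  proof (intro mult_left_mono)
    have "(\<Sum>l<m. \<Sum>i<m. if i \<le> l then lam i * lam l * q ^ (l - i) else 0) \<le> mass / (1 - q)"
      unfolding mass_def by (rule schur_sum) (use q lam_nonneg in auto)
    also have "\<dots> \<le> mass / (1 / 4)" using q by (intro divide_left_mono) auto
    finally show "(\<Sum>l<m. \<Sum>i<m. if i \<le> l then lam i * lam l * q ^ (l - i) else 0) \<le> 4 * mass" by simp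
  qed (auto intro!: mult_nonneg_nonneg sum_nonneg lam_nonneg)
  also have "\<dots> = 64 / 3 * mass * (\<Sum>j<m. lam j)^2" by (simp add: power2_eq_square)
  also have "\<dots> \<le> 64 / 3 * mass * (m * mass)" using sum_lam_sq by (intro mult_left_mono) auto
  also have "\<dots> \<le> 22 * m * mass^2" by (simp add: power2_eq_square mult_right_mono)
  finally show ?thesis .
qed

text \<open>For fixed \<open>a\<close> and \<open>b\<close> the point \<open>c\<close> runs through a single line, so the reciprocals add up to at most 1.\<close>

lemma half_count:
  assumes Z: "Z \<subseteq> R" and s: "\<And>z. z \<in> Z \<Longrightarrow> \<not> sr i (l1 z)"
    and ij: "i < m" "j < m"
  shows "(\<Sum>z\<in>lvl Z i j k. rc i (l1 z) / rc k (l2 z)) \<le> 20000 * G i j"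
proof -
  let ?Y = "{y \<in> prs i j. \<not> sr i (lnz y)}"
  let ?ab = "\<lambda>z. (vA z, vB z)"
  have flvl: "finite (lvl Z i j k)" using Z by (intro finite_subR) (auto simp: lvl_def)
  have im: "?ab ` lvl Z i j k \<subseteq> ?Y"
  proof
    fix y assume "y \<in> ?ab ` lvl Z i j k"
    then obtain z where z: "z \<in> Z" "idx (vA z) = i" "idx (vB z) = j" "y = ?ab z" by (auto simp: lvl_def)
    have r: "z \<in> R" using z Z by auto
    show "y \<in> ?Y" using z s[OF z(1)] R_D[OF r] lev_R[OF r] by (simp add: prs_def)
  qed
  have "(\<Sum>z\<in>lvl Z i j k. rc i (l1 z) / rc k (l2 z)) = (\<Sum>y\<in>?Y. \<Sum>z | z \<in> lvl Z i j k \<and> ?ab z = y. rc i (l1 z) / rc k (l2 z))"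
    by (rule sum.group[OF flvl _ im, symmetric]) simp
  also have "\<dots> \<le> (\<Sum>y\<in>?Y. rc i (lnz y))"
  proof (rule sum_mono)
    fix y
    let ?F = "{z \<in> lvl Z i j k. ?ab z = y}"
    show "(\<Sum>z\<in>?F. rc i (l1 z) / rc k (l2 z)) \<le> rc i (lnz y)"
    proof (cases "?F = {}")
      case False
      then obtain z0 where z0: "z0 \<in> ?F" by blast
      have a: "?F \<subseteq> R" "\<And>z. z \<in> ?F \<Longrightarrow> idx (vC z) = k" "\<And>z. z \<in> ?F \<Longrightarrow> vA z = fst y \<and> vB z = snd y"
        using Z by (auto simp: lvl_def)
      have fc1: "real (card ?F) \<le> rc k (l2 z0)"
        by (rule fiber_card(1)[where k = k and a = "fst y" and b = "snd y"], rule a(1), erule a(2), rule z0, erule a(3))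
      have fc2: "l2 z = l2 z0" if "z \<in> ?F" for z
        by (rule fiber_card(2)[where Z = ?F and k = k and a = "fst y" and b = "snd y"],
            rule a(1), erule a(2), rule z0, erule a(3), rule that)
      have "(\<Sum>z\<in>?F. rc i (l1 z) / rc k (l2 z)) = (\<Sum>z\<in>?F. rc i (lnz y) / rc k (l2 z0))"
      proof (rule sum.cong)
        fix z assume z: "z \<in> ?F"
        show "rc i (l1 z) / rc k (l2 z) = rc i (lnz y) / rc k (l2 z0)" using fc2[OF z] a(3)[OF z] by simp
      qed simp
      also have "\<dots> = card ?F * (rc i (lnz y) / rc k (l2 z0))" by simp
      also have "\<dots> \<le> rc k (l2 z0) * (rc i (lnz y) / rc k (l2 z0))" using fc1 by (intro mult_right_mono) auto
      also have "\<dots> \<le> rc i (lnz y)" by simp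
      finally show ?thesis .
    next
      case True
      then show ?thesis by (simp only: sum.empty) simp
    qed
  qed
  also have "\<dots> \<le> 20000 * G i j" using normal_pairs[OF ij] by simp
  finally show ?thesis .
qed

text \<open>Write 1 as \<open>sqrt (rc i (l1 z) / rc k (l2 z))\<close> times its reciprocal and
  apply Cauchy-Schwarz. One of the two sums is bounded by \<open>half_count\<close>, the other by
  \<open>half_count\<close> after \<open>swap\<close>.\<close>

lemma case_normal_count:
  assumes Z: "Z \<subseteq> R" and s1: "\<And>z. z \<in> Z \<Longrightarrow> \<not> sr (idx (vA z)) (l1 z)"
    and s2: "\<And>z. z \<in> Z \<Longrightarrow> \<not> sr (idx (vC z)) (l2 z)" and ijk: "i < m" "j < m" "k < m"
  shows "real (card (lvl Z i j k)) \<le> 20000 * (sqrt (G i j) * sqrt (G k j))"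
proof -
  let ?T = "lvl Z i j k"
  have TR: "?T \<subseteq> R" using Z by (auto simp: lvl_def)
  have pos: "0 < rc i (l1 z)" "0 < rc k (l2 z)" if "z \<in> ?T" for z
  proof -
    have r: "z \<in> R" using that TR by blast
    have "vA z \<in> lev i \<inter> l1 z" "vC z \<in> lev k \<inter> l2 z" using lev_R[OF r] that by (auto simp: lvl_def)
    then have "lev i \<inter> l1 z \<noteq> {}" "lev k \<inter> l2 z \<noteq> {}" by blast+
    then show "0 < rc i (l1 z)" "0 < rc k (l2 z)" by (simp_all add: rc_def card_gt_0_iff)
  qed
  have A: "(\<Sum>z\<in>?T. rc i (l1 z) / rc k (l2 z)) \<le> 20000 * G i j"
  proof -
    have "(\<Sum>z\<in>lvl ?T i j k. rc i (l1 z) / rc k (l2 z)) \<le> 20000 * G i j"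
    proof (rule half_count[OF TR])
      show "\<not> sr i (l1 z)" if "z \<in> ?T" for z using s1[of z] that by (auto simp: lvl_def)
    qed (use ijk in auto)
    moreover have "lvl ?T i j k = ?T" by (auto simp: lvl_def)
    ultimately show ?thesis by simp
  qed
  have B: "(\<Sum>z\<in>?T. rc k (l2 z) / rc i (l1 z)) \<le> 20000 * G k j"
  proof -
    have sR: "swap ` ?T \<subseteq> R" using TR swap_R by blast
    have "(\<Sum>z\<in>lvl (swap ` ?T) k j i. rc k (l1 z) / rc i (l2 z)) \<le> 20000 * G k j"
    proof (rule half_count[OF sR])
      fix z assume "z \<in> swap ` ?T"
      then obtain z' where "z' \<in> ?T" "z = swap z'" by blast
      then show "\<not> sr k (l1 z)" using s2[of z'] ln_through_commute[of "vC z'" "vB z'"] by (auto simp: lvl_def)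
    qed (use ijk in auto)
    moreover have "lvl (swap ` ?T) k j i = swap ` ?T" by (auto simp: lvl_def)
    ultimately have "(\<Sum>z\<in>swap ` ?T. rc k (l1 z) / rc i (l2 z)) \<le> 20000 * G k j" by (simp only:)
    then show ?thesis unfolding sum_swap l_swap .
  qed
  have "real (card ?T) = (\<Sum>z\<in>?T. sqrt (rc i (l1 z) / rc k (l2 z)) * sqrt (rc k (l2 z) / rc i (l1 z)))"
  proof -
    have "(\<Sum>z\<in>?T. sqrt (rc i (l1 z) / rc k (l2 z)) * sqrt (rc k (l2 z) / rc i (l1 z))) = (\<Sum>z\<in>?T. 1)"
    proof (rule sum.cong)
      fix z assume "z \<in> ?T"
      from pos[OF this] show "sqrt (rc i (l1 z) / rc k (l2 z)) * sqrt (rc k (l2 z) / rc i (l1 z)) = 1"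
        by (simp add: real_sqrt_mult[symmetric])
    qed simp
    then show ?thesis by simp
  qed
  then have "(real (card ?T))^2 \<le> (\<Sum>z\<in>?T. (sqrt (rc i (l1 z) / rc k (l2 z)))^2) * (\<Sum>z\<in>?T. (sqrt (rc k (l2 z) / rc i (l1 z)))^2)"
    by (simp only: Cauchy_Schwarz_ineq_sum)
  also have "\<dots> = (\<Sum>z\<in>?T. rc i (l1 z) / rc k (l2 z)) * (\<Sum>z\<in>?T. rc k (l2 z) / rc i (l1 z))"
    by simp
  also have "\<dots> \<le> (20000 * G i j) * (20000 * G k j)"
    using A B G_nonneg by (intro mult_mono) (auto intro!: sum_nonneg)
  also have "\<dots> = (20000 * (sqrt (G i j) * sqrt (G k j)))^2"
    using G_nonneg by (simp add: power_mult_distrib)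
  finally show ?thesis by (rule power2_le_imp_le) (simp add: G_nonneg)
qed

lemma swap_Rmax: "z \<in> Rmax \<Longrightarrow> swap z \<in> Rmax"
  using swap_R by (auto simp: Rmax_def)

lemma w_ratio:
  assumes "j \<le> l"
  shows "w j / w l = 2 powr (- ((real l - real j) / 2))"
proof -
  have "w n = 2 powr (real n / 2)" for n
    unfolding w_def by (simp add: powr_half_sqrt[symmetric] powr_powr powr_realpow[symmetric])
  then show ?thesis by (simp add: powr_diff[symmetric] diff_divide_distrib)
qed

text \<open>The two powers sum to multiples of their values at i = l, while the constant term of
  \<open>G\<close> is repeated l + 1 \<le> m times.\<close>

lemma G_column_sum:
  assumes "l < m"
  shows "(\<Sum>i\<le>l. G i j / 2 ^ i) \<le>
    2 ^ j * (5 * m * 2 powr ((real l - real j) / 3) + 4 * 2 powr ((real l - real j) / 2) + m)"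
proof -
  have g3: "(\<Sum>i\<le>l. 2 powr ((real i - real j) / 3)) \<le> 5 * 2 powr ((real l - real j) / 3)"
    using geometric_powr_sum[of "1/3" "4/5" "real j" l] powr_two_bounds(1) by simp
  have g2: "(\<Sum>i\<le>l. 2 powr ((real i - real j) / 2)) \<le> 4 * 2 powr ((real l - real j) / 2)"
    using geometric_powr_sum[of "1/2" "3/4" "real j" l] powr_two_bounds(2) by simp
  have "(\<Sum>i\<le>l. G i j / 2 ^ i) = (\<Sum>i\<le>l. 2 ^ j * (m * 2 powr ((real i - real j) / 3) + 2 powr ((real i - real j) / 2) + 1))"
    by (intro sum.cong) (auto simp: G_def)
  also have "\<dots> = 2 ^ j * (m * (\<Sum>i\<le>l. 2 powr ((real i - real j) / 3)) + (\<Sum>i\<le>l. 2 powr ((real i - real j) / 2)) + real (Suc l))"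
    by (simp only: sum_distrib_left[symmetric] sum.distrib) simp
  also have "\<dots> \<le> 2 ^ j * (m * (5 * 2 powr ((real l - real j) / 3)) + 4 * 2 powr ((real l - real j) / 2) + m)"
    using g3 g2 assms by (intro mult_left_mono add_mono) auto
  finally show ?thesis by (simp add: mult_ac)
qed

text \<open>For fixed levels j of \<open>b\<close> and l of \<open>d\<close>, the sums over the
  levels of \<open>a\<close> and \<open>c\<close> form a square, to which Cauchy-Schwarz applies.
  The resulting kernel in j and l splits into a decaying part with a factor \<open>m\<close>, for
  \<open>schur_sum\<close>, and a constant part, for \<open>sum_lam_sq\<close>.\<close>

lemma case_normal:
  assumes Z: "Z \<subseteq> Rmax" and s1: "\<And>z. z \<in> Z \<Longrightarrow> \<not> sr (idx (vA z)) (l1 z)"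
    and s2: "\<And>z. z \<in> Z \<Longrightarrow> \<not> sr (idx (vC z)) (l2 z)"
  shows "sum W Z \<le> 1280000 * m * mass^2"
proof -
  have ZR: "Z \<subseteq> R" using Z Rmax_R by blast
  define x where "x j l i = (if i \<le> l then lam i / w i * sqrt (G i j) else 0)" for j l i
  have xx: "(\<Sum>i<m. x j l i)^2 \<le> mass * (\<Sum>i\<le>l. G i j / 2 ^ i)" if l: "l < m" for j l
  proof -
    have "(\<Sum>i<m. x j l i)^2 = (\<Sum>i<m. lam i * (if i \<le> l then sqrt (G i j) / w i else 0))^2"
      by (intro arg_cong[where f = "\<lambda>t. t^2"] sum.cong) (auto simp: x_def)
    also have "\<dots> \<le> (\<Sum>i<m. (lam i)^2) * (\<Sum>i<m. (if i \<le> l then sqrt (G i j) / w i else 0)^2)"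
      by (rule Cauchy_Schwarz_ineq_sum)
    also have "(\<Sum>i<m. (if i \<le> l then sqrt (G i j) / w i else 0)^2) = (\<Sum>i\<le>l. G i j / 2 ^ i)"
      using l by (intro sum.mono_neutral_cong_right) (auto simp: power_divide w_sq G_nonneg)
    finally show ?thesis by (simp add: mass_def)
  qed
  \<comment> \<open>The factor w j / w l = 2^(-(l-j)/2) turns the exponents 1/3, 1/2 and 0 of the
    column sum into -1/6, 0 and -1/2. Thus exactly the two terms that carry \<open>m\<close> decay
    in l - j.\<close>
  have tm: "20000 * (lam j / w j * (lam l / w l)) * (\<Sum>i<m. x j l i)^2 \<le>
      20000 * mass * (lam j * lam l * (6 * m * (9 / 10) ^ (l - j) + 4))" if jl: "j \<le> l" "l < m" for j l
  proof -
    define d where "d = real l - real j"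
    have d: "d = real (l - j)" using jl by (simp add: d_def)
    have r: "w j / w l = 2 powr (- (d / 2))" using w_ratio[OF jl(1)] by (simp add: d_def)
    have p6: "2 powr (- (d / 6)) \<le> (9 / 10) ^ (l - j)"
    proof -
      have "2 powr (- (d / 6)) = (2 powr (- (1 / 6))) ^ (l - j)"
        unfolding d by (simp add: powr_powr powr_realpow[symmetric])
      also have "\<dots> \<le> (9 / 10) ^ (l - j)" using powr_two_bounds(3) by (intro power_mono) auto
      finally show ?thesis .
    qed
    have p2: "2 powr (- (d / 2)) \<le> (9 / 10) ^ (l - j)"
    proof -
      have "2 powr (- (d / 2)) \<le> 2 powr (- (d / 6))" using d by (intro powr_mono) auto
      then show ?thesis using p6 by linarith
    qed
    have e: "2 powr (- (d / 2)) * 2 powr (d / 3) = 2 powr (- (d / 6))" "2 powr (- (d / 2)) * 2 powr (d / 2) = 1"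
      by (simp_all add: powr_add[symmetric])
    have "w j / w l * (5 * m * 2 powr (d / 3) + 4 * 2 powr (d / 2) + m)
        = 5 * m * (2 powr (- (d / 2)) * 2 powr (d / 3)) + 4 * (2 powr (- (d / 2)) * 2 powr (d / 2)) + m * 2 powr (- (d / 2))"
      unfolding r by (simp add: algebra_simps)
    also have "\<dots> = 5 * m * 2 powr (- (d / 6)) + 4 + m * 2 powr (- (d / 2))" unfolding e by simp
    also have "\<dots> \<le> 5 * m * (9 / 10) ^ (l - j) + 4 + m * (9 / 10) ^ (l - j)"
      using p6 p2 by (intro add_mono mult_left_mono) auto
    finally have b: "w j / w l * (5 * m * 2 powr (d / 3) + 4 * 2 powr (d / 2) + m) \<le> 6 * m * (9 / 10) ^ (l - j) + 4"
      by simp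
    have c0: "0 \<le> 20000 * (lam j / w j * (lam l / w l))" using lam_nonneg by simp
    have "20000 * (lam j / w j * (lam l / w l)) * (\<Sum>i<m. x j l i)^2
        \<le> 20000 * (lam j / w j * (lam l / w l)) * (mass * (\<Sum>i\<le>l. G i j / 2 ^ i))"
      using xx[OF jl(2)] c0 by (rule mult_left_mono)
    also have "\<dots> \<le> 20000 * (lam j / w j * (lam l / w l)) * (mass * (2 ^ j * (5 * m * 2 powr (d / 3) + 4 * 2 powr (d / 2) + m)))"
      using G_column_sum[OF jl(2), of j] c0 unfolding d_def by (intro mult_left_mono) auto
    also have "\<dots> = 20000 * mass * (lam j * lam l * (w j / w l * (5 * m * 2 powr (d / 3) + 4 * 2 powr (d / 2) + m)))"
      unfolding w_sq[symmetric, of j] by (simp add: power2_eq_square)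
    also have "\<dots> \<le> 20000 * mass * (lam j * lam l * (6 * m * (9 / 10) ^ (l - j) + 4))"
      using b lam_nonneg by (intro mult_left_mono) auto
    finally show ?thesis .
  qed
  have "sum W Z \<le> (\<Sum>j<m. \<Sum>l<m. \<Sum>i<m. \<Sum>k<m. if i \<le> l \<and> j \<le> l \<and> k \<le> l then
      20000 * (sqrt (G i j) * sqrt (G k j)) * (lam i / w i * (lam j / w j) * (lam k / w k) * (lam l / w l)) else 0)"
  proof (rule level_sum[OF ZR])
    show "idx (vA z) \<le> idx (vD z) \<and> idx (vB z) \<le> idx (vD z) \<and> idx (vC z) \<le> idx (vD z)" if "z \<in> Z" for z
      using that Z by (auto simp: Rmax_def)
    show "real (card (lvl Z i j k)) \<le> 20000 * (sqrt (G i j) * sqrt (G k j))" if "i < m" "j < m" "k < m" for i j k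
      by (rule case_normal_count[OF ZR s1 s2 that])
  qed
  also have "\<dots> = (\<Sum>j<m. \<Sum>l<m. if j \<le> l then 20000 * (lam j / w j * (lam l / w l)) * (\<Sum>i<m. x j l i)^2 else 0)"
  proof (intro sum.cong refl)
    fix j l
    have "(\<Sum>i<m. \<Sum>k<m. if i \<le> l \<and> j \<le> l \<and> k \<le> l then
        20000 * (sqrt (G i j) * sqrt (G k j)) * (lam i / w i * (lam j / w j) * (lam k / w k) * (lam l / w l)) else 0)
      = (\<Sum>i<m. \<Sum>k<m. (if j \<le> l then 20000 * (lam j / w j * (lam l / w l)) else 0) * (x j l i * x j l k))"
      by (intro sum.cong refl) (simp add: x_def mult_ac)
    also have "\<dots> = (if j \<le> l then 20000 * (lam j / w j * (lam l / w l)) else 0) * (\<Sum>i<m. x j l i)^2"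
      by (simp only: sum_distrib_left[symmetric] power2_eq_square sum_product)
    finally show "(\<Sum>i<m. \<Sum>k<m. if i \<le> l \<and> j \<le> l \<and> k \<le> l then
        20000 * (sqrt (G i j) * sqrt (G k j)) * (lam i / w i * (lam j / w j) * (lam k / w k) * (lam l / w l)) else 0)
      = (if j \<le> l then 20000 * (lam j / w j * (lam l / w l)) * (\<Sum>i<m. x j l i)^2 else 0)" by simp
  qed
  also have "\<dots> \<le> (\<Sum>j<m. \<Sum>l<m. 20000 * mass * (6 * m * (if j \<le> l then lam j * lam l * (9 / 10) ^ (l - j) else 0) + 4 * (lam j * lam l)))"
  proof (intro sum_mono)
    fix j l assume "j \<in> {..<m}" "l \<in> {..<m}"
    then have "20000 * (lam j / w j * (lam l / w l)) * (\<Sum>i<m. x j l i)^2 \<le>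
        20000 * mass * (6 * m * (lam j * lam l * (9 / 10) ^ (l - j)) + 4 * (lam j * lam l))" if "j \<le> l"
      using tm[OF that] by (simp add: algebra_simps)
    moreover have "0 \<le> 20000 * mass * (4 * (lam j * lam l))" using lam_nonneg by simp
    ultimately show "(if j \<le> l then 20000 * (lam j / w j * (lam l / w l)) * (\<Sum>i<m. x j l i)^2 else 0) \<le>
        20000 * mass * (6 * m * (if j \<le> l then lam j * lam l * (9 / 10) ^ (l - j) else 0) + 4 * (lam j * lam l))"
      by simp
  qed
  also have "\<dots> = 20000 * mass * (6 * m * (\<Sum>j<m. \<Sum>l<m. if j \<le> l then lam j * lam l * (9 / 10) ^ (l - j) else 0) + 4 * (\<Sum>j<m. \<Sum>l<m. lam j * lam l))"
    by (simp only: sum_distrib_left[symmetric] sum.distrib)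
  also have "\<dots> \<le> 20000 * mass * (6 * m * (10 * mass) + 4 * (m * mass))"
  proof (intro mult_left_mono add_mono)
    have "(\<Sum>j<m. \<Sum>l<m. if j \<le> l then lam j * lam l * (9 / 10) ^ (l - j) else 0)
        = (\<Sum>l<m. \<Sum>j<m. if j \<le> l then lam j * lam l * (9 / 10) ^ (l - j) else 0)" by (rule sum.swap)
    also have "\<dots> \<le> mass / (1 - 9 / 10)"
      unfolding mass_def by (rule schur_sum) (use lam_nonneg in auto)
    finally show "(\<Sum>j<m. \<Sum>l<m. if j \<le> l then lam j * lam l * (9 / 10) ^ (l - j) else 0) \<le> 10 * mass" by simp
    show "(\<Sum>j<m. \<Sum>l<m. lam j * lam l) \<le> m * mass"
      using sum_lam_sq by (simp add: power2_eq_square sum_product)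
  qed auto
  also have "\<dots> = 1280000 * m * mass^2" by (simp add: power2_eq_square algebra_simps)
  finally show ?thesis .
qed

text \<open>\<open>?Z2\<close> and \<open>?Z5\<close> are the mirror images of \<open>?Z1\<close>
  and \<open>?Z4\<close> under \<open>swap\<close>. The six cases may overlap because
  \<open>W\<close> is nonnegative.\<close>

lemma nondegenerate_sum:
  assumes m: "1 \<le> m"
  shows "sum W R \<le> 6000000 * m * mass^2"
proof -
  let ?P = "\<lambda>z. sr (idx (vA z)) (l1 z)" and ?Q = "\<lambda>z. sr (idx (vB z)) (l1 z)"
    and ?P' = "\<lambda>z. sr (idx (vC z)) (l2 z)" and ?Q' = "\<lambda>z. sr (idx (vB z)) (l2 z)"
  let ?Z1 = "{z \<in> Rmax. ?P z \<and> ?Q z}" and ?Z2 = "{z \<in> Rmax. ?P' z \<and> ?Q' z}"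
    and ?Z3 = "{z \<in> Rmax. ?P z \<and> \<not> ?Q z \<and> ?P' z \<and> \<not> ?Q' z}"
    and ?Z4 = "{z \<in> Rmax. ?P z \<and> \<not> ?Q z \<and> \<not> ?P' z}" and ?Z5 = "{z \<in> Rmax. ?P' z \<and> \<not> ?Q' z \<and> \<not> ?P z}"
    and ?Z6 = "{z \<in> Rmax. \<not> ?P z \<and> \<not> ?P' z}"
  have fin: "finite {z \<in> Rmax. X z}" for X by (rule finite_subR) (use Rmax_R in auto)
  have 1: "sum W ?Z1 \<le> 4 / 3 * m * mass^2" by (rule case_rich_rich) (use Rmax_R in auto)
  have 2: "sum W ?Z2 \<le> 4 / 3 * m * mass^2"
  proof -
    have "sum W (swap ` ?Z2) \<le> 4 / 3 * m * mass^2"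
    proof (rule case_rich_rich)
      show "swap ` ?Z2 \<subseteq> R" using swap_R Rmax_R by blast
      fix z assume "z \<in> swap ` ?Z2"
      then obtain z' where z': "z' \<in> ?Z2" "z = swap z'" by blast
      show "?P z \<and> ?Q z" unfolding z'(2) l_swap using z'(1) by simp
    qed
    then show ?thesis unfolding sum_swap by simp
  qed
  have 3: "sum W ?Z3 \<le> 8 / 3 * m * mass^2" by (rule case_two_arms_rich) (use Rmax_R m in auto)
  have 4: "sum W ?Z4 \<le> 22 * m * mass^2" by (rule case_one_arm_rich) auto
  have 5: "sum W ?Z5 \<le> 22 * m * mass^2"
  proof -
    have "sum W (swap ` ?Z5) \<le> 22 * m * mass^2"
    proof (rule case_one_arm_rich)
      show "swap ` ?Z5 \<subseteq> Rmax" using swap_Rmax by blast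
      fix z assume "z \<in> swap ` ?Z5"
      then obtain z' where z': "z' \<in> ?Z5" "z = swap z'" by blast
      show "?P z \<and> \<not> ?Q z" "\<not> ?P' z" unfolding z'(2) l_swap using z'(1) by simp_all
    qed
    then show ?thesis unfolding sum_swap by simp
  qed
  have 6: "sum W ?Z6 \<le> 1280000 * m * mass^2" by (rule case_normal) auto
  have cover: "Rmax \<subseteq> ?Z1 \<union> (?Z2 \<union> (?Z3 \<union> (?Z4 \<union> (?Z5 \<union> ?Z6))))" by blast
  have "sum W Rmax \<le> sum W ?Z1 + sum W (?Z2 \<union> (?Z3 \<union> (?Z4 \<union> (?Z5 \<union> ?Z6))))"
    by (rule sum_cover_le[OF _ _ cover]) (use fin in simp_all)
  moreover have "sum W (?Z2 \<union> (?Z3 \<union> (?Z4 \<union> (?Z5 \<union> ?Z6)))) \<le> sum W ?Z2 + sum W (?Z3 \<union> (?Z4 \<union> (?Z5 \<union> ?Z6)))"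
    by (rule sum_cover_le[OF _ _ subset_refl]) (use fin in simp_all)
  moreover have "sum W (?Z3 \<union> (?Z4 \<union> (?Z5 \<union> ?Z6))) \<le> sum W ?Z3 + sum W (?Z4 \<union> (?Z5 \<union> ?Z6))"
    by (rule sum_cover_le[OF _ _ subset_refl]) (use fin in simp_all)
  moreover have "sum W (?Z4 \<union> (?Z5 \<union> ?Z6)) \<le> sum W ?Z4 + sum W (?Z5 \<union> ?Z6)"
    by (rule sum_cover_le[OF _ _ subset_refl]) (use fin in simp_all)
  moreover have "sum W (?Z5 \<union> ?Z6) \<le> sum W ?Z5 + sum W ?Z6"
    by (rule sum_cover_le[OF _ _ subset_refl]) (use fin in simp_all)
  ultimately have "sum W Rmax \<le> sum W ?Z1 + (sum W ?Z2 + (sum W ?Z3 + (sum W ?Z4 + (sum W ?Z5 + sum W ?Z6))))" by linarith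
  moreover have "0 \<le> m * mass^2" by simp
  ultimately have "sum W Rmax \<le> 1500000 * (m * mass^2)" using 1 2 3 4 5 6 by linarith
  then show ?thesis using sum_R_le_Rmax by linarith
qed

text \<open>In a degenerate triple \<open>b\<close> equals \<open>a\<close> or \<open>c\<close>, and
  \<open>d\<close> is then the other of the two. The weight is the product of the squares at
  \<open>a\<close> and \<open>c\<close>, so each kind adds at most \<open>mass^2\<close>.\<close>

theorem rectangle_sum:
  assumes m: "1 \<le> m"
  shows "sum W {z \<in> S \<times> S \<times> S. vD z \<in> S \<and> right_angle (vA z) (vB z) (vC z)} \<le> 6000002 * m * mass^2"
proof -
  let ?D1 = "(\<lambda>(a, c). (a, a, c)) ` (S \<times> S)" and ?D2 = "(\<lambda>(a, c). (a, c, c)) ` (S \<times> S)"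
  have sq: "(\<Sum>y\<in>S \<times> S. (f (fst y))^2 * (f (snd y))^2) \<le> mass^2"
  proof -
    have "(\<Sum>y\<in>S \<times> S. (f (fst y))^2 * (f (snd y))^2) = (\<Sum>p\<in>S. (f p)^2)^2"
      by (simp only: power2_eq_square[of "sum _ _"] sum_product sum.cartesian_product split_def)
    also have "\<dots> \<le> mass^2" using sum_f_sq by (intro power_mono sum_nonneg) auto
    finally show ?thesis .
  qed
  have D1: "sum W ?D1 \<le> mass^2"
  proof -
    have "sum W ?D1 = (\<Sum>y\<in>S \<times> S. (f (fst y))^2 * (f (snd y))^2)"
      by (subst sum.reindex) (auto simp: inj_on_def W_def vD_def power2_eq_square intro!: sum.cong)
    then show ?thesis using sq by simp
  qed
  have D2: "sum W ?D2 \<le> mass^2"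
  proof -
    have "sum W ?D2 = (\<Sum>y\<in>S \<times> S. (f (fst y))^2 * (f (snd y))^2)"
      by (subst sum.reindex) (auto simp: inj_on_def W_def vD_def power2_eq_square intro!: sum.cong)
    then show ?thesis using sq by simp
  qed
  let ?A = "{z \<in> S \<times> S \<times> S. vD z \<in> S \<and> right_angle (vA z) (vB z) (vC z)}"
  have cover: "?A \<subseteq> R \<union> (?D1 \<union> ?D2)"
  proof
    fix z assume z: "z \<in> ?A"
    obtain a b c where e: "z = (a, b, c)" by (metis surj_pair)
    show "z \<in> R \<union> (?D1 \<union> ?D2)"
    proof (cases "a = b \<or> c = b")
      case True
      then show ?thesis using z e by (auto simp: image_iff)
    next
      case False
      then show ?thesis using z e by (simp add: R_def)
    qed
  qed
  have fin: "finite ?D1" "finite ?D2" using finS by auto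
  have "sum W ?A \<le> sum W R + sum W (?D1 \<union> ?D2)"
    by (rule sum_cover_le[OF _ _ cover]) (use fin in simp_all)
  also have "sum W (?D1 \<union> ?D2) \<le> sum W ?D1 + sum W ?D2"
    by (rule sum_cover_le[OF _ _ subset_refl]) (use fin in simp_all)
  finally have "sum W ?A \<le> 6000000 * m * mass^2 + (mass^2 + mass^2)"
    using nondegenerate_sum[OF m] D1 D2 by linarith
  moreover have "mass^2 \<le> m * mass^2" using m by (simp add: mult_le_cancel_right1)
  ultimately show ?thesis by (simp add: algebra_simps)
qed

end

section \<open>From sorted coefficients to dyadic levels\<close>

lemma floor_log_le_logp:
  assumes "0 < n"
  shows "real (floor_log n) + 1 \<le> 3 * logp (real n)"
proof -
  let ?k = "floor_log n"
  have "2 ^ ?k \<le> n" using floor_log_exp2_le assms .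
  then have "(2::real) ^ ?k \<le> real n" by (metis of_nat_le_iff of_nat_numeral of_nat_power)
  then have "ln ((2::real) ^ ?k) \<le> ln (real n)" using assms by (subst ln_le_cancel_iff) auto
  then have 1: "?k * ln 2 \<le> ln (real n)" by (simp add: ln_realpow)
  \<comment> \<open>This bounds \<open>floor_log n\<close> by 3/2 of \<open>logp n\<close>; the
    summand 1 is absorbed by the maximum in \<open>logp\<close>.\<close>
  have "?k * (2 / 3) \<le> ?k * ln 2" using ln2_ge_two_thirds by (intro mult_left_mono) auto
  then have "?k * (2 / 3) \<le> logp (real n)" using 1 by (simp add: logp_def)
  moreover have "1 \<le> logp (real n)" by (simp add: logp_def)
  ultimately show ?thesis by linarith
qed

text \<open>Cauchy condensation: the term of index i + 1 is at most twice the sum of the squares at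
  the positions from 2^i to 2^(i+1) - 1, none of which is smaller than the sampled one.\<close>

lemma dyadic_decreasing_sum:
  fixes g :: "nat \<Rightarrow> real"
  assumes dec: "\<And>r s. r \<le> s \<Longrightarrow> s < 2 ^ k \<Longrightarrow> g s \<le> g r" and nonneg: "\<And>r. r < 2 ^ k \<Longrightarrow> 0 \<le> g r"
  shows "(\<Sum>i\<le>k. 2 ^ i * (g (2 ^ i - 1))^2) \<le> 2 * (\<Sum>r<2 ^ k. (g r)^2)"
  using assms
proof (induction k)
  case 0
  then show ?case by simp
next
  case (Suc k)
  have IH: "(\<Sum>i\<le>k. 2 ^ i * (g (2 ^ i - 1))^2) \<le> 2 * (\<Sum>r<2 ^ k. (g r)^2)"
    by (rule Suc.IH) (use Suc.prems in auto)
  have "2 ^ k * (g (2 ^ Suc k - 1))^2 = (\<Sum>r\<in>{2 ^ k..<(2::nat) ^ Suc k}. (g (2 ^ Suc k - 1))^2)"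
    by simp
  also have "\<dots> \<le> (\<Sum>r\<in>{2 ^ k..<2 ^ Suc k}. (g r)^2)"
  proof (intro sum_mono power_mono)
    fix r assume "r \<in> {2 ^ k..<(2::nat) ^ Suc k}"
    then have "r \<le> 2 ^ Suc k - 1" by auto
    then show "g (2 ^ Suc k - 1) \<le> g r" by (rule Suc.prems(1)) simp
    show "0 \<le> g (2 ^ Suc k - 1)" by (rule Suc.prems(2)) simp
  qed
  finally have 1: "2 ^ Suc k * (g (2 ^ Suc k - 1))^2 \<le> 2 * (\<Sum>r\<in>{2 ^ k..<2 ^ Suc k}. (g r)^2)" by simp
  have "(\<Sum>r<2 ^ Suc k. (g r)^2) = (\<Sum>r<2 ^ k. (g r)^2) + (\<Sum>r\<in>{2 ^ k..<2 ^ Suc k}. (g r)^2)"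
    unfolding lessThan_atLeast0 by (rule sum.atLeastLessThan_concat[symmetric]) auto
  then show ?case using IH 1 by simp
qed

text \<open>Replacing \<open>f\<close> on each level by its largest value there can only increase
  the left side, and by condensation it at most doubles the sum of squares.\<close>

theorem weighted_rectangle_sum:
  fixes f :: "int \<times> int \<Rightarrow> real"
  assumes S: "finite S" "S \<noteq> {}" and f: "\<And>p. 0 \<le> f p"
  shows "(\<Sum>z\<in>{z \<in> S \<times> S \<times> S. vD z \<in> S \<and> right_angle (vA z) (vB z) (vC z)}. f (vA z) * f (vB z) * f (vC z) * f (vD z))
    \<le> 72000024 * logp (card S) * (\<Sum>p\<in>S. (f p)^2)^2"
proof -
  obtain xs0 where xs0: "set xs0 = S" "distinct xs0" using finite_distinct_list[OF S(1)] by blast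
  define xs where "xs = sort_key (\<lambda>p. - f p) xs0"
  have xs: "set xs = S" "distinct xs" using xs0 by (auto simp: xs_def)
  define n where "n = card S"
  have len: "length xs = n" using xs distinct_card n_def by metis
  have n0: "0 < n" using S by (simp add: n_def card_gt_0_iff)
  define g where "g r = f (xs ! r)" for r
  have dec: "g s \<le> g r" if "r \<le> s" "s < n" for r s
  proof -
    have "sorted (map (\<lambda>p. - f p) xs)" by (simp add: xs_def)
    from sorted_nth_mono[OF this that(1)] show ?thesis using that len by (simp add: g_def)
  qed
  have bij: "bij_betw ((!) xs) {..<n} S" using bij_betw_nth[OF xs(2)] xs(1) len by auto
  define pos where "pos = inv_into {..<n} ((!) xs)"
  have pos: "pos p < n" "xs ! pos p = p" if "p \<in> S" for p
    using bij that unfolding pos_def bij_betw_def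
    by (auto intro: inv_into_into f_inv_into_f simp: inv_into_into[of _ "(!) xs" "{..<n}", unfolded lessThan_iff])
  \<comment> \<open>Positions start at 0; the shift puts the positions from 2^i - 1 to 2^(i+1) - 2
    on level i.\<close>
  define idx where "idx p = floor_log (pos p + 1)" for p
  define m where "m = floor_log n + 1"
  \<comment> \<open>Position 2^i - 1 is the first of level i and carries its largest coefficient;
    dividing \<open>lam i\<close> by \<open>w i\<close> returns that coefficient.\<close>
  define lam where "lam i = sqrt 2 ^ i * g (2 ^ i - 1)" for i
  have two: "2 ^ i \<le> n" if "i < m" for i
  proof -
    have "(2::nat) ^ i \<le> 2 ^ floor_log n" using that by (intro power_increasing) (auto simp: m_def)
    then show ?thesis using floor_log_exp2_le[OF n0] by linarith
  qed
  have idx_bounds: "2 ^ idx p \<le> pos p + 1" "pos p + 1 < 2 * 2 ^ idx p" for p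
    using floor_log_exp2_le[of "pos p + 1"] floor_log_exp2_gt[of "pos p + 1"] by (auto simp: idx_def)
  interpret L: level_sets S idx m lam
  proof
    show "finite S" by fact
    show "idx p < m" if "p \<in> S" for p
      using monoD[OF floor_log_mono, of "pos p + 1" n] pos[OF that] by (simp add: idx_def m_def)
    show "card {p \<in> S. idx p = i} \<le> 2 ^ i" for i
    proof -
      have "card {p \<in> S. idx p = i} \<le> card {2 ^ i - 1..<2 * 2 ^ i - (1::nat)}"
      proof (rule card_inj_on_le)
        show "inj_on pos {p \<in> S. idx p = i}" by (rule inj_onI) (metis (mono_tags, lifting) mem_Collect_eq pos(2))
        show "pos ` {p \<in> S. idx p = i} \<subseteq> {2 ^ i - 1..<2 * 2 ^ i - (1::nat)}"
        proof
          fix r assume "r \<in> pos ` {p \<in> S. idx p = i}"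
          then obtain p where "r = pos p" "idx p = i" by blast
          then show "r \<in> {2 ^ i - 1..<2 * 2 ^ i - (1::nat)}" using idx_bounds[of p] by auto
        qed
      qed simp
      also have "\<dots> \<le> 2 ^ i" by simp
      finally show ?thesis .
    qed
    show "0 \<le> lam i" for i using f by (simp add: lam_def g_def)
  qed
  have fle: "f p \<le> L.f p" if "p \<in> S" for p
  proof -
    have "L.f p = g (2 ^ idx p - 1)" by (simp add: L.f_def lam_def L.w_def)
    moreover have "g (pos p) \<le> g (2 ^ idx p - 1)" using idx_bounds[of p] pos[OF that] by (intro dec) auto
    ultimately show ?thesis using pos[OF that] by (simp add: g_def)
  qed
  have mass: "L.mass \<le> 2 * (\<Sum>p\<in>S. (f p)^2)"
  proof -
    let ?k = "floor_log n"
    have "L.mass = (\<Sum>i<m. (lam i)^2)" by (rule L.mass_def)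
    also have "\<dots> = (\<Sum>i\<le>?k. 2 ^ i * (g (2 ^ i - 1))^2)"
      unfolding lam_def
      by (intro sum.cong) (auto simp: m_def power_mult_distrib L.w_sq[unfolded L.w_def])
    also have "\<dots> \<le> 2 * (\<Sum>r<2 ^ ?k. (g r)^2)"
    proof (rule dyadic_decreasing_sum)
      have "2 ^ ?k \<le> n" using floor_log_exp2_le[OF n0] .
      then show "g s \<le> g r" if "r \<le> s" "s < 2 ^ ?k" for r s using that by (intro dec) auto
      show "0 \<le> g r" for r using f by (simp add: g_def)
    qed
    also have "(\<Sum>r<2 ^ ?k. (g r)^2) \<le> (\<Sum>r<n. (g r)^2)"
      using floor_log_exp2_le[OF n0] by (intro sum_mono2) auto
    also have "(\<Sum>r<n. (g r)^2) = (\<Sum>p\<in>S. (f p)^2)"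
      unfolding g_def by (rule sum.reindex_bij_betw[OF bij])
    finally show ?thesis by simp
  qed
  let ?A = "{z \<in> S \<times> S \<times> S. vD z \<in> S \<and> right_angle (vA z) (vB z) (vC z)}"
  have "(\<Sum>z\<in>?A. f (vA z) * f (vB z) * f (vC z) * f (vD z)) \<le> sum L.W ?A"
  proof (rule sum_mono)
    fix z assume z: "z \<in> ?A"
    then have "vA z \<in> S" "vB z \<in> S" "vC z \<in> S" "vD z \<in> S" by (auto simp: mem_Times_iff)
    then show "f (vA z) * f (vB z) * f (vC z) * f (vD z) \<le> L.W z"
      unfolding L.W_def using fle f by (intro mult_mono mult_nonneg_nonneg) auto
  qed
  also have "\<dots> \<le> 6000002 * m * L.mass^2" by (rule L.rectangle_sum) (simp add: m_def)
  also have "\<dots> \<le> 6000002 * (3 * logp n) * (2 * (\<Sum>p\<in>S. (f p)^2))^2"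
  proof -
    have "real m \<le> 3 * logp n" using floor_log_le_logp[OF n0] by (simp add: m_def)
    moreover have "1 \<le> logp n" by (simp add: logp_def)
    ultimately show ?thesis using mass by (intro mult_mono power_mono) auto
  qed
  also have "\<dots> = 72000024 * logp n * (\<Sum>p\<in>S. (f p)^2)^2" by (simp add: power_mult_distrib)
  finally show ?thesis by (simp add: n_def)
qed

subsection \<open>Fourier analysis on the torus\<close>

definition tchr :: "int \<Rightarrow> real \<Rightarrow> complex" where
  "tchr n t = exp (\<i> * complex_of_real (of_int n * t))"

lemma continuous_on_tchr: "continuous_on A (tchr n)"
  unfolding tchr_def by (intro continuous_intros)

lemma integral_tchr: "(LINT t:{0..2*pi}|lborel. tchr n t) = (if n = 0 then complex_of_real (2 * pi) else 0)"
proof -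
  have int: "set_integrable lborel {0..2*pi} (tchr n)"
    unfolding set_integrable_def by (intro borel_integrable_compact compact_Icc continuous_on_tchr)
  have eq: "(LINT t:{0..2*pi}|lborel. tchr n t) = integral {0..2*pi} (tchr n)"
    using set_borel_integral_eq_integral(2)[OF int] by simp
  show ?thesis
  proof (cases "n = 0")
    case True
    then have "tchr n = (\<lambda>_. 1)" by (simp add: tchr_def fun_eq_iff)
    then show ?thesis unfolding eq using True by (simp add: scaleR_conv_of_real)
  next
    case False
    define al where "al = \<i> * of_int n"
    have al: "al \<noteq> 0" using False by (simp add: al_def)
    have t: "tchr n t = exp (al * of_real t)" for t by (simp add: tchr_def al_def mult.assoc)
    have "(tchr n has_integral (exp (al * of_real (2*pi)) / al - exp (al * of_real 0) / al)) {0..2*pi}"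
    proof (rule fundamental_theorem_of_calculus)
      fix t :: real
      have "((\<lambda>z. exp (al * z) / al) has_field_derivative exp (al * of_real t)) (at (of_real t))"
        using al by (auto intro!: derivative_eq_intros)
      from has_vector_derivative_real_field[OF this, of "{0..2*pi}"]
      show "((\<lambda>t. exp (al * of_real t) / al) has_vector_derivative tchr n t) (at t within {0..2*pi})"
        unfolding t .
    qed simp
    moreover have "exp (al * of_real (2*pi)) = 1"
      by (subst exp_eq_1) (auto simp: al_def intro!: exI[of _ n])
    ultimately show ?thesis unfolding eq using False by (simp add: integral_unique)
  qed
qed

lemma set_integrable_compact:
  fixes f :: "'a::euclidean_space \<Rightarrow> 'b::{banach, second_countable_topology}"
  assumes "compact A" "continuous_on A f"
  shows "set_integrable lborel A f"
  unfolding set_integrable_def using borel_integrable_compact[OF assms] .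

lemma integral_prod_Times:
  fixes f :: "'a::euclidean_space \<Rightarrow> complex" and g :: "'b::euclidean_space \<Rightarrow> complex"
  assumes "compact A" "compact B" "continuous_on A f" "continuous_on B g"
  shows "(LINT z:A \<times> B|lborel. f (fst z) * g (snd z)) = (LINT x:A|lborel. f x) * (LINT y:B|lborel. g y)"
proof -
  let ?h = "\<lambda>z. indicator (A \<times> B) z *\<^sub>R (f (fst z) * g (snd z))"
  have "continuous_on (A \<times> B) (\<lambda>z. f (fst z) * g (snd z))"
    by (intro continuous_on_mult continuous_on_compose2[OF assms(3) continuous_on_fst[OF continuous_on_id]]
        continuous_on_compose2[OF assms(4) continuous_on_snd[OF continuous_on_id]]) auto
  then have "integrable lborel ?h" using assms by (intro borel_integrable_compact compact_Times)
  then have int: "integrable (lborel \<Otimes>\<^sub>M lborel) ?h" by (simp add: lborel_prod)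
  have "(LINT z:A \<times> B|lborel. f (fst z) * g (snd z)) = integral\<^sup>L (lborel \<Otimes>\<^sub>M lborel) ?h"
    by (simp add: set_lebesgue_integral_def lborel_prod)
  also have "\<dots> = (\<integral>x. (\<integral>y. ?h (x, y) \<partial>lborel) \<partial>lborel)"
    by (rule lborel_pair.integral_fst'[OF int, symmetric])
  also have "\<dots> = (\<integral>x. (indicator A x *\<^sub>R f x) * (\<integral>y. indicator B y *\<^sub>R g y \<partial>lborel) \<partial>lborel)"
  proof (rule Bochner_Integration.integral_cong[OF refl])
    fix x :: 'a
    have "(\<integral>y. ?h (x, y) \<partial>lborel) = (\<integral>y. (indicator A x *\<^sub>R f x) * (indicator B y *\<^sub>R g y) \<partial>lborel)"
      by (intro Bochner_Integration.integral_cong) (auto simp: indicator_def)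
    then show "(\<integral>y. ?h (x, y) \<partial>lborel) = (indicator A x *\<^sub>R f x) * (\<integral>y. indicator B y *\<^sub>R g y \<partial>lborel)"
      by (simp only: integral_mult_right_zero)
  qed
  also have "\<dots> = (LINT x:A|lborel. f x) * (LINT y:B|lborel. g y)"
    unfolding set_lebesgue_integral_def by (rule integral_mult_left_zero)
  finally show ?thesis .
qed

definition chr :: "int \<times> int \<Rightarrow> real \<times> real \<Rightarrow> complex" where
  "chr \<xi> x = exp (\<i> * complex_of_real (of_int (fst \<xi>) * fst x + of_int (snd \<xi>) * snd x))"

lemma continuous_on_chr [continuous_intros]: "continuous_on A (chr \<xi>)"
  unfolding chr_def by (intro continuous_intros)

lemma compact_torus_box [simp]: "compact torus_box"
  unfolding torus_box_def by (intro compact_Times compact_Icc)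

lemma chr_measurable [measurable]: "chr \<xi> \<in> borel_measurable borel"
  by (rule borel_measurable_continuous_onI) (rule continuous_on_chr)

lemma chr_add: "chr (\<xi> + \<eta>) x = chr \<xi> x * chr \<eta> x"
  by (simp add: chr_def algebra_simps flip: exp_add)

lemma chr_cnj: "cnj (chr \<xi> x) = chr (- \<xi>) x"
  by (simp add: chr_def exp_cnj algebra_simps)

lemma norm_chr [simp]: "cmod (chr \<xi> x) = 1" by (simp add: chr_def)

lemma integral_chr: "(LINT x:torus_box|lborel. chr \<xi> x) = (if \<xi> = 0 then complex_of_real ((2 * pi)^2) else 0)"
proof -
  have "chr \<xi> = (\<lambda>x. tchr (fst \<xi>) (fst x) * tchr (snd \<xi>) (snd x))"
    by (simp add: fun_eq_iff chr_def tchr_def distrib_left exp_add)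
  then have "(LINT x:torus_box|lborel. chr \<xi> x) = (LINT t:{0..2*pi}|lborel. tchr (fst \<xi>) t) * (LINT t:{0..2*pi}|lborel. tchr (snd \<xi>) t)"
    unfolding torus_box_def
    using integral_prod_Times[OF compact_Icc compact_Icc continuous_on_tchr continuous_on_tchr] by simp
  then show ?thesis by (simp add: integral_tchr power2_eq_square prod_eq_iff)
qed

lemma integral_tchr_chr:
  "(LINT p:{0..2*pi} \<times> torus_box|lborel. tchr n (fst p) * chr \<xi> (snd p))
    = (if n = 0 \<and> \<xi> = 0 then complex_of_real ((2 * pi)^3) else 0)"
  by (subst integral_prod_Times[OF compact_Icc compact_torus_box continuous_on_tchr continuous_on_chr])
    (simp add: integral_tchr integral_chr power2_eq_square power3_eq_cube)

lemma set_integral_sum: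
  fixes f :: "'i \<Rightarrow> 'a \<Rightarrow> 'b::{banach, second_countable_topology}"
  assumes "\<And>i. i \<in> I \<Longrightarrow> set_integrable M A (f i)"
  shows "(LINT x:A|M. (\<Sum>i\<in>I. f i x)) = (\<Sum>i\<in>I. LINT x:A|M. f i x)"
  using assms unfolding set_lebesgue_integral_def set_integrable_def scaleR_sum_right
  by (intro Bochner_Integration.integral_sum)

lemma fourier_coeff_chr:
  "complex_of_real ((2 * pi)^2) * fourier_coeff \<phi> \<xi> = (LINT x:torus_box|lborel. \<phi> x * cnj (chr \<xi> x))"
proof -
  have "(\<lambda>x. \<phi> x * exp (- \<i> * complex_of_real (of_int (fst \<xi>) * fst x + of_int (snd \<xi>) * snd x))) = (\<lambda>x. \<phi> x * cnj (chr \<xi> x))"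
    by (simp add: chr_def exp_cnj)
  then show ?thesis unfolding fourier_coeff_def by simp
qed

text \<open>Expand the integral of |phi - g|^2 \<ge> 0, where g is the Fourier sum over
  \<open>S\<close>. The inner product of phi with g and that of g with itself both equal
  \<open>K * s\<close>, so the terms with g combine to \<open>- K * s\<close>.\<close>

lemma bessel:
  fixes \<phi> :: "real \<times> real \<Rightarrow> complex"
  assumes S: "finite S" and meas: "\<phi> \<in> borel_measurable lborel"
    and L2: "set_integrable lborel torus_box (\<lambda>x. (cmod (\<phi> x))^2)"
  shows "(2 * pi)^2 * (\<Sum>\<xi>\<in>S. (cmod (fourier_coeff \<phi> \<xi>))^2) \<le> (LINT x:torus_box|lborel. (cmod (\<phi> x))^2)"
proof -
  let ?c = "fourier_coeff \<phi>"
  define K where "K = complex_of_real ((2 * pi)^2)"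
  define s where "s = complex_of_real (\<Sum>\<xi>\<in>S. (cmod (?c \<xi>))^2)"
  define g where "g x = (\<Sum>\<xi>\<in>S. ?c \<xi> * chr \<xi> x)" for x
  have tb: "torus_box \<in> sets lborel" using compact_torus_box by (simp add: borel_compact)
  \<comment> \<open>The box has finite measure, so square integrability implies integrability; this
    makes the Fourier coefficients genuine integrals.\<close>
  have phi_int: "set_integrable lborel torus_box \<phi>"
  proof -
    have "set_integrable lborel torus_box (\<lambda>x. 1 + (cmod (\<phi> x))^2)"
      by (intro set_integral_add L2 set_integrable_compact) auto
    then show ?thesis
    proof (rule set_integrable_bound)
      show "set_borel_measurable lborel torus_box \<phi>" unfolding set_borel_measurable_def using meas tb by measurable
      have "cmod (\<phi> x) \<le> norm (1 + (cmod (\<phi> x))^2)" for x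
      proof -
        have "2 * cmod (\<phi> x) \<le> 1 + (cmod (\<phi> x))^2" using sum_squares_bound[of 1 "cmod (\<phi> x)"] by simp
        then have "cmod (\<phi> x) \<le> 1 + (cmod (\<phi> x))^2" using norm_ge_zero[of "\<phi> x"] by linarith
        then show ?thesis by simp
      qed
      then show "AE x in lborel. x \<in> torus_box \<longrightarrow> norm (\<phi> x) \<le> norm (1 + (cmod (\<phi> x))^2)" by simp
    qed
  qed
  have phi_chr: "set_integrable lborel torus_box (\<lambda>x. \<phi> x * cnj (chr \<xi> x))" for \<xi>
  proof (rule set_integrable_bound[OF phi_int])
    show "set_borel_measurable lborel torus_box (\<lambda>x. \<phi> x * cnj (chr \<xi> x))"
      unfolding set_borel_measurable_def chr_cnj using meas tb by measurable
  qed (simp add: norm_mult)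
  have gcont: "continuous_on A g" for A unfolding g_def by (intro continuous_intros)
  have phi_g: "set_integrable lborel torus_box (\<lambda>x. \<phi> x * cnj (g x))"
    and phi_g_eq: "(LINT x:torus_box|lborel. \<phi> x * cnj (g x)) = K * s"
  proof -
    have e: "\<phi> x * cnj (g x) = (\<Sum>\<xi>\<in>S. cnj (?c \<xi>) * (\<phi> x * cnj (chr \<xi> x)))" for x
      by (simp add: g_def sum_distrib_left mult_ac)
    have i: "set_integrable lborel torus_box (\<lambda>x. cnj (?c \<xi>) * (\<phi> x * cnj (chr \<xi> x)))" for \<xi>
      by (intro set_integrable_mult_right phi_chr)
    show "set_integrable lborel torus_box (\<lambda>x. \<phi> x * cnj (g x))"
      unfolding e using i unfolding set_integrable_def scaleR_sum_right by (intro Bochner_Integration.integrable_sum)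
    have "(LINT x:torus_box|lborel. \<phi> x * cnj (g x)) = (\<Sum>\<xi>\<in>S. cnj (?c \<xi>) * (K * ?c \<xi>))"
      unfolding e K_def fourier_coeff_chr by (subst set_integral_sum[OF i]) simp
    also have "\<dots> = K * s"
      unfolding s_def of_real_sum sum_distrib_left by (intro sum.cong) (simp_all add: complex_norm_square mult_ac del: of_real_power)
    finally show "(LINT x:torus_box|lborel. \<phi> x * cnj (g x)) = K * s" .
  qed
  have g_g: "set_integrable lborel torus_box (\<lambda>x. g x * cnj (g x))"
    by (intro set_integrable_compact continuous_intros gcont) simp
  have g_g_eq: "(LINT x:torus_box|lborel. g x * cnj (g x)) = K * s"
  proof -
    have e: "g x * cnj (g x) = (\<Sum>\<xi>\<in>S. \<Sum>\<eta>\<in>S. (?c \<xi> * cnj (?c \<eta>)) * chr (\<xi> - \<eta>) x)" for x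
    proof -
      have "chr (\<xi> - \<eta>) x = chr \<xi> x * cnj (chr \<eta> x)" for \<xi> \<eta>
        using chr_add[of \<xi> "- \<eta>" x] by (simp add: chr_cnj)
      then show ?thesis unfolding g_def cnj_sum sum_product by (intro sum.cong refl) (simp add: mult_ac)
    qed
    have i1: "set_integrable lborel torus_box (\<lambda>x. (?c \<xi> * cnj (?c \<eta>)) * chr (\<xi> - \<eta>) x)" for \<xi> \<eta>
      by (intro set_integrable_compact continuous_intros) simp
    have i2: "set_integrable lborel torus_box (\<lambda>x. \<Sum>\<eta>\<in>S. (?c \<xi> * cnj (?c \<eta>)) * chr (\<xi> - \<eta>) x)" for \<xi>
      by (intro set_integrable_compact continuous_intros) simp
    have "(LINT x:torus_box|lborel. g x * cnj (g x)) = (\<Sum>\<xi>\<in>S. \<Sum>\<eta>\<in>S. (?c \<xi> * cnj (?c \<eta>)) * (if \<xi> - \<eta> = 0 then K else 0))"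
      unfolding e by (simp add: set_integral_sum[OF i2] set_integral_sum[OF i1] integral_chr[folded K_def])
    also have "\<dots> = (\<Sum>\<xi>\<in>S. (?c \<xi> * cnj (?c \<xi>)) * K)"
      using S by (intro sum.cong refl) (simp add: if_distrib[of "(*) _"] sum.delta cong: if_cong)
    also have "\<dots> = K * s"
      unfolding s_def of_real_sum sum_distrib_left by (intro sum.cong) (simp_all add: complex_norm_square mult_ac del: of_real_power)
    finally show ?thesis .
  qed
  have re: "set_integrable lborel torus_box (\<lambda>x. Re (h x))" "(LINT x:torus_box|lborel. Re (h x)) = Re (LINT x:torus_box|lborel. h x)"
    if "set_integrable lborel torus_box h" for h :: "real \<times> real \<Rightarrow> complex"
  proof -
    have e: "indicator torus_box x *\<^sub>R Re (h x) = Re (indicator torus_box x *\<^sub>R h x)" for x by simp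
    note i = that[unfolded set_integrable_def]
    show "set_integrable lborel torus_box (\<lambda>x. Re (h x))"
      unfolding set_integrable_def e using i by (rule integrable_Re)
    show "(LINT x:torus_box|lborel. Re (h x)) = Re (LINT x:torus_box|lborel. h x)"
      unfolding set_lebesgue_integral_def e using i by (rule integral_Re)
  qed
  have expand: "(cmod (\<phi> x - g x))^2 = (cmod (\<phi> x))^2 + (Re (g x * cnj (g x)) - 2 * Re (\<phi> x * cnj (g x)))" for x
    by (simp only: cmod_power2) (simp add: power2_eq_square algebra_simps)
  have "0 \<le> (LINT x:torus_box|lborel. (cmod (\<phi> x - g x))^2)"
    unfolding set_lebesgue_integral_def by (intro integral_nonneg_AE) (auto simp: indicator_def)
  also have "\<dots> = (LINT x:torus_box|lborel. (cmod (\<phi> x))^2) + (Re (K * s) - 2 * Re (K * s))"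
  proof -
    have i: "set_integrable lborel torus_box (\<lambda>x. 2 * Re (\<phi> x * cnj (g x)))"
      by (intro set_integrable_mult_right re(1) phi_g)
    have "(LINT x:torus_box|lborel. 2 * Re (\<phi> x * cnj (g x))) = 2 * Re (K * s)"
      unfolding set_integral_mult_right re(2)[OF phi_g] phi_g_eq ..
    moreover have "(LINT x:torus_box|lborel. Re (g x * cnj (g x))) = Re (K * s)"
      unfolding re(2)[OF g_g] g_g_eq ..
    ultimately show ?thesis unfolding expand
      using set_integral_add(2)[OF L2 set_integral_diff(1)[OF re(1)[OF g_g] i]]
        set_integral_diff(2)[OF re(1)[OF g_g] i] by simp
  qed
  also have "Re (K * s) = (2 * pi)^2 * (\<Sum>\<xi>\<in>S. (cmod (?c \<xi>))^2)"
    unfolding K_def s_def of_real_mult[symmetric] by (rule Re_complex_of_real)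
  finally show ?thesis by linarith
qed

section \<open>The fourth moment as a sum over resonant quadruples\<close>

definition nsq :: "int \<times> int \<Rightarrow> int" where "nsq \<xi> = (fst \<xi>)^2 + (snd \<xi>)^2"

text \<open>Write |u|^4 as the square of u * cnj u and integrate term by term: only the quadruples
  with vanishing total frequency in time and in space survive. Their coefficients may have any
  phase, so passing to absolute values leaves an inequality.\<close>

lemma L4_expansion:
  fixes c :: "int \<times> int \<Rightarrow> complex"
  assumes S: "finite S"
  defines "u \<equiv> \<lambda>t x. (\<Sum>\<xi>\<in>S. exp (- \<i> * complex_of_real (t * of_int (nsq \<xi>))) * c \<xi> * chr \<xi> x)"
  shows "(LINT p:{0..2*pi} \<times> torus_box|lborel. (cmod (u (fst p) (snd p)))^4)
    \<le> (2 * pi)^3 * (\<Sum>q | q \<in> (S \<times> S) \<times> (S \<times> S) \<and>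
        nsq (snd (fst q)) - nsq (fst (fst q)) + (nsq (snd (snd q)) - nsq (fst (snd q))) = 0 \<and>
        fst (fst q) - snd (fst q) + (fst (snd q) - snd (snd q)) = 0.
        (cmod (c (fst (fst q))) * cmod (c (snd (fst q)))) * (cmod (c (fst (snd q))) * cmod (c (snd (snd q)))))"
proof -
  let ?B = "{0..2*pi} \<times> torus_box"
  let ?Q = "(S \<times> S) \<times> (S \<times> S)"
  define tm where "tm y = c (fst y) * cnj (c (snd y))" for y
  define dn where "dn y = nsq (snd y) - nsq (fst y)" for y
  define dx where "dx y = fst y - snd y" for y :: "(int \<times> int) \<times> (int \<times> int)"
  have e_add: "tchr (n + k) t = tchr n t * tchr k t" for n k t
    by (simp add: tchr_def algebra_simps flip: exp_add)
  have e_cnj: "cnj (tchr n t) = tchr (- n) t" for n t by (simp add: tchr_def exp_cnj)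
  have u_eq: "u t x = (\<Sum>\<xi>\<in>S. c \<xi> * (tchr (- nsq \<xi>) t * chr \<xi> x))" for t x
    unfolding u_def by (intro sum.cong) (auto simp: tchr_def mult_ac)
  have uu: "u t x * cnj (u t x) = (\<Sum>y\<in>S \<times> S. tm y * (tchr (dn y) t * chr (dx y) x))" for t x
  proof -
    have "u t x * cnj (u t x) = (\<Sum>y\<in>S \<times> S. (c (fst y) * (tchr (- nsq (fst y)) t * chr (fst y) x)) * cnj (c (snd y) * (tchr (- nsq (snd y)) t * chr (snd y) x)))"
      unfolding u_eq cnj_sum sum_product sum.cartesian_product by (simp only: split_def)
    also have "\<dots> = (\<Sum>y\<in>S \<times> S. tm y * (tchr (dn y) t * chr (dx y) x))"
    proof (rule sum.cong[OF refl])
      fix y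
      have "tchr (dn y) t = tchr (- nsq (fst y)) t * tchr (nsq (snd y)) t" using e_add[of "- nsq (fst y)" "nsq (snd y)" t] by (simp add: dn_def)
      moreover have "chr (dx y) x = chr (fst y) x * chr (- snd y) x" using chr_add[of "fst y" "- snd y" x] by (simp add: dx_def)
      ultimately show "(c (fst y) * (tchr (- nsq (fst y)) t * chr (fst y) x)) * cnj (c (snd y) * (tchr (- nsq (snd y)) t * chr (snd y) x)) = tm y * (tchr (dn y) t * chr (dx y) x)"
        by (simp add: tm_def e_cnj chr_cnj mult_ac)
    qed
    finally show ?thesis .
  qed
  have u4: "complex_of_real ((cmod (u t x))^4) = (\<Sum>q\<in>?Q. (tm (fst q) * tm (snd q)) * (tchr (dn (fst q) + dn (snd q)) t * chr (dx (fst q) + dx (snd q)) x))" for t x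
  proof -
    have "complex_of_real ((cmod (u t x))^4) = (u t x * cnj (u t x)) * (u t x * cnj (u t x))"
      unfolding complex_norm_square[symmetric] by (simp flip: of_real_mult add: power_add[symmetric])
    also have "\<dots> = (\<Sum>q\<in>?Q. (tm (fst q) * (tchr (dn (fst q)) t * chr (dx (fst q)) x)) * (tm (snd q) * (tchr (dn (snd q)) t * chr (dx (snd q)) x)))"
      unfolding uu sum_product sum.cartesian_product by (simp only: split_def)
    also have "\<dots> = (\<Sum>q\<in>?Q. (tm (fst q) * tm (snd q)) * (tchr (dn (fst q) + dn (snd q)) t * chr (dx (fst q) + dx (snd q)) x))"
      by (intro sum.cong refl) (simp add: e_add chr_add mult_ac)
    finally show ?thesis .
  qed
  have int: "set_integrable lborel ?B (\<lambda>p. a * (tchr n (fst p) * chr \<xi> (snd p)))" for a n \<xi>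
    unfolding tchr_def chr_def
    by (intro set_integrable_compact compact_Times compact_Icc compact_torus_box continuous_intros)
  let ?X = "LINT p:?B|lborel. (cmod (u (fst p) (snd p)))^4"
  have "complex_of_real ?X = (LINT p:?B|lborel. complex_of_real ((cmod (u (fst p) (snd p)))^4))"
    by (rule set_integral_complex_of_real[symmetric])
  also have "\<dots> = (\<Sum>q\<in>?Q. (tm (fst q) * tm (snd q)) * (if dn (fst q) + dn (snd q) = 0 \<and> dx (fst q) + dx (snd q) = 0 then complex_of_real ((2 * pi)^3) else 0))"
    unfolding u4
    by (subst set_integral_sum[OF int]) (simp add: integral_tchr_chr)
  finally have eq: "complex_of_real ?X = (\<Sum>q\<in>?Q. (tm (fst q) * tm (snd q)) * (if dn (fst q) + dn (snd q) = 0 \<and> dx (fst q) + dx (snd q) = 0 then complex_of_real ((2 * pi)^3) else 0))" .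
  have "?X \<le> cmod (complex_of_real ?X)" by simp
  also have "\<dots> \<le> (\<Sum>q\<in>?Q. cmod ((tm (fst q) * tm (snd q)) * (if dn (fst q) + dn (snd q) = 0 \<and> dx (fst q) + dx (snd q) = 0 then complex_of_real ((2 * pi)^3) else 0)))"
    unfolding eq by (rule norm_sum)
  also have "\<dots> = (\<Sum>q\<in>?Q. if dn (fst q) + dn (snd q) = 0 \<and> dx (fst q) + dx (snd q) = 0 then (2 * pi)^3 * (cmod (tm (fst q)) * cmod (tm (snd q))) else 0)"
    by (intro sum.cong refl) (simp add: norm_mult norm_power)
  also have "\<dots> = (2 * pi)^3 * (\<Sum>q | q \<in> ?Q \<and> dn (fst q) + dn (snd q) = 0 \<and> dx (fst q) + dx (snd q) = 0. cmod (tm (fst q)) * cmod (tm (snd q)))"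
    using S unfolding sum_distrib_left by (intro sum.inter_filter[symmetric]) simp
  finally show ?thesis by (simp add: tm_def dn_def dx_def norm_mult)
qed

text \<open>With d = a - b + c, the time frequency |b|^2 - |a|^2 + |d|^2 - |c|^2 is twice the inner
  product of a - b and c - b. Resonance is therefore a right angle at \<open>b\<close>.\<close>

lemma resonant_sum_le:
  fixes f :: "int \<times> int \<Rightarrow> real"
  assumes S: "finite S" and f: "\<And>p. 0 \<le> f p"
  shows "(\<Sum>q | q \<in> (S \<times> S) \<times> (S \<times> S) \<and>
        nsq (snd (fst q)) - nsq (fst (fst q)) + (nsq (snd (snd q)) - nsq (fst (snd q))) = 0 \<and>
        fst (fst q) - snd (fst q) + (fst (snd q) - snd (snd q)) = 0.
        (f (fst (fst q)) * f (snd (fst q))) * (f (fst (snd q)) * f (snd (snd q))))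
    \<le> (\<Sum>z\<in>{z \<in> S \<times> S \<times> S. vD z \<in> S \<and> right_angle (vA z) (vB z) (vC z)}. f (vA z) * f (vB z) * f (vC z) * f (vD z))"
    (is "sum ?g ?Q \<le> sum ?h ?A")
proof -
  let ?p = "\<lambda>q :: ((int \<times> int) \<times> (int \<times> int)) \<times> ((int \<times> int) \<times> (int \<times> int)). (fst (fst q), snd (fst q), fst (snd q))"
  have d: "snd (snd q) = vD (?p q)" if "q \<in> ?Q" for q
    using that by (simp add: vD_def algebra_simps)
  have "sum ?g ?Q = (\<Sum>q\<in>?Q. ?h (?p q))"
    by (intro sum.cong refl) (simp add: d[symmetric] mult.assoc)
  also have "\<dots> = sum ?h (?p ` ?Q)"
  proof (rule sum.reindex_cong[symmetric, where l = ?p])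
    show "inj_on ?p ?Q"
    proof (rule inj_onI)
      fix q q' assume q: "q \<in> ?Q" "q' \<in> ?Q" "?p q = ?p q'"
      then have "snd (snd q) = snd (snd q')" using d[OF q(1)] d[OF q(2)] by simp
      then show "q = q'" using q(3) by (simp add: prod_eq_iff)
    qed
  qed auto
  also have "\<dots> \<le> sum ?h ?A"
  proof (rule sum_mono2)
    show "finite ?A" using S by (intro finite_Collect_conjI disjI1) auto
    show "?p ` ?Q \<subseteq> ?A"
    proof
      fix z assume "z \<in> ?p ` ?Q"
      then obtain q where q: "q \<in> ?Q" "z = ?p q" by blast
      have n: "nsq (snd (fst q)) - nsq (fst (fst q)) + (nsq (vD z) - nsq (fst (snd q))) = 0"
        using q d[OF q(1)] by simp
      have "2 * ((fst (vA z) - fst (vB z)) * (fst (vC z) - fst (vB z)) + (snd (vA z) - snd (vB z)) * (snd (vC z) - snd (vB z)))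
          = nsq (vB z) - nsq (vA z) + (nsq (vD z) - nsq (vC z))"
        by (simp add: nsq_def vD_def power2_eq_square algebra_simps)
      also have "\<dots> = 0" using n q(2) by simp
      finally have "right_angle (vA z) (vB z) (vC z)" by (simp add: right_angle_def)
      moreover have "vD z \<in> S" using d[OF q(1)] q by (simp add: mem_Times_iff)
      ultimately show "z \<in> ?A" using q by (simp add: mem_Times_iff)
    qed
    show "0 \<le> ?h z" if "z \<in> ?A - ?p ` ?Q" for z using f by simp
  qed
  finally show ?thesis .
qed

theorem theorem1p1:
  shows "\<exists>c>0. \<forall>(S :: (int \<times> int) set) (\<phi> :: real \<times> real \<Rightarrow> complex).
    finite S \<and> S \<noteq> {} \<and> \<phi> \<in> borel_measurable lborel \<and>
    set_integrable lborel torus_box (\<lambda>x. (cmod (\<phi> x))^2) \<longrightarrow>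
    L4_time_torus (schrod_proj S \<phi>) \<le> c * (logp (real (card S))) powr (1/4) * L2_torus \<phi>"
proof (intro exI[of _ "72000024 powr (1/4)"] conjI allI impI)
  fix S :: "(int \<times> int) set" and \<phi> :: "real \<times> real \<Rightarrow> complex"
  assume a: "finite S \<and> S \<noteq> {} \<and> \<phi> \<in> borel_measurable lborel \<and>
    set_integrable lborel torus_box (\<lambda>x. (cmod (\<phi> x))^2)"
  let ?K = "72000024 :: real"
  let ?f = "\<lambda>\<xi>. cmod (fourier_coeff \<phi> \<xi>)"
  define X where "X = (LINT p:{0..2*pi} \<times> torus_box|lborel. (cmod (schrod_proj S \<phi> (fst p) (snd p)))^4)"
  define I where "I = (LINT x:torus_box|lborel. (cmod (\<phi> x))^2)"
  define s where "s = (\<Sum>\<xi>\<in>S. (?f \<xi>)^2)"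
  define lg where "lg = logp (real (card S))"
  have lg: "1 \<le> lg" by (simp add: lg_def logp_def)
  have s0: "0 \<le> s" by (simp add: s_def sum_nonneg)
  have X0: "0 \<le> X" unfolding X_def set_lebesgue_integral_def by (intro integral_nonneg_AE) (auto simp: indicator_def)
  have I0: "0 \<le> I" unfolding I_def set_lebesgue_integral_def by (intro integral_nonneg_AE) (auto simp: indicator_def)
  have proj: "schrod_proj S \<phi> = (\<lambda>t x. \<Sum>\<xi>\<in>S. exp (- \<i> * complex_of_real (t * of_int (nsq \<xi>))) * fourier_coeff \<phi> \<xi> * chr \<xi> x)"
    by (simp add: fun_eq_iff schrod_proj_def nsq_def chr_def)
  have "X \<le> (2 * pi)^3 * (?K * lg * s^2)"
    unfolding X_def proj lg_def s_def
    by (rule order_trans[OF L4_expansion], use a in simp,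
        intro mult_left_mono order_trans[OF resonant_sum_le weighted_rectangle_sum]) (use a in auto)
  also have "\<dots> \<le> ?K * lg * I^2"
  proof -
    have b: "(2 * pi)^2 * s \<le> I" unfolding s_def I_def using a by (intro bessel) auto
    \<comment> \<open>The square of Bessel's inequality carries (2 pi)^4 while orthogonality on
      space-time gives (2 pi)^3; the surplus factor is greater than 1.\<close>
    have "(2 * pi)^3 * s^2 \<le> (2 * pi)^4 * s^2"
      using pi_gt3 by (intro mult_right_mono power_increasing) auto
    also have "\<dots> = ((2 * pi)^2 * s)^2" by (simp add: power_mult_distrib)
    also have "\<dots> \<le> I^2" using b s0 by (intro power_mono) auto
    finally have "?K * lg * ((2 * pi)^3 * s^2) \<le> ?K * lg * I^2" using lg by (intro mult_left_mono) auto
    then show ?thesis by (simp add: mult_ac)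
  qed
  finally have X: "X \<le> ?K * lg * I^2" .
  have "L4_time_torus (schrod_proj S \<phi>) = X powr (1/4)" by (simp add: L4_time_torus_def X_def)
  also have "\<dots> \<le> (?K * lg * I^2) powr (1/4)" using X X0 by (intro powr_mono2) auto
  also have "\<dots> = ?K powr (1/4) * lg powr (1/4) * (I^2) powr (1/4)"
    using lg I0 by (simp add: powr_mult)
  \<comment> \<open>The exponents are combined for a positive base only; for I = 0 both sides are
    0.\<close>
  also have "(I^2) powr (1/4) = L2_torus \<phi>"
  proof (cases "I = 0")
    case False
    then have "(I^2) powr (1/4) = I powr (1/2)" using I0 by (simp add: powr_realpow[symmetric] powr_powr flip: powr_numeral)
    then show ?thesis using I0 by (simp add: L2_torus_def I_def powr_half_sqrt)
  qed (simp add: L2_torus_def I_def)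
  finally show "L4_time_torus (schrod_proj S \<phi>) \<le> ?K powr (1/4) * (logp (real (card S))) powr (1/4) * L2_torus \<phi>"
    by (simp add: lg_def)
qed simp

end
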